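(* Let $\Omega\subseteq\mathbb R^n$ be an open set satisfying the cone condition $(h_1)$ stated in the context. Let $r\in\mathbb N$ and let $p,q$ be real numbers with $1\le p\le q<+\infty$, $q\ge \frac nr$, and moreover $q>\frac nr$ if $\frac nr=p>1$. Let $s\in\mathbb R$ with $s\le p$ and let $g\in\widetilde{\mathcal M}^{q,\frac sp}(\Omega)$. Then for every $\epsilon>0$ there exists $c(\epsilon)>0$ such that $$\|gu\|_{L^p(\Omega)}\le\epsilon\|u\|_{W^{r,p}(\Omega)}+c(\epsilon)\|u\|_{L^p(\Omega)}\qquad\text{for all }u\in W^{r,p}(\Omega).$$
   Context: Functions are complex valued, $B_\rho(x)$ is the open ball in $\mathbb R^n$ of center $x$ and radius $\rho$, and $d>0$ is a fixed real number. $W^{r,p}(\Omega)$ is the usual Sobolev space. Cones: for $x\in\mathbb R^n$, an open infinite cone with vertex $x$ is a set $\{x+\lambda(y-x):\lambda>0,\ |y-z|<a\}$ with $a>0$, $z\in\mathbb R^n$, $|z-x|>a$. $C_\theta(x)$ denotes an open infinite cone with vertex $x$ and opening $\theta$, and $C_\theta(x,h)=C_\theta(x)\cap B_h(x)$. Condition $(h_1)$: there exists $\theta\in\,]0,\pi/2[$ such that for every $x\in\Omega$ there is a cone $C_\theta(x)$ with $\overline{C_\theta(x,\rho)}\subset\Omega$ for all $\rho\in\,]0,d]$. Spaces: $\Omega_\rho(x)=B_\rho(x)\cap\Omega$. For $1\le p<+\infty$ and $\sigma\in\mathbb R$, $\mathcal M^{p,\sigma}(\Omega)$ is the space of $g\in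 L^p_{loc}(\overline\Omega)$ (i.e. $g\in L^p(\Omega\cap B)$ for every ball $B$) such that $$\|g\|_{\mathcal M^{p,\sigma}(\Omega)}=\sup_{x\in\Omega,\ \rho\in]0,d]}\rho^{\sigma-n/p}\|g\|_{L^p(\Omega_\rho(x))}<+\infty,$$ with this norm. $\widetilde{\mathcal M}^{p,\sigma}(\Omega)$ is the closure of $L^\infty(\Omega)$ in $\mathcal M^{p,\sigma}(\Omega)$ (for $\sigma\ge0$ one has $L^\infty(\Omega)\subset \mathcal M^{p,\sigma}(\Omega)$; in general, the closure of $L^\infty(\Omega)\cap\mathcal M^{p,\sigma}(\Omega)$). *)

theory Defs
  imports "HOL-Analysis.Analysis"
begin

text \<open>
  Elements of function spaces are represented by functions on the whole of \<open>real^'n\<close>, of which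
  only the values on the open set \<open>\<Omega>\<close> matter, up to null sets. The dimension of the space is
  \<open>n = CARD('n)\<close>.
\<close>

section \<open>Lebesgue spaces\<close>

definition Lp :: "real \<Rightarrow> (real^'n) set \<Rightarrow> (real^'n \<Rightarrow> complex) set" where
  "Lp p \<Omega> = {u \<in> borel_measurable (lebesgue_on \<Omega>).
               integrable (lebesgue_on \<Omega>) (\<lambda>x. norm (u x) powr p)}"

text \<open>Real valued, hence meaningful on members of \<open>Lp p \<Omega>\<close> only: a nonintegrable function
  has Bochner integral \<open>0\<close>.\<close>

definition Lp_norm :: "real \<Rightarrow> (real^'n) set \<Rightarrow> (real^'n \<Rightarrow> complex) \<Rightarrow> real" where
  "Lp_norm p \<Omega> u = (LINT x|lebesgue_on \<Omega>. norm (u x) powr p) powr (1 / p)"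

definition L_infinity :: "(real^'n) set \<Rightarrow> (real^'n \<Rightarrow> complex) set" where
  "L_infinity \<Omega> = {u \<in> borel_measurable (lebesgue_on \<Omega>).
                     \<exists>C::real. AE x in lebesgue_on \<Omega>. norm (u x) \<le> C}"


section \<open>Sobolev spaces\<close>

definition partial :: "'n \<Rightarrow> (real^'n \<Rightarrow> complex) \<Rightarrow> real^'n \<Rightarrow> complex" where
  "partial i f x = frechet_derivative f (at x) (axis i 1)"

definition smooth :: "(real^'n \<Rightarrow> complex) \<Rightarrow> bool" where
  "smooth f \<longleftrightarrow> (\<forall>xs x. foldr partial xs f differentiable (at x))"

definition test_function :: "(real^'n) set \<Rightarrow> (real^'n \<Rightarrow> complex) \<Rightarrow> bool" where
  "test_function \<Omega> \<phi> \<longleftrightarrow>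
     smooth \<phi> \<and> compact (closure {x. \<phi> x \<noteq> 0}) \<and> closure {x. \<phi> x \<noteq> 0} \<subseteq> \<Omega>"

text \<open>A multi-index is a function \<open>\<alpha> :: 'n \<Rightarrow> nat\<close>, of order \<open>sum \<alpha> UNIV\<close>. Since \<open>'n\<close> carries no
  order, the order of differentiation in \<open>D\<^sup>\<alpha>\<close> is chosen arbitrarily; on smooth functions, where
  \<open>D\<^sup>\<alpha>\<close> is used, the choice is immaterial by symmetry of mixed partial derivatives.\<close>

definition multi_partial :: "('n \<Rightarrow> nat) \<Rightarrow> (real^'n \<Rightarrow> complex) \<Rightarrow> real^'n \<Rightarrow> complex" where
  "multi_partial \<alpha> f = foldr partial (SOME xs. \<forall>i. count_list xs i = \<alpha> i) f"

definition locally_integrable :: "(real^'n) set \<Rightarrow> (real^'n \<Rightarrow> complex) \<Rightarrow> bool" where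
  "locally_integrable \<Omega> u \<longleftrightarrow> (\<forall>K. compact K \<and> K \<subseteq> \<Omega> \<longrightarrow> u absolutely_integrable_on K)"

definition has_weak_derivative ::
    "(real^'n) set \<Rightarrow> ('n \<Rightarrow> nat) \<Rightarrow> (real^'n \<Rightarrow> complex) \<Rightarrow> (real^'n \<Rightarrow> complex) \<Rightarrow> bool" where
  "has_weak_derivative \<Omega> \<alpha> u v \<longleftrightarrow>
     locally_integrable \<Omega> u \<and> locally_integrable \<Omega> v \<and>
     (\<forall>\<phi>. test_function \<Omega> \<phi> \<longrightarrow>
        (LINT x|lebesgue_on \<Omega>. u x * multi_partial \<alpha> \<phi> x) =
        (-1) ^ sum \<alpha> UNIV * (LINT x|lebesgue_on \<Omega>. v x * \<phi> x))"

text \<open>On an open set weak derivatives are unique up to null sets; the choice of a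
  representative does not affect norms.\<close>

definition weak_derivative ::
    "(real^'n) set \<Rightarrow> ('n \<Rightarrow> nat) \<Rightarrow> (real^'n \<Rightarrow> complex) \<Rightarrow> real^'n \<Rightarrow> complex" where
  "weak_derivative \<Omega> \<alpha> u = (SOME v. has_weak_derivative \<Omega> \<alpha> u v)"

definition Sobolev :: "nat \<Rightarrow> real \<Rightarrow> (real^'n) set \<Rightarrow> (real^'n \<Rightarrow> complex) set" where
  "Sobolev r p \<Omega> =
     {u \<in> Lp p \<Omega>. \<forall>\<alpha>. sum \<alpha> UNIV \<le> r \<longrightarrow> (\<exists>v \<in> Lp p \<Omega>. has_weak_derivative \<Omega> \<alpha> u v)}"

definition Sobolev_norm :: "nat \<Rightarrow> real \<Rightarrow> (real^'n) set \<Rightarrow> (real^'n \<Rightarrow> complex) \<Rightarrow> real" where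
  "Sobolev_norm r p \<Omega> u =
     (\<Sum>\<alpha> | sum \<alpha> UNIV \<le> r. Lp_norm p \<Omega> (weak_derivative \<Omega> \<alpha> u) powr p) powr (1 / p)"


section \<open>Cone condition\<close>

definition infinite_cone :: "real^'n \<Rightarrow> real^'n \<Rightarrow> real \<Rightarrow> (real^'n) set" where
  "infinite_cone x z a = {x + l *\<^sub>R (y - x) | l y. l > 0 \<and> norm (y - z) < a}"

text \<open>The opening \<open>\<theta>\<close> is the angle between the axis and the boundary of the cone: the lines
  through the vertex \<open>x\<close> tangent to the ball of center \<open>z\<close> and radius \<open>a\<close> make with \<open>z - x\<close> the
  angle whose sine is \<open>a / norm (z - x)\<close>.\<close>

definition is_cone :: "real \<Rightarrow> real^'n \<Rightarrow> (real^'n) set \<Rightarrow> bool" where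
  "is_cone \<theta> x C \<longleftrightarrow>
     (\<exists>z a. a > 0 \<and> norm (z - x) > a \<and> sin \<theta> = a / norm (z - x) \<and> C = infinite_cone x z a)"

definition cone_condition :: "real \<Rightarrow> (real^'n) set \<Rightarrow> bool" where
  "cone_condition d \<Omega> \<longleftrightarrow>
     (\<exists>\<theta>. 0 < \<theta> \<and> \<theta> < pi / 2 \<and>
        (\<forall>x\<in>\<Omega>. \<exists>C. is_cone \<theta> x C \<and>
           (\<forall>\<rho>. 0 < \<rho> \<and> \<rho> \<le> d \<longrightarrow> closure (C \<inter> ball x \<rho>) \<subseteq> \<Omega>)))"


section \<open>Morrey type spaces\<close>

text \<open>The supremum is taken in \<open>ennreal\<close>, so that finiteness is a genuine condition and the
  supremum over the empty set (when \<open>\<Omega> = {}\<close>) is \<open>0\<close>.\<close>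

definition Morrey_norm ::
    "real \<Rightarrow> real \<Rightarrow> real \<Rightarrow> (real^'n) set \<Rightarrow> (real^'n \<Rightarrow> complex) \<Rightarrow> ennreal" where
  "Morrey_norm d p \<sigma> \<Omega> g =
     (SUP (x, \<rho>) \<in> \<Omega> \<times> {0<..d}.
        ennreal (\<rho> powr (\<sigma> - real CARD('n) / p) * Lp_norm p (ball x \<rho> \<inter> \<Omega>) g))"

definition Morrey :: "real \<Rightarrow> real \<Rightarrow> real \<Rightarrow> (real^'n) set \<Rightarrow> (real^'n \<Rightarrow> complex) set" where
  "Morrey d p \<sigma> \<Omega> =
     {g. (\<forall>x R. g \<in> Lp p (\<Omega> \<inter> ball x R)) \<and> Morrey_norm d p \<sigma> \<Omega> g < \<infinity>}"

text \<open>The closure of \<open>L_infinity \<Omega> \<inter> Morrey d p \<sigma> \<Omega>\<close> in \<open>Morrey d p \<sigma> \<Omega>\<close>.\<close>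

definition Morrey_tilde :: "real \<Rightarrow> real \<Rightarrow> real \<Rightarrow> (real^'n) set \<Rightarrow> (real^'n \<Rightarrow> complex) set" where
  "Morrey_tilde d p \<sigma> \<Omega> =
     {g \<in> Morrey d p \<sigma> \<Omega>. \<forall>\<epsilon>>0. \<exists>h \<in> L_infinity \<Omega> \<inter> Morrey d p \<sigma> \<Omega>.
        Morrey_norm d p \<sigma> \<Omega> (\<lambda>x. g x - h x) < ennreal \<epsilon>}"

end

theory Submission
  imports Defs
begin

text \<open>
  Write \<open>g = h + (g - h)\<close> with \<open>h\<close> bounded and \<open>g - h\<close> of small Morrey norm; it remains to bound
  \<open>\<parallel>G u\<parallel>\<^sub>p\<close> by a multiple of the Morrey norm of \<open>G\<close> times the Sobolev norm of \<open>u\<close>. By compactness of the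
  sphere finitely many cones \<open>{t w | 0 \<le> t \<le> 1, w \<in> W}\<close>, with \<open>W\<close> a closed ball, suffice for all points of
  \<open>\<Omega>\<close>. At the points carrying a given cone, averaging \<open>u\<close> against a bump supported in \<open>x + \<tau> W\<close> yields a function
  that is smooth along the rays \<open>x + t w\<close>, and Taylor's formula bounds it by averages at distance \<open>t = 1/2\<close>
  plus \<open>\<integral> t\<^sup>m avg\<^sub>t |D\<^sup>m\<^sup>+\<^sup>1 u| dt\<close>, where \<open>avg\<^sub>t\<close> averages over \<open>x + t W\<close>. Jensen's inequality and the growth
  \<open>\<integral>_{B(y,\<rho>)} G\<^sup>p \<le> C \<rho>^(n - e p)\<close> control the product with \<open>G\<close> as soon as \<open>m \<le> e < m + 1\<close>. This covers
  \<open>r \<ge> 2\<close> (with \<open>m = e = 1\<close>, because \<open>s \<le> p\<close>) and \<open>r = 1\<close>, \<open>q > n\<close> (with \<open>m = 0\<close>, \<open>e = n / q\<close>). If \<open>r = 1\<close> and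
  \<open>q = n > p\<close>, a weak type bound is applied on each dyadic level set of \<open>u\<close> to the part of the gradient
  carried by that level set; the case \<open>r = n = p = q = 1\<close> is elementary.
\<close>

section \<open>Smooth bump functions and their products\<close>

text \<open>Only cones are known to fit into \<Omega>, so \<open>u\<close> can neither be extended
  across the boundary nor mollified symmetrically near it. The bump is therefore placed off centre,
  inside the cone itself: if \<open>x\<close> carries the cone, then by convexity
  \<open>x + t w + \<tau> y\<close> stays in \<Omega> for \<open>w\<close> and \<open>y\<close> in
  \<open>W\<close> and \<open>t + \<tau> \<le> 1\<close>, and weak derivatives may be tested there.
  The bounds are uniform in \<tau>; as \<tau> tends to 0 the averages tend to a constant multiple of
  \<open>u\<close> almost everywhere along a sequence, and Fatou's lemma passes the bound to
  \<open>u\<close>. The bump is a product of one-variable functions because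
  \<open>multi_partial\<close> differentiates in an arbitrary order, and on products the order is
  visibly irrelevant. In the critical case the growth exponent \<open>e\<close> equals
  \<open>m + 1\<close>, and the integral over \<open>t\<close> diverges logarithmically. A weak type
  inequality survives; using at each height only the gradient on one dyadic band of values, it can
  be summed because the bands are disjoint. The estimates are carried out in \<open>ennreal\<close>,
  so that Tonelli's theorem and substitutions need no integrability conditions.\<close>

definition smooth1 :: "(real \<Rightarrow> real) \<Rightarrow> bool" where
  "smooth1 f \<longleftrightarrow> (\<forall>n x. (deriv ^^ n) f differentiable at x)"

text \<open>The recursion peels off the first derivative, so that closure under sums, products and
  affine substitution follows by induction on the order with the function left arbitrary.\<close>

primrec kdiff :: "nat \<Rightarrow> (real \<Rightarrow> real) \<Rightarrow> bool" where
  "kdiff 0 f \<longleftrightarrow> True"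
| "kdiff (Suc n) f \<longleftrightarrow> (\<forall>x. f differentiable at x) \<and> kdiff n (deriv f)"

lemma smooth1_iff_kdiff: "smooth1 f \<longleftrightarrow> (\<forall>n. kdiff n f)"
proof -
  have "kdiff n f \<longleftrightarrow> (\<forall>m<n. \<forall>x. (deriv ^^ m) f differentiable at x)" for n f
  proof (induction n arbitrary: f)
    case (Suc n)
    show ?case
      by (auto simp: Suc less_Suc_eq_0_disj funpow_Suc_right simp del: funpow.simps)
  qed simp
  then show ?thesis unfolding smooth1_def by blast
qed

lemma smooth1_funpow_deriv: "smooth1 f \<Longrightarrow> smooth1 ((deriv ^^ n) f)"
  unfolding smooth1_def by (metis comp_apply funpow_add)

lemma smooth1_deriv: "smooth1 f \<Longrightarrow> smooth1 (deriv f)"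
  using smooth1_funpow_deriv[of f 1] by simp

lemma smooth1_has_deriv: "smooth1 f \<Longrightarrow> (f has_real_derivative deriv f x) (at x)"
  unfolding smooth1_def
  by (metis DERIV_deriv_iff_real_differentiable funpow_0)

lemma kdiff_SucI:
  assumes "\<And>x. (f has_real_derivative f' x) (at x)" "kdiff n f'"
  shows "kdiff (Suc n) f"
proof -
  have "deriv f = f'" using assms(1) DERIV_imp_deriv by blast
  then show ?thesis using assms by (auto simp: real_differentiable_def)
qed

lemma kdiff_Suc_deriv: "kdiff (Suc n) f \<Longrightarrow> (f has_real_derivative deriv f x) (at x)"
  by (simp add: DERIV_deriv_iff_real_differentiable)

lemma kdiff_Suc_imp: "kdiff (Suc n) f \<Longrightarrow> kdiff n f"
  by (induction n arbitrary: f) auto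

lemma kdiff_add: "kdiff n f \<Longrightarrow> kdiff n g \<Longrightarrow> kdiff n (\<lambda>x. f x + g x)"
proof (induction n arbitrary: f g)
  case (Suc n)
  show ?case
    by (rule kdiff_SucI[where f' = "\<lambda>x. deriv f x + deriv g x"])
      (use Suc in \<open>auto intro!: DERIV_add kdiff_Suc_deriv\<close>)
qed simp

lemma kdiff_mult: "kdiff n f \<Longrightarrow> kdiff n g \<Longrightarrow> kdiff n (\<lambda>x. f x * g x)"
proof (induction n arbitrary: f g)
  case (Suc n)
  show ?case
    by (rule kdiff_SucI[where f' = "\<lambda>x. deriv f x * g x + deriv g x * f x"])
      (use Suc kdiff_Suc_imp in \<open>auto intro!: DERIV_mult kdiff_Suc_deriv kdiff_add\<close>)
qed simp

lemma kdiff_const: "kdiff n (\<lambda>x. c)"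
proof (induction n arbitrary: c)
  case (Suc n)
  show ?case
    by (rule kdiff_SucI[where f' = "\<lambda>x. 0"]) (use Suc in auto)
qed simp

lemma kdiff_affine: "kdiff n f \<Longrightarrow> kdiff n (\<lambda>x. f (m * x + b))"
proof (induction n arbitrary: f)
  case (Suc n)
  have "((\<lambda>x. f (m * x + b)) has_real_derivative deriv f (m * x + b) * m) (at x)" for x
    by (rule DERIV_chain2[OF kdiff_Suc_deriv[OF Suc.prems]]) (auto intro!: derivative_eq_intros)
  then show ?case
    by (rule kdiff_SucI) (use Suc in \<open>auto intro!: kdiff_mult kdiff_const\<close>)
qed simp

lemma smooth1_affine: "smooth1 f \<Longrightarrow> smooth1 (\<lambda>x. f (m * x + b))"
  and smooth1_mult: "smooth1 f \<Longrightarrow> smooth1 g \<Longrightarrow> smooth1 (\<lambda>x. f x * g x)"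
  by (auto simp: smooth1_iff_kdiff intro: kdiff_affine kdiff_mult)

section \<open>Flat functions at the origin and bumps on an interval\<close>

text \<open>The classical flat function \<open>exp (- 1 / x)\<close> times a power of
  \<open>1 / x\<close>. The power is carried along because the derivative of the member
  \<open>k\<close> is the member \<open>k + 2\<close> minus \<open>k\<close> times the member
  \<open>k + 1\<close>: the linear span of the family is closed under differentiation, which gives
  smoothness by induction.\<close>

definition exp_flat :: "nat \<Rightarrow> real \<Rightarrow> real" where
  "exp_flat k x = (if x > 0 then (1 / x) ^ k * exp (- (1 / x)) else 0)"

lemma exp_flat_deriv:
  "(exp_flat k has_real_derivative (exp_flat (k + 2) x - k * exp_flat (k + 1) x)) (at x)"
proof -
  consider "x > 0" | "x < 0" | "x = 0" by linarith
  then show ?thesis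
  proof cases
    case 1
    have "((\<lambda>x. 1 / x) has_real_derivative - ((1 / x) * (1 / x))) (at x)"
      using 1 by (auto intro!: derivative_eq_intros)
    then have "((\<lambda>x. (1 / x) ^ k) has_real_derivative - (k * (1 / x) ^ (k + 1))) (at x)"
      by (rule DERIV_cong[OF DERIV_power]) (cases k; simp del: power_one_over)
    moreover have "((\<lambda>x. exp (- (1 / x))) has_real_derivative exp (- (1 / x)) * (1 / x) ^ 2) (at x)"
      using 1 by (auto intro!: derivative_eq_intros simp: power2_eq_square)
    ultimately have "((\<lambda>x. (1 / x) ^ k * exp (- (1 / x))) has_real_derivative
        (exp_flat (k + 2) x - k * exp_flat (k + 1) x)) (at x)"
      by (rule DERIV_cong[OF DERIV_mult])
        (use 1 in \<open>simp add: exp_flat_def algebra_simps power_add power2_eq_square del: power_one_over\<close>)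
    then show ?thesis
      by (rule has_field_derivative_transform_within_open[where S = "{0<..}"])
        (use 1 in \<open>auto simp: exp_flat_def\<close>)
  next
    case 2
    have "((\<lambda>x. 0) has_real_derivative 0) (at x)" by simp
    then have "(exp_flat k has_real_derivative 0) (at x)"
      by (rule has_field_derivative_transform_within_open[where S = "{..<0}"])
        (use 2 in \<open>auto simp: exp_flat_def\<close>)
    then show ?thesis using 2 by (simp add: exp_flat_def)
  next
    case 3
    \<comment> \<open>With \<open>s = 1 / h\<close> the difference quotient at 0 from the right
      becomes \<open>s ^ (k + 1) / exp s\<close>, where the exponential beats every power.\<close>
    have "((\<lambda>s::real. s ^ (k + 1) / exp s) \<longlongrightarrow> 0) at_top" by (rule tendsto_power_div_exp_0)
    then have "((\<lambda>h::real. (1 / h) ^ (k + 1) / exp (1 / h)) \<longlongrightarrow> 0) (at_right 0)"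
      by (rule filterlim_compose) (simp add: filterlim_inverse_at_top_right flip: inverse_eq_divide)
    then have R: "((\<lambda>h. exp_flat k h / h) \<longlongrightarrow> 0) (at_right 0)"
      by (rule Lim_transform_eventually)
        (auto simp: eventually_at_filter exp_flat_def exp_minus field_simps)
    have "((\<lambda>h. 0) \<longlongrightarrow> (0::real)) (at_left 0)" by simp
    then have L: "((\<lambda>h. exp_flat k h / h) \<longlongrightarrow> 0) (at_left 0)"
      by (rule Lim_transform_eventually) (auto simp: eventually_at_filter exp_flat_def)
    have "((\<lambda>h. exp_flat k h / h) \<longlongrightarrow> 0) (at 0)"
      using L R by (simp add: filterlim_split_at)
    then have "(exp_flat k has_real_derivative 0) (at 0)"
      by (simp add: DERIV_def exp_flat_def)
    then show ?thesis using 3 by (simp add: exp_flat_def)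
  qed
qed

lemma smooth1_exp_flat: "smooth1 (exp_flat k)"
proof -
  have "kdiff n (exp_flat k)" for n
  proof (induction n arbitrary: k)
    case (Suc n)
    have "kdiff n (\<lambda>x. exp_flat (k + 2) x + (- real k) * exp_flat (k + 1) x)"
      by (intro kdiff_add kdiff_mult kdiff_const Suc)
    then show ?case
      by (intro kdiff_SucI[OF exp_flat_deriv]) simp
  qed simp
  then show ?thesis by (simp add: smooth1_iff_kdiff)
qed

text \<open>Smooth, positive exactly on the open interval, and at most 1. No normalisation is made;
  the mass of the resulting kernel enters later as the constant \<kappa>.\<close>

definition bump :: "real \<Rightarrow> real \<Rightarrow> real \<Rightarrow> real" where
  "bump l u x = exp_flat 0 (x - l) * exp_flat 0 (u - x)"

lemma smooth1_bump: "smooth1 (bump l u)"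
  using smooth1_mult[OF smooth1_affine[OF smooth1_exp_flat[of 0], of 1 "- l"]
      smooth1_affine[OF smooth1_exp_flat[of 0], of "-1" u]]
  by (simp add: bump_def[abs_def])

lemma bump_nonneg: "0 \<le> bump l u x" and bump_le_1: "bump l u x \<le> 1"
  and bump_pos_iff: "0 < bump l u x \<longleftrightarrow> l < x \<and> x < u"
  by (auto simp: bump_def exp_flat_def zero_less_mult_iff intro!: mult_le_one)

text \<open>One-variable test functions with support in a given interval. Unlike the concrete
  \<open>bump\<close>, this class is stable under differentiation, and translation and scaling only
  move the interval; all of these operations act on the factors of a product.\<close>

definition bump1 :: "real \<Rightarrow> real \<Rightarrow> (real \<Rightarrow> real) \<Rightarrow> bool" where
  "bump1 l u f \<longleftrightarrow> smooth1 f \<and> (\<forall>x. x \<notin> {l..u} \<longrightarrow> f x = 0)"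

lemma bump1_bump: "bump1 l u (bump l u)"
  by (auto simp: bump1_def smooth1_bump bump_def exp_flat_def)

lemma bump1_deriv:
  assumes "bump1 l u f" shows "bump1 l u (deriv f)"
proof -
  have "deriv f x = 0" if "x \<notin> {l..u}" for x
  proof -
    have "((\<lambda>x. 0) has_real_derivative 0) (at x)" by simp
    then have "(f has_real_derivative 0) (at x)"
      by (rule has_field_derivative_transform_within_open[where S = "- {l..u}"])
        (use that assms in \<open>auto simp: bump1_def\<close>)
    then show ?thesis by (rule DERIV_imp_deriv)
  qed
  then show ?thesis using assms smooth1_deriv by (auto simp: bump1_def)
qed

lemma bump1_funpow_deriv: "bump1 l u f \<Longrightarrow> bump1 l u ((deriv ^^ n) f)"
  by (induction n) (auto intro: bump1_deriv)

lemma bump1_affine: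
  assumes "bump1 l u f" "\<tau> > 0"
  shows "bump1 (b + \<tau> * l) (b + \<tau> * u) (\<lambda>s. f ((s - b) / \<tau>))"
proof -
  have "smooth1 (\<lambda>s. f ((1 / \<tau>) * s + (- b / \<tau>)))"
    using assms by (intro smooth1_affine) (auto simp: bump1_def)
  then have "smooth1 (\<lambda>s. f ((s - b) / \<tau>))"
    by (simp add: diff_divide_distrib)
  moreover have "(s - b) / \<tau> \<notin> {l..u}" if "s \<notin> {b + \<tau> * l..b + \<tau> * u}" for s
    using that assms(2) by (auto simp: field_simps)
  ultimately show ?thesis using assms by (auto simp: bump1_def)
qed

lemma deriv_affine:
  assumes "smooth1 f" "\<tau> > 0"
  shows "deriv (\<lambda>s. f ((s - b) / \<tau>)) = (\<lambda>s. (1 / \<tau>) * deriv f ((s - b) / \<tau>))"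
proof (rule ext, rule DERIV_imp_deriv)
  fix s
  show "((\<lambda>s. f ((s - b) / \<tau>)) has_real_derivative 1 / \<tau> * deriv f ((s - b) / \<tau>)) (at s)"
    by (rule DERIV_cong[OF DERIV_chain2[OF smooth1_has_deriv[OF assms(1)]]])
      (use assms(2) in \<open>auto intro!: derivative_eq_intros\<close>)
qed

lemma bump1_continuous: "bump1 l u f \<Longrightarrow> continuous_on S f"
  unfolding bump1_def by (meson DERIV_isCont continuous_at_imp_continuous_on smooth1_has_deriv)

lemma bump1_bounded:
  assumes "bump1 l u f" obtains B where "B > 0" "\<And>x. \<bar>f x\<bar> \<le> B"
proof -
  have "bounded (f ` {l..u})"
    by (intro compact_imp_bounded compact_continuous_image bump1_continuous[OF assms]) simp
  then obtain B where B: "B > 0" "\<And>x. x \<in> {l..u} \<Longrightarrow> \<bar>f x\<bar> \<le> B"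
    unfolding bounded_pos by auto
  have "\<bar>f x\<bar> \<le> B" for x
    using B assms by (cases "x \<in> {l..u}") (auto simp: bump1_def)
  with B(1) show ?thesis by (rule that)
qed

section \<open>Products of one-variable functions as test functions\<close>

definition prodf :: "('n::finite \<Rightarrow> real \<Rightarrow> real) \<Rightarrow> real^'n \<Rightarrow> real" where
  "prodf F y = (\<Prod>k\<in>UNIV. F k (y $ k))"

definition cprodf :: "('n::finite \<Rightarrow> real \<Rightarrow> real) \<Rightarrow> real^'n \<Rightarrow> complex" where
  "cprodf F y = complex_of_real (prodf F y)"

text \<open>A partial derivative of a product changes a single factor. All partial derivatives of a
  product are therefore products of the same kind, and they commute for trivial reasons.\<close>

definition gradf :: "('n::finite \<Rightarrow> real \<Rightarrow> real) \<Rightarrow> 'n \<Rightarrow> 'n \<Rightarrow> real \<Rightarrow> real" where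
  "gradf F i = F(i := deriv (F i))"

lemma prodf_has_derivative:
  assumes "\<And>k. smooth1 (F k)"
  shows "(prodf F has_derivative (\<lambda>h. \<Sum>i\<in>UNIV. h $ i * prodf (gradf F i) y)) (at y)"
proof -
  have 1: "((\<lambda>y. F k (y $ k)) has_derivative (\<lambda>h. h $ k * deriv (F k) (y $ k))) (at y)" for k
    using has_derivative_compose[OF bounded_linear_imp_has_derivative[OF bounded_linear_vec_nth[of k], of "at y"]
       smooth1_has_deriv[OF assms[of k], unfolded has_field_derivative_def, of "y $ k"]]
    by (simp add: mult.commute)
  have 2: "prodf (gradf F i) y = deriv (F i) (y $ i) * (\<Prod>j\<in>UNIV - {i}. F j (y $ j))" for i
    unfolding prodf_def by (subst prod.remove[of _ i]) (auto simp: gradf_def intro!: prod.cong)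
  show ?thesis
    unfolding prodf_def[of F, abs_def]
    by (rule has_derivative_eq_rhs[OF has_derivative_prod[OF 1]])
      (auto simp: 2 mult.assoc)
qed

lemma cprodf_has_derivative:
  assumes "\<And>k. smooth1 (F k)"
  shows "(cprodf F has_derivative (\<lambda>h. \<Sum>i\<in>UNIV. complex_of_real (h $ i) * cprodf (gradf F i) y)) (at y)"
  unfolding cprodf_def[of F, abs_def]
  by (rule has_derivative_eq_rhs[OF bounded_linear.has_derivative[OF bounded_linear_of_real prodf_has_derivative[OF assms]]])
    (auto simp: cprodf_def)

lemma partial_cprodf:
  assumes "\<And>k. smooth1 (F k)"
  shows "partial i (cprodf F) = cprodf (gradf F i)"
proof
  fix x
  have "partial i (cprodf F) x = (\<Sum>j\<in>UNIV. complex_of_real (axis i 1 $ j) * cprodf (gradf F j) x)"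
    unfolding partial_def frechet_derivative_at[OF cprodf_has_derivative[OF assms], symmetric] ..
  also have "\<dots> = (\<Sum>j\<in>UNIV. if j = i then cprodf (gradf F j) x else 0)"
    by (rule sum.cong) (auto simp: axis_def)
  finally show "partial i (cprodf F) x = cprodf (gradf F i) x" by simp
qed

text \<open>Each occurrence of an index differentiates its own factor once more, so only the
  multiplicities in the list count, not the order.\<close>

lemma foldr_partial_cprodf:
  assumes "\<And>k. smooth1 (F k)"
  shows "foldr partial xs (cprodf F) = cprodf (\<lambda>k. (deriv ^^ count_list xs k) (F k))"
proof (induction xs)
  case (Cons i xs)
  have "foldr partial (i # xs) (cprodf F) = partial i (cprodf (\<lambda>k. (deriv ^^ count_list xs k) (F k)))"
    by (simp add: Cons)
  also have "\<dots> = cprodf (gradf (\<lambda>k. (deriv ^^ count_list xs k) (F k)) i)"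
    by (intro partial_cprodf smooth1_funpow_deriv assms)
  also have "gradf (\<lambda>k. (deriv ^^ count_list xs k) (F k)) i = (\<lambda>k. (deriv ^^ count_list (i # xs) k) (F k))"
    by (auto simp: gradf_def fun_eq_iff)
  finally show ?case .
qed simp

lemma multi_partial_cprodf:
  assumes "\<And>k. smooth1 (F k)"
  shows "multi_partial \<alpha> (cprodf F) = cprodf (\<lambda>k. (deriv ^^ \<alpha> k) (F k))"
proof -
  \<comment> \<open>A list with the prescribed multiplicities exists, as an enumeration of this
    multiset; hence the choice in \<open>multi_partial\<close> does satisfy its
    specification.\<close>
  define M where "M = (\<Sum>i\<in>UNIV. replicate_mset (\<alpha> i) i)"
  obtain xs where "mset xs = M" using ex_mset by blast
  then have "\<exists>xs. \<forall>i. count_list xs i = \<alpha> i"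
    by (intro exI[of _ xs]) (auto simp: M_def count_sum simp flip: count_mset)
  then have "\<forall>i. count_list (SOME xs. \<forall>i. count_list xs i = \<alpha> i) i = \<alpha> i"
    by (rule someI_ex)
  then show ?thesis
    unfolding multi_partial_def foldr_partial_cprodf[OF assms] by simp
qed

lemma smooth_cprodf:
  assumes "\<And>k. smooth1 (F k)" shows "smooth (cprodf F)"
  unfolding smooth_def foldr_partial_cprodf[OF assms]
  by (auto simp: differentiable_def intro!: exI cprodf_has_derivative smooth1_funpow_deriv assms)

lemma prodf_eq_0:
  assumes "\<And>k. bump1 (l $ k) (u $ k) (F k)" "y \<notin> cbox l u"
  shows "prodf F y = 0"
proof -
  obtain k where "y $ k \<notin> {l $ k..u $ k}" using assms(2) by (auto simp: mem_box_cart)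
  then show ?thesis using assms(1)[of k] by (auto simp: prodf_def bump1_def intro!: prod_zero)
qed

lemma test_function_cprodf:
  assumes "\<And>k. bump1 (l $ k) (u $ k) (F k)" "cbox l u \<subseteq> \<Omega>"
  shows "test_function \<Omega> (cprodf F)"
proof -
  have "closure {x. cprodf F x \<noteq> 0} \<subseteq> cbox l u"
    by (intro closure_minimal) (use prodf_eq_0[OF assms(1)] in \<open>auto simp: cprodf_def\<close>)
  moreover have "compact (closure {x. cprodf F x \<noteq> 0})"
    using calculation by (meson bounded_cbox bounded_subset closed_closure compact_eq_bounded_closed)
  moreover have "smooth (cprodf F)"
    by (rule smooth_cprodf) (use assms(1) in \<open>auto simp: bump1_def\<close>)
  ultimately show ?thesis using assms(2) unfolding test_function_def by auto
qed

lemma prodf_bounded: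
  assumes "\<And>k. bump1 (l $ k) (u $ k) (F k)"
  obtains B where "B > 0" "\<And>x. \<bar>prodf F x\<bar> \<le> B"
proof -
  have "\<exists>B>0. \<forall>x. \<bar>F k x\<bar> \<le> B" for k
    using bump1_bounded[OF assms[of k]] by metis
  then obtain B where B: "\<And>k. B k > (0::real)" "\<And>k x. \<bar>F k x\<bar> \<le> B k" by metis
  have "\<bar>prodf F x\<bar> \<le> (\<Prod>k\<in>UNIV. B k)" for x
    unfolding prodf_def abs_prod using B by (intro prod_mono) auto
  moreover have "(\<Prod>k\<in>UNIV. B k) > 0" using B by (intro prod_pos) auto
  ultimately show ?thesis using that by blast
qed

lemma bump1_gradf:
  assumes "\<And>k. bump1 (l $ k) (u $ k) (F k)"
  shows "bump1 (l $ k) (u $ k) (gradf F i k)"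
  using assms bump1_deriv[OF assms[of k]] by (auto simp: gradf_def)

lemma continuous_prodf:
  assumes "\<And>k. bump1 (l $ k) (u $ k) (F k)" shows "continuous_on S (prodf F)"
  using prodf_has_derivative[of F] assms
  by (meson bump1_def continuous_at_imp_continuous_on has_derivative_continuous)

lemma borel_measurable_prodf:
  assumes "\<And>k. bump1 (l $ k) (u $ k) (F k)" shows "prodf F \<in> borel_measurable borel"
  using continuous_prodf[OF assms] by (intro borel_measurable_continuous_onI)

section \<open>Powers of extended nonnegative reals and averaged potentials\<close>

text \<open>At 0 the value is 0 even for exponent 0, following \<open>powr\<close>, and at
  \<open>top\<close> it is always \<open>top\<close>. The exponent \<open>p - 1\<close> occurs below
  with \<open>p = 1\<close>; for a weight of mass 0 both sides of Jensen's inequality then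
  vanish.\<close>

definition epow :: "ennreal \<Rightarrow> real \<Rightarrow> ennreal" where
  "epow x p = (if x = top then top else ennreal (enn2real x powr p))"

lemma epow_ennreal: "0 \<le> a \<Longrightarrow> epow (ennreal a) p = ennreal (a powr p)"
  by (simp add: epow_def)

lemma epow_0 [simp]: "epow 0 p = 0"
  by (simp add: epow_def)

lemma epow_top [simp]: "epow top p = top"
  by (simp add: epow_def)

lemma epow_mono:
  assumes "0 \<le> p" "x \<le> y" shows "epow x p \<le> epow y p"
proof (cases "y = top")
  case False
  then have "x \<noteq> top" using assms(2) by (auto simp: top_unique)
  then show ?thesis using False assms
    by (auto simp: epow_def intro!: ennreal_leI powr_mono2 enn2real_mono simp: less_top)
qed simp

lemma epow_mult:
  assumes "0 < p" shows "epow (x * y) p = epow x p * epow y p"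
proof (cases x; cases y)
  fix a b assume "x = ennreal a" "0 \<le> a" "y = ennreal b" "0 \<le> b"
  then show ?thesis by (simp add: epow_ennreal powr_mult flip: ennreal_mult)
next
  fix a assume *: "0 \<le> a" "x = ennreal a" "y = top"
  show ?thesis
    using * by (cases "a = 0") (auto simp: epow_ennreal ennreal_mult_top ennreal_eq_0_iff not_le)
next
  fix a assume *: "0 \<le> a" "y = ennreal a" "x = top"
  show ?thesis
    using * by (cases "a = 0") (auto simp: epow_ennreal ennreal_top_mult ennreal_eq_0_iff not_le)
qed (auto simp: ennreal_mult_top)

lemma epow_1: "epow x 1 = x"
  by (cases x) (auto simp: epow_ennreal)

lemma epow_le_ennrealD:
  assumes "epow x p \<le> ennreal b" "0 < p" "0 \<le> b"
  shows "x \<le> ennreal (b powr (1 / p))"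
proof (cases x)
  case (real a)
  then have "a powr p \<le> b" using assms by (simp add: epow_ennreal)
  then have "(a powr p) powr (1 / p) \<le> b powr (1 / p)" using assms by (intro powr_mono2) auto
  then show ?thesis using real assms by (simp add: powr_powr)
qed (use assms in \<open>auto simp: top_unique\<close>)

lemma borel_measurable_epow [measurable (raw)]:
  assumes [measurable]: "f \<in> borel_measurable M"
  shows "(\<lambda>x. epow (f x) p) \<in> borel_measurable M"
  unfolding epow_def by measurable

lemma epow_add:
  assumes "0 < p" shows "epow (x + y) p \<le> ennreal (2 powr p) * (epow x p + epow y p)"
proof -
  have "epow (x + y) p \<le> epow (2 * max x y) p"
    using assms by (intro epow_mono) (auto simp: mult_2 intro: add_mono)
  also have "\<dots> = ennreal (2 powr p) * epow (max x y) p"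
    using assms epow_ennreal[of 2 p] by (simp add: epow_mult)
  also have "epow (max x y) p \<le> epow x p + epow y p"
    by (auto simp: max_def)
  finally show ?thesis by (simp add: mult_left_mono)
qed

text \<open>The sum is at most the number of summands times the largest one, and the power of the
  largest one is among the powers on the right.\<close>

lemma epow_sum:
  assumes "0 < p" "finite I"
  shows "epow (\<Sum>i\<in>I. x i) p \<le> ennreal (real (card I) powr p) * (\<Sum>i\<in>I. epow (x i) p)"
proof (cases "I = {}")
  case False
  have "Max (x ` I) \<in> x ` I" using False assms(2) by (intro Max_in) auto
  then obtain j where "j \<in> I" "x j = Max (x ` I)" by auto
  then have j: "j \<in> I" "\<And>i. i \<in> I \<Longrightarrow> x i \<le> x j"
    using assms(2) by auto
  have "(\<Sum>i\<in>I. x i) \<le> of_nat (card I) * x j"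
    using sum_bounded_above[of I x "x j"] j by auto
  then have "epow (\<Sum>i\<in>I. x i) p \<le> epow (ennreal (card I) * x j) p"
    using assms by (intro epow_mono) (auto simp: ennreal_of_nat_eq_real_of_nat)
  also have "\<dots> = ennreal (real (card I) powr p) * epow (x j) p"
    using assms by (simp add: epow_mult epow_ennreal)
  also have "\<dots> \<le> ennreal (real (card I) powr p) * (\<Sum>i\<in>I. epow (x i) p)"
    using j(1) assms by (intro mult_left_mono member_le_sum) auto
  finally show ?thesis .
qed simp

section \<open>Jensen's inequality for powers and weights of arbitrary finite mass\<close>

text \<open>A convex function lies above its tangent at \<open>a\<close>. After scaling to
  \<open>s = x / a\<close> this is Bernoulli's inequality
  \<open>1 + p * (s - 1) \<le> s powr p\<close>, which in turn is the weighted arithmetic-geometric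
  mean inequality for \<open>1 + p * (s - 1)\<close> and 1 with weight \<open>1 / p\<close>.\<close>

lemma powr_tangent:
  assumes "1 \<le> p" "0 < a" "0 \<le> (x::real)"
  shows "p * a powr (p - 1) * x \<le> x powr p + (p - 1) * a powr p"
proof (cases "x = 0")
  case True
  then show ?thesis using assms by simp
next
  case False
  define s where "s = x / a"
  have s: "s > 0" using False assms by (simp add: s_def)
  have "p * s \<le> s powr p + (p - 1)"
  proof -
    have "1 + p * (s - 1) \<le> s powr p"
    proof (cases "1 + p * (s - 1) \<le> 0")
      case False
      then have "1 + p * (s - 1) > 0" by simp
      have "(1 + p * (s - 1)) powr (1 / p) \<le> s"
      proof -
        have "(1 + p * (s - 1)) powr (1 / p) * 1 powr (1 - 1 / p) \<le> (1 / p) * (1 + p * (s - 1)) + (1 - 1 / p) * 1"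
          by (rule Youngs_inequality_0) (use False assms in auto)
        also have "\<dots> = s" using assms by (simp add: field_simps)
        finally show ?thesis by simp
      qed
      then have "((1 + p * (s - 1)) powr (1 / p)) powr p \<le> s powr p"
        using assms by (intro powr_mono2) auto
      then show ?thesis using False assms by (simp add: powr_powr)
    qed (use order_trans[OF _ powr_ge_zero] in auto)
    then show ?thesis by (simp add: algebra_simps)
  qed
  then have "a powr p * (p * s) \<le> a powr p * (s powr p + (p - 1))"
    by (intro mult_left_mono) auto
  moreover have "a powr p * (p * s) = p * a powr (p - 1) * x"
    using assms by (simp add: s_def powr_diff)
  moreover have "a powr p * (s powr p + (p - 1)) = x powr p + (p - 1) * a powr p"
    using assms by (simp add: s_def powr_divide algebra_simps)
  ultimately show ?thesis by simp
qed

lemma epow_tangent: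
  assumes "1 \<le> p" "0 < a"
  shows "ennreal (p * a powr (p - 1)) * x \<le> epow x p + ennreal ((p - 1) * a powr p)"
proof (cases x)
  case (real b)
  then show ?thesis
    using powr_tangent[OF assms, of b] assms
    by (simp add: epow_ennreal flip: ennreal_mult ennreal_plus)
qed (use assms in auto)

text \<open>The tangent inequality at a point \<open>a\<close> is integrated against the weight
  \<open>k\<close>, and \<open>a\<close> is then chosen as the mean value of \<open>f\<close>. Since
  the weight has mass \<open>c\<close> instead of 1, the factor \<open>c powr (p - 1)\<close>
  appears.\<close>

lemma nn_integral_Jensen_powr:
  assumes [measurable]: "k \<in> borel_measurable M" "f \<in> borel_measurable M"
    and p: "1 \<le> p" and fin: "(\<integral>\<^sup>+x. k x \<partial>M) < top"
  shows "epow (\<integral>\<^sup>+x. k x * f x \<partial>M) p \<le> epow (\<integral>\<^sup>+x. k x \<partial>M) (p - 1) * (\<integral>\<^sup>+x. k x * epow (f x) p \<partial>M)"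
proof -
  define c where "c = enn2real (\<integral>\<^sup>+x. k x \<partial>M)"
  have c: "(\<integral>\<^sup>+x. k x \<partial>M) = ennreal c" "c \<ge> 0"
    using fin by (auto simp: c_def)
  let ?I = "\<integral>\<^sup>+x. k x * f x \<partial>M" and ?J = "\<integral>\<^sup>+x. k x * epow (f x) p \<partial>M"
  show ?thesis
  proof (cases "c = 0")
    case True
    then have "AE x in M. k x = 0" using c by (simp add: nn_integral_0_iff_AE)
    then have "?I = (\<integral>\<^sup>+x. 0 \<partial>M)" by (intro nn_integral_cong_AE) auto
    then show ?thesis by simp
  next
    case False
    with c have c0: "c > 0" by simp
    show ?thesis
    proof (cases "?J = top")
      case True
      have "epow (\<integral>\<^sup>+x. k x \<partial>M) (p - 1) * ?J = top"
        unfolding True c(1) using c0 by (simp add: epow_ennreal ennreal_mult_top)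
      then show ?thesis by simp
    next
      case False
      then obtain J where J: "?J = ennreal J" "J \<ge> 0" by (cases "?J") auto
      have tang: "ennreal (p * a powr (p - 1)) * ?I \<le> ennreal (J + (p - 1) * a powr p * c)"
        if "a > 0" for a
      proof -
        have "ennreal (p * a powr (p - 1)) * ?I = (\<integral>\<^sup>+x. k x * (ennreal (p * a powr (p - 1)) * f x) \<partial>M)"
          by (subst nn_integral_cmult[symmetric]) (auto intro!: nn_integral_cong simp: ac_simps)
        also have "\<dots> \<le> (\<integral>\<^sup>+x. k x * (epow (f x) p + ennreal ((p - 1) * a powr p)) \<partial>M)"
          by (intro nn_integral_mono mult_left_mono epow_tangent p that) auto
        also have "\<dots> = ?J + (\<integral>\<^sup>+x. k x \<partial>M) * ennreal ((p - 1) * a powr p)"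
          by (simp add: distrib_left nn_integral_add nn_integral_multc)
        also have "\<dots> = ennreal (J + (p - 1) * a powr p * c)"
          using J c c0 p by (simp add: mult_ac flip: ennreal_mult ennreal_plus)
        finally show ?thesis .
      qed
      \<comment> \<open>Any tangent, for instance the one at 1, bounds the integral of
        \<open>f\<close> by that of its power, which is finite here; so the mean value is a real
        number.\<close>
      have "?I < top"
      proof -
        have "ennreal p * ?I < top"
          using tang[of 1] p le_less_trans[OF _ ennreal_less_top] by auto
        then show ?thesis using p by (auto simp: ennreal_mult_less_top)
      qed
      then obtain I where I: "?I = ennreal I" "I \<ge> 0" by (cases "?I") auto
      show ?thesis
      proof (cases "I = 0")
        case False
        define a where "a = I / c"
        have a: "a > 0" "I = a * c" using False I c0 by (auto simp: a_def)
        have "p * a powr (p - 1) * I \<le> J + (p - 1) * a powr p * c"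
        proof -
          have "ennreal (p * a powr (p - 1) * I) \<le> ennreal (J + (p - 1) * a powr p * c)"
            using tang[OF a(1)] I p by (simp add: ennreal_mult'')
          moreover have "0 \<le> J + (p - 1) * a powr p * c"
            using J c0 p by auto
          ultimately show ?thesis by (simp only: ennreal_le_iff)
        qed
        moreover have "p * a powr (p - 1) * I = p * a powr p * c"
          using a by (simp add: powr_diff)
        ultimately have "p * a powr p * c \<le> J + (p - 1) * a powr p * c" by (simp only:)
        then have "a powr p * c \<le> J" by (simp add: algebra_simps)
        then have "a powr p * c * c powr (p - 1) \<le> J * c powr (p - 1)"
          by (intro mult_right_mono) auto
        moreover have "a powr p * c * c powr (p - 1) = I powr p"
          using a c0 by (simp add: powr_mult powr_diff)
        ultimately have "I powr p \<le> c powr (p - 1) * J" by (simp add: mult.commute)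
        then show ?thesis
          unfolding I(1) J(1) c(1) using I(2) J(2) c(2)
          by (simp add: epow_ennreal flip: ennreal_mult)
      qed (use I in simp)
    qed
  qed
qed

section \<open>Substitutions, and averages and potentials over a cone\<close>

lemma nn_integral_lborel_affine:
  fixes f :: "'a::euclidean_space \<Rightarrow> ennreal"
  assumes [measurable]: "f \<in> borel_measurable borel" and "c \<noteq> 0"
  shows "(\<integral>\<^sup>+x. f x \<partial>lborel) = ennreal (\<bar>c\<bar> ^ DIM('a)) * (\<integral>\<^sup>+x. f (t + c *\<^sub>R x) \<partial>lborel)"
  by (subst lborel_affine[OF assms(2), of t])
    (simp add: nn_integral_density nn_integral_distr nn_integral_cmult ennreal_power)

lemma nn_integral_lborel_translate:
  fixes f :: "'a::euclidean_space \<Rightarrow> ennreal"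
  assumes "f \<in> borel_measurable borel"
  shows "(\<integral>\<^sup>+x. f (x + t) \<partial>lborel) = (\<integral>\<^sup>+x. f x \<partial>lborel)"
  using nn_integral_lborel_affine[OF assms, of 1 t] by (simp add: add.commute)

lemma nn_integral_lborel_reflect:
  fixes f :: "'a::euclidean_space \<Rightarrow> ennreal"
  assumes "f \<in> borel_measurable borel"
  shows "(\<integral>\<^sup>+x. f (t - x) \<partial>lborel) = (\<integral>\<^sup>+x. f x \<partial>lborel)"
  using nn_integral_lborel_affine[OF assms, of "-1" t] by simp

text \<open>Integration is over \<open>w\<close>, so the set \<open>x + t W\<close> shrinks to
  \<open>x\<close> with \<open>t\<close> while the total weight remains the measure of
  \<open>W\<close>.\<close>

definition avg :: "'a::euclidean_space set \<Rightarrow> real \<Rightarrow> ('a \<Rightarrow> ennreal) \<Rightarrow> 'a \<Rightarrow> ennreal" where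
  "avg W t f x = (\<integral>\<^sup>+w. indicator W w * f (x + t *\<^sub>R w) \<partial>lborel)"

text \<open>Writing \<open>v = t w\<close> shows a Riesz type potential restricted to a cone: in
  dimension \<open>n\<close> the kernel at \<open>v\<close> is at most of size
  \<open>|v|^(m + 1 - n)\<close> when \<open>W\<close> is bounded and stays away from the origin.
  Keeping \<open>t\<close> as the outer variable reduces its estimates to those of the
  averages.\<close>

definition pot :: "'a::euclidean_space set \<Rightarrow> real set \<Rightarrow> nat \<Rightarrow> ('a \<Rightarrow> ennreal) \<Rightarrow> 'a \<Rightarrow> ennreal" where
  "pot W T m f x = (\<integral>\<^sup>+t. indicator T t * (ennreal (t ^ m) * avg W t f x) \<partial>lborel)"

lemma borel_measurable_avg [measurable]:
  assumes [measurable]: "f \<in> borel_measurable borel" "W \<in> sets borel"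
  shows "(\<lambda>(t, x). avg W t f x) \<in> borel_measurable (borel \<Otimes>\<^sub>M borel)"
proof -
  have [measurable]: "(\<lambda>z. f (snd (fst z) + fst (fst z) *\<^sub>R snd z)) \<in> borel_measurable ((borel \<Otimes>\<^sub>M borel) \<Otimes>\<^sub>M lborel)"
    by measurable
  show ?thesis unfolding avg_def case_prod_beta by measurable
qed

lemma borel_measurable_avg' [measurable (raw)]:
  assumes "f \<in> borel_measurable borel" "W \<in> sets borel"
    and "g \<in> borel_measurable M" "h \<in> M \<rightarrow>\<^sub>M borel"
  shows "(\<lambda>z. avg W (g z) f (h z)) \<in> borel_measurable M"
  using measurable_compose[OF measurable_Pair[OF assms(3,4)] borel_measurable_avg[OF assms(1,2)]]
  by simp

lemma borel_measurable_pot [measurable (raw)]: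
  assumes [measurable]: "f \<in> borel_measurable borel" "W \<in> sets borel" "T \<in> sets borel"
    "h \<in> M \<rightarrow>\<^sub>M borel"
  shows "(\<lambda>z. pot W T m f (h z)) \<in> borel_measurable M"
  unfolding pot_def by measurable

text \<open>A Schur type test. Jensen's inequality moves the power under the average, and the
  translation \<open>y = x + t w\<close> shifts the argument of the weight \<open>H\<close> to
  \<open>y - t w\<close>; for fixed \<open>y\<close> the remaining integral over \<open>w\<close> is
  bounded by \<open>B\<close>.\<close>

lemma nn_integral_avg_le:
  fixes f :: "'a::euclidean_space \<Rightarrow> ennreal"
  assumes [measurable]: "f \<in> borel_measurable borel" "H \<in> borel_measurable borel" "W \<in> sets borel"
    and p: "1 \<le> p" and W: "emeasure lborel W < top"
    and B: "\<And>y. (\<integral>\<^sup>+w. indicator W w * H (y - t *\<^sub>R w) \<partial>lborel) \<le> B"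
  shows "(\<integral>\<^sup>+x. H x * epow (avg W t f x) p \<partial>lborel)
    \<le> epow (emeasure lborel W) (p - 1) * B * (\<integral>\<^sup>+x. epow (f x) p \<partial>lborel)"
proof -
  let ?c = "epow (emeasure lborel W) (p - 1)"
  have J: "epow (avg W t f x) p \<le> ?c * (\<integral>\<^sup>+w. indicator W w * epow (f (x + t *\<^sub>R w)) p \<partial>lborel)" for x
    using nn_integral_Jensen_powr[of "indicator W" lborel "\<lambda>w. f (x + t *\<^sub>R w)" p] p W
    by (simp add: avg_def)
  have "(\<integral>\<^sup>+x. H x * epow (avg W t f x) p \<partial>lborel)
    \<le> (\<integral>\<^sup>+x. ?c * (\<integral>\<^sup>+w. H x * (indicator W w * epow (f (x + t *\<^sub>R w)) p) \<partial>lborel) \<partial>lborel)"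
  proof (rule nn_integral_mono)
    fix x
    have "H x * epow (avg W t f x) p \<le> H x * (?c * (\<integral>\<^sup>+w. indicator W w * epow (f (x + t *\<^sub>R w)) p \<partial>lborel))"
      by (intro mult_left_mono J) auto
    also have "\<dots> = ?c * (\<integral>\<^sup>+w. H x * (indicator W w * epow (f (x + t *\<^sub>R w)) p) \<partial>lborel)"
      by (subst nn_integral_cmult) (auto simp: ac_simps)
    finally show "H x * epow (avg W t f x) p \<le> \<dots>" .
  qed
  also have "\<dots> = ?c * (\<integral>\<^sup>+x. (\<integral>\<^sup>+w. H x * (indicator W w * epow (f (x + t *\<^sub>R w)) p) \<partial>lborel) \<partial>lborel)"
    by (rule nn_integral_cmult) simp
  also have "(\<integral>\<^sup>+x. (\<integral>\<^sup>+w. H x * (indicator W w * epow (f (x + t *\<^sub>R w)) p) \<partial>lborel) \<partial>lborel)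
    = (\<integral>\<^sup>+w. (\<integral>\<^sup>+x. H x * (indicator W w * epow (f (x + t *\<^sub>R w)) p) \<partial>lborel) \<partial>lborel)"
    by (rule lborel_pair.Fubini'[symmetric]) simp
  also have "\<dots> = (\<integral>\<^sup>+w. (\<integral>\<^sup>+y. H (y - t *\<^sub>R w) * (indicator W w * epow (f y) p) \<partial>lborel) \<partial>lborel)"
  proof (rule nn_integral_cong)
    fix w
    show "(\<integral>\<^sup>+x. H x * (indicator W w * epow (f (x + t *\<^sub>R w)) p) \<partial>lborel) =
       (\<integral>\<^sup>+y. H (y - t *\<^sub>R w) * (indicator W w * epow (f y) p) \<partial>lborel)"
      using nn_integral_lborel_translate[of "\<lambda>y. H (y - t *\<^sub>R w) * (indicator W w * epow (f y) p)" "t *\<^sub>R w"]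
      by simp
  qed
  also have "\<dots> = (\<integral>\<^sup>+y. (\<integral>\<^sup>+w. H (y - t *\<^sub>R w) * (indicator W w * epow (f y) p) \<partial>lborel) \<partial>lborel)"
    by (rule lborel_pair.Fubini') simp
  also have "\<dots> \<le> (\<integral>\<^sup>+y. B * epow (f y) p \<partial>lborel)"
  proof (rule nn_integral_mono)
    fix y
    have "(\<integral>\<^sup>+w. H (y - t *\<^sub>R w) * (indicator W w * epow (f y) p) \<partial>lborel)
      = (\<integral>\<^sup>+w. indicator W w * H (y - t *\<^sub>R w) \<partial>lborel) * epow (f y) p"
      by (subst nn_integral_multc[symmetric]) (auto simp: ac_simps)
    also have "\<dots> \<le> B * epow (f y) p" by (intro mult_right_mono B) auto
    finally show "(\<integral>\<^sup>+w. H (y - t *\<^sub>R w) * (indicator W w * epow (f y) p) \<partial>lborel) \<le> B * epow (f y) p" .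
  qed
  also have "\<dots> = B * (\<integral>\<^sup>+y. epow (f y) p \<partial>lborel)" by (rule nn_integral_cmult) simp
  finally show ?thesis by (simp add: mult.assoc mult_left_mono)
qed

text \<open>The map from \<open>w\<close> to \<open>y - t w\<close> is a reflection and scaling
  whose Jacobian is \<open>t\<close> to the power of the dimension, and it sends \<open>W\<close>
  into the ball of radius \<open>R * t\<close> around \<open>y\<close>.\<close>

lemma nn_integral_avg_le_ball:
  fixes H :: "'a::euclidean_space \<Rightarrow> ennreal"
  assumes [measurable]: "H \<in> borel_measurable borel" "W \<in> sets borel"
    and W: "W \<subseteq> ball 0 R" and t: "t > 0"
  shows "(\<integral>\<^sup>+w. indicator W w * H (y - t *\<^sub>R w) \<partial>lborel)
    \<le> ennreal (1 / t ^ DIM('a)) * (\<integral>\<^sup>+x. indicator (ball y (R * t)) x * H x \<partial>lborel)"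
proof -
  let ?h = "\<lambda>x. indicator (ball y (R * t)) x * H x"
  have [measurable]: "ball y (R * t) \<in> sets borel" by simp
  have m: "?h \<in> borel_measurable borel" by measurable
  have "(\<integral>\<^sup>+x. ?h x \<partial>lborel) = ennreal (t ^ DIM('a)) * (\<integral>\<^sup>+w. ?h (y - t *\<^sub>R w) \<partial>lborel)"
    using nn_integral_lborel_affine[OF m, of "- t" y] t by simp
  then have "ennreal (1 / t ^ DIM('a)) * (\<integral>\<^sup>+x. ?h x \<partial>lborel) =
     ennreal (1 / t ^ DIM('a) * t ^ DIM('a)) * (\<integral>\<^sup>+w. ?h (y - t *\<^sub>R w) \<partial>lborel)"
    using t by (simp only: mult.assoc[symmetric] ennreal_mult'' zero_le_power less_imp_le)
  also have "\<dots> = (\<integral>\<^sup>+w. ?h (y - t *\<^sub>R w) \<partial>lborel)" using t by simp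
  also have "\<dots> \<ge> (\<integral>\<^sup>+w. indicator W w * H (y - t *\<^sub>R w) \<partial>lborel)"
  proof (intro nn_integral_mono mult_right_mono)
    fix w
    show "(indicator W w :: ennreal) \<le> indicator (ball y (R * t)) (y - t *\<^sub>R w)"
      using W t by (auto simp: indicator_def dist_norm)
  qed simp
  finally show ?thesis .
qed

text \<open>The factor \<open>t ^ m\<close> is split as \<open>t powr - b\<close> times
  \<open>t powr (m + b)\<close>. The first part is the weight for Jensen's inequality in
  \<open>t\<close>; the second cancels the assumed blow-up of the averages as \<open>t\<close> tends
  to 0. The mass \<open>c\<close> of the weight enters with exponent \<open>p - 1\<close> through
  Jensen and once more through the final integration.\<close>

lemma nn_integral_pot_le:
  fixes f :: "'a::euclidean_space \<Rightarrow> ennreal"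
  assumes [measurable]: "f \<in> borel_measurable borel" "H \<in> borel_measurable borel" "W \<in> sets borel" "T \<in> sets borel"
    and T: "T \<subseteq> {0<..}" and p: "1 \<le> p" and c: "(\<integral>\<^sup>+t. indicator T t * ennreal (t powr - b) \<partial>lborel) = ennreal c" "c \<ge> 0"
    and B: "\<And>t. t \<in> T \<Longrightarrow> (\<integral>\<^sup>+x. H x * epow (avg W t f x) p \<partial>lborel) \<le> ennreal (t powr (- (p * (m + b)))) * B"
  shows "(\<integral>\<^sup>+x. H x * epow (pot W T m f x) p \<partial>lborel) \<le> ennreal (c powr p) * B"
proof -
  let ?k = "\<lambda>t. indicator T t * ennreal (t powr - b)"
  let ?g = "\<lambda>t x. ennreal (t powr (m + b)) * avg W t f x"
  have kg: "indicator T t * (ennreal (t ^ m) * avg W t f x) = ?k t * ?g t x" for t x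
  proof (cases "t \<in> T")
    case True
    then have "t > 0" using T by auto
    then have "t ^ m = t powr - b * t powr (m + b)"
      by (simp add: powr_add[symmetric] powr_realpow)
    then show ?thesis using True by (simp add: ennreal_mult mult.assoc)
  qed simp
  have J: "epow (pot W T m f x) p \<le> ennreal (c powr (p - 1)) * (\<integral>\<^sup>+t. ?k t * epow (?g t x) p \<partial>lborel)" for x
    using nn_integral_Jensen_powr[of ?k lborel "\<lambda>t. ?g t x" p] p c
    unfolding pot_def kg by (simp add: epow_ennreal)
  have "(\<integral>\<^sup>+x. H x * epow (pot W T m f x) p \<partial>lborel)
    \<le> (\<integral>\<^sup>+x. ennreal (c powr (p - 1)) * (\<integral>\<^sup>+t. H x * (?k t * epow (?g t x) p) \<partial>lborel) \<partial>lborel)"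
  proof (rule nn_integral_mono)
    fix x
    have "H x * epow (pot W T m f x) p \<le> H x * (ennreal (c powr (p - 1)) * (\<integral>\<^sup>+t. ?k t * epow (?g t x) p \<partial>lborel))"
      by (intro mult_left_mono J) auto
    also have "\<dots> = ennreal (c powr (p - 1)) * (\<integral>\<^sup>+t. H x * (?k t * epow (?g t x) p) \<partial>lborel)"
      by (subst nn_integral_cmult) (auto simp: ac_simps)
    finally show "H x * epow (pot W T m f x) p \<le> \<dots>" .
  qed
  also have "\<dots> = ennreal (c powr (p - 1)) * (\<integral>\<^sup>+x. (\<integral>\<^sup>+t. H x * (?k t * epow (?g t x) p) \<partial>lborel) \<partial>lborel)"
    by (rule nn_integral_cmult) simp
  also have "(\<integral>\<^sup>+x. (\<integral>\<^sup>+t. H x * (?k t * epow (?g t x) p) \<partial>lborel) \<partial>lborel)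
     = (\<integral>\<^sup>+t. (\<integral>\<^sup>+x. H x * (?k t * epow (?g t x) p) \<partial>lborel) \<partial>lborel)"
    by (rule lborel_pair.Fubini') simp
  also have "\<dots> \<le> (\<integral>\<^sup>+t. ?k t * B \<partial>lborel)"
  proof (rule nn_integral_mono)
    fix t
    show "(\<integral>\<^sup>+x. H x * (?k t * epow (?g t x) p) \<partial>lborel) \<le> ?k t * B"
    proof (cases "t \<in> T")
      case True
      then have t: "t > 0" using T by auto
      have "(\<integral>\<^sup>+x. H x * (?k t * epow (?g t x) p) \<partial>lborel)
        = (\<integral>\<^sup>+x. ?k t * (ennreal (t powr (p * (m + b))) * (H x * epow (avg W t f x) p)) \<partial>lborel)"
        using p t by (intro nn_integral_cong) (simp add: epow_mult epow_ennreal powr_powr ac_simps)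
      also have "\<dots> = ?k t * (ennreal (t powr (p * (m + b))) * (\<integral>\<^sup>+x. H x * epow (avg W t f x) p \<partial>lborel))"
        by (simp add: nn_integral_cmult)
      also have "\<dots> \<le> ?k t * (ennreal (t powr (p * (m + b))) * (ennreal (t powr (- (p * (m + b)))) * B))"
        by (intro mult_left_mono B True) auto
      also have "ennreal (t powr (p * (m + b))) * (ennreal (t powr (- (p * (m + b)))) * B) = B"
        using t by (simp add: mult.assoc[symmetric] flip: ennreal_mult powr_add)
      finally show ?thesis .
    qed simp
  qed
  also have "\<dots> = ennreal c * B" by (simp add: nn_integral_multc c)
  finally have "(\<integral>\<^sup>+x. H x * epow (pot W T m f x) p \<partial>lborel) \<le> ennreal (c powr (p - 1)) * (ennreal c * B)"
    by (simp add: mult_left_mono)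
  also have "\<dots> = ennreal (c powr p) * B"
    using c(2) by (cases "c = 0") (auto simp: mult.assoc[symmetric] powr_diff simp flip: ennreal_mult)
  finally show ?thesis .
qed

lemma sets_borel_ball [measurable]: "ball (x :: 'a::metric_space) r \<in> sets borel"
  by simp

text \<open>In dimension \<open>n\<close> the volume factor \<open>t powr (- n)\<close> of the
  substitution and the growth \<open>t powr (n - e * p)\<close> of \<open>H\<close> on balls
  multiply to \<open>t powr (- (p * e))\<close>.\<close>

lemma nn_integral_avg_le_powr:
  fixes f :: "'a::euclidean_space \<Rightarrow> ennreal" and e p :: real
  assumes [measurable]: "f \<in> borel_measurable borel" "H \<in> borel_measurable borel" "W \<in> sets borel"
    and W: "W \<subseteq> ball 0 d" "emeasure lborel W = ennreal \<omega>" "\<omega> \<ge> 0" and p: "1 \<le> p" and t: "t > 0" and C: "C \<ge> 0"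
    and HB: "\<And>y. (\<integral>\<^sup>+x. indicator (ball y (d * t)) x * H x \<partial>lborel) \<le> ennreal (C * t powr (real DIM('a) - e * p))"
  shows "(\<integral>\<^sup>+x. H x * epow (avg W t f x) p \<partial>lborel)
    \<le> ennreal (t powr (- (p * e))) * (ennreal (\<omega> powr (p - 1) * C) * (\<integral>\<^sup>+x. epow (f x) p \<partial>lborel))"
proof -
  have "(\<integral>\<^sup>+x. H x * epow (avg W t f x) p \<partial>lborel)
    \<le> epow (emeasure lborel W) (p - 1) * (ennreal (1 / t ^ DIM('a)) * ennreal (C * t powr (real DIM('a) - e * p)))
      * (\<integral>\<^sup>+x. epow (f x) p \<partial>lborel)"
    by (intro nn_integral_avg_le assms order_trans[OF nn_integral_avg_le_ball[OF _ _ W(1) t]] mult_left_mono HB)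
      (auto simp: W)
  also have "epow (emeasure lborel W) (p - 1) = ennreal (\<omega> powr (p - 1))"
    using W by (simp add: epow_ennreal)
  also have "ennreal (1 / t ^ DIM('a)) * ennreal (C * t powr (real DIM('a) - e * p)) = ennreal (C * t powr (- (p * e)))"
  proof -
    have "1 / t ^ DIM('a) * (C * t powr (real DIM('a) - e * p)) = C * t powr (- (p * e))"
      using t by (simp add: powr_diff powr_realpow powr_minus_divide mult.commute)
    then show ?thesis using t C by (simp flip: ennreal_mult)
  qed
  finally show ?thesis using C by (simp add: ennreal_mult ac_simps)
qed

lemma nn_integral_powr_0:
  assumes "b < 1" "0 < r"
  obtains c where "c \<ge> 0" "(\<integral>\<^sup>+t. indicator {0<..<r} t * ennreal (t powr - b) \<partial>lborel) = ennreal c"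
proof -
  have "((\<lambda>t. t powr - b) has_integral r powr (- b + 1) / (- b + 1)) {0..r}"
    using has_integral_powr_from_0[of "- b" r] assms by auto
  then have "(\<integral>\<^sup>+t. ennreal (indicator {0..r} t * t powr - b) \<partial>lborel) = ennreal (r powr (- b + 1) / (- b + 1))"
    by (intro nn_integral_has_integral_lebesgue) auto
  moreover have "(\<integral>\<^sup>+t. indicator {0<..<r} t * ennreal (t powr - b) \<partial>lborel) \<le>
      (\<integral>\<^sup>+t. ennreal (indicator {0..r} t * t powr - b) \<partial>lborel)"
    by (intro nn_integral_mono) (auto simp: indicator_def)
  ultimately have "(\<integral>\<^sup>+t. indicator {0<..<r} t * ennreal (t powr - b) \<partial>lborel) < top"
    by (metis ennreal_less_top order.strict_trans1)
  then show ?thesis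
    by (intro that[of "enn2real (\<integral>\<^sup>+t. indicator {0<..<r} t * ennreal (t powr - b) \<partial>lborel)"]) auto
qed

text \<open>With \<open>b = e - m\<close> the weight \<open>t powr - b\<close> matches the growth
  exponent \<open>e\<close>, and it is integrable near 0 because \<open>e < m + 1\<close>. The
  constant is obtained before \<open>f\<close> and \<open>H\<close>, so it depends on
  neither.\<close>

lemma nn_integral_pot_le_powr:
  fixes e p :: real
  assumes "W \<in> sets (borel :: 'a::euclidean_space measure)"
    and W: "W \<subseteq> ball 0 d" "emeasure lborel W = ennreal \<omega>" "\<omega> \<ge> 0"
    and p: "1 \<le> p" and C: "C \<ge> 0" and e: "real m \<le> e" "e < real m + 1"
  obtains K where "K \<ge> 0"
    "\<And>f H. f \<in> borel_measurable borel \<Longrightarrow> H \<in> borel_measurable borel \<Longrightarrow>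
      (\<And>y t. 0 < t \<Longrightarrow> t \<le> 1/2 \<Longrightarrow> (\<integral>\<^sup>+x. indicator (ball y (d * t)) x * H x \<partial>lborel) \<le> ennreal (C * t powr (real DIM('a) - e * p))) \<Longrightarrow>
      (\<integral>\<^sup>+x. H x * epow (pot W {0<..<1/2} m f x) p \<partial>lborel) \<le> ennreal K * (\<integral>\<^sup>+x. epow (f x) p \<partial>lborel)"
proof -
  obtain c where c: "c \<ge> 0" "(\<integral>\<^sup>+t. indicator {0<..<1/2} t * ennreal (t powr - (e - m)) \<partial>lborel) = ennreal c"
    using nn_integral_powr_0[of "e - m" "1/2"] e by auto
  show ?thesis
  proof (rule that)
    show "0 \<le> c powr p * (\<omega> powr (p - 1) * C)" using C by simp
    fix f H :: "'a \<Rightarrow> ennreal"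
    assume [measurable]: "f \<in> borel_measurable borel" "H \<in> borel_measurable borel"
      and HB: "\<And>y t. 0 < t \<Longrightarrow> t \<le> 1/2 \<Longrightarrow> (\<integral>\<^sup>+x. indicator (ball y (d * t)) x * H x \<partial>lborel) \<le> ennreal (C * t powr (real DIM('a) - e * p))"
    have "(\<integral>\<^sup>+x. H x * epow (pot W {0<..<1/2} m f x) p \<partial>lborel) \<le>
       ennreal (c powr p) * (ennreal (\<omega> powr (p - 1) * C) * (\<integral>\<^sup>+x. epow (f x) p \<partial>lborel))"
    proof (rule nn_integral_pot_le[OF _ _ assms(1) _ _ p c(2,1)])
      fix t :: real assume "t \<in> {0<..<1/2}"
      then show "(\<integral>\<^sup>+x. H x * epow (avg W t f x) p \<partial>lborel) \<le> ennreal (t powr - (p * (real m + (e - real m)))) *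
         (ennreal (\<omega> powr (p - 1) * C) * (\<integral>\<^sup>+x. epow (f x) p \<partial>lborel))"
        using nn_integral_avg_le_powr[OF _ _ assms(1) W p _ C HB, of f] by simp
    qed auto
    then show "(\<integral>\<^sup>+x. H x * epow (pot W {0<..<1/2} m f x) p \<partial>lborel) \<le>
       ennreal (c powr p * (\<omega> powr (p - 1) * C)) * (\<integral>\<^sup>+x. epow (f x) p \<partial>lborel)"
      using C by (simp add: ennreal_mult mult.assoc)
  qed
qed

text \<open>Since \<open>W\<close> stays away from the origin, only parameters \<open>t\<close> comparable to \<open>norm v\<close> contribute to the
  kernel of the potential at \<open>v\<close>; in dimension one this makes the kernel bounded.\<close>

lemma nn_integral_pot_le_1:
  fixes f :: "'a::euclidean_space \<Rightarrow> ennreal"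
  assumes [measurable]: "f \<in> borel_measurable borel" "H \<in> borel_measurable borel" "W \<in> sets borel"
    and W: "W \<subseteq> ball 0 d" "W \<inter> ball 0 a = {}" "a > 0" and dim: "DIM('a) = 1" and d: "d > 0"
    and HB: "\<And>y. (\<integral>\<^sup>+x. indicator (ball y (d / 2)) x * H x \<partial>lborel) \<le> ennreal C"
  shows "(\<integral>\<^sup>+x. H x * pot W {0<..<1/2} 0 f x \<partial>lborel) \<le> ennreal (d / a) * ennreal C * (\<integral>\<^sup>+x. f x \<partial>lborel)"
proof -
  let ?T = "{0<..<1/2} :: real set"
  have "(\<integral>\<^sup>+x. H x * pot W ?T 0 f x \<partial>lborel) =
     (\<integral>\<^sup>+x. \<integral>\<^sup>+t. \<integral>\<^sup>+w. H x * (indicator ?T t * (indicator W w * f (x + t *\<^sub>R w))) \<partial>lborel \<partial>lborel \<partial>lborel)"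
    unfolding pot_def avg_def by (simp add: nn_integral_cmult)
  also have "\<dots> = (\<integral>\<^sup>+t. \<integral>\<^sup>+x. \<integral>\<^sup>+w. H x * (indicator ?T t * (indicator W w * f (x + t *\<^sub>R w))) \<partial>lborel \<partial>lborel \<partial>lborel)"
    by (rule lborel_pair.Fubini') measurable
  also have "\<dots> = (\<integral>\<^sup>+t. \<integral>\<^sup>+w. \<integral>\<^sup>+x. H x * (indicator ?T t * (indicator W w * f (x + t *\<^sub>R w))) \<partial>lborel \<partial>lborel \<partial>lborel)"
    by (rule nn_integral_cong, rule lborel_pair.Fubini') measurable
  also have "\<dots> = (\<integral>\<^sup>+t. \<integral>\<^sup>+w. \<integral>\<^sup>+y. H (y - t *\<^sub>R w) * (indicator ?T t * (indicator W w * f y)) \<partial>lborel \<partial>lborel \<partial>lborel)"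
  proof (rule nn_integral_cong, rule nn_integral_cong)
    fix t and w :: 'a
    show "(\<integral>\<^sup>+x. H x * (indicator ?T t * (indicator W w * f (x + t *\<^sub>R w))) \<partial>lborel) =
      (\<integral>\<^sup>+y. H (y - t *\<^sub>R w) * (indicator ?T t * (indicator W w * f y)) \<partial>lborel)"
      using nn_integral_lborel_translate[of "\<lambda>y. H (y - t *\<^sub>R w) * (indicator ?T t * (indicator W w * f y))" "t *\<^sub>R w"]
      by simp
  qed
  also have "\<dots> = (\<integral>\<^sup>+t. \<integral>\<^sup>+y. \<integral>\<^sup>+w. H (y - t *\<^sub>R w) * (indicator ?T t * (indicator W w * f y)) \<partial>lborel \<partial>lborel \<partial>lborel)"
    by (rule nn_integral_cong, rule lborel_pair.Fubini') measurable
  also have "\<dots> = (\<integral>\<^sup>+y. \<integral>\<^sup>+t. \<integral>\<^sup>+w. H (y - t *\<^sub>R w) * (indicator ?T t * (indicator W w * f y)) \<partial>lborel \<partial>lborel \<partial>lborel)"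
    by (rule lborel_pair.Fubini') measurable
  also have "\<dots> = (\<integral>\<^sup>+y. f y * (\<integral>\<^sup>+t. indicator ?T t * (\<integral>\<^sup>+w. indicator W w * H (y - t *\<^sub>R w) \<partial>lborel) \<partial>lborel) \<partial>lborel)"
  proof (intro nn_integral_cong)
    fix y
    have "f y * (\<integral>\<^sup>+t. indicator ?T t * (\<integral>\<^sup>+w. indicator W w * H (y - t *\<^sub>R w) \<partial>lborel) \<partial>lborel)
      = (\<integral>\<^sup>+t. \<integral>\<^sup>+w. f y * (indicator ?T t * (indicator W w * H (y - t *\<^sub>R w))) \<partial>lborel \<partial>lborel)"
      by (simp add: nn_integral_cmult)
    then show "(\<integral>\<^sup>+t. \<integral>\<^sup>+w. H (y - t *\<^sub>R w) * (indicator ?T t * (indicator W w * f y)) \<partial>lborel \<partial>lborel)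
      = f y * (\<integral>\<^sup>+t. indicator ?T t * (\<integral>\<^sup>+w. indicator W w * H (y - t *\<^sub>R w) \<partial>lborel) \<partial>lborel)"
      by (simp add: ac_simps)
  qed
  also have "\<dots> \<le> (\<integral>\<^sup>+y. f y * (ennreal (d / a) * ennreal C) \<partial>lborel)"
  proof (intro nn_integral_mono mult_left_mono)
    fix y
    have "(\<integral>\<^sup>+t. indicator ?T t * (\<integral>\<^sup>+w. indicator W w * H (y - t *\<^sub>R w) \<partial>lborel) \<partial>lborel)
      = (\<integral>\<^sup>+t. \<integral>\<^sup>+v. indicator ?T t * (ennreal (1 / t) * (indicator W (v /\<^sub>R t) * H (y - v))) \<partial>lborel \<partial>lborel)"
    proof (intro nn_integral_cong)
      fix t :: real
      show "indicator ?T t * (\<integral>\<^sup>+w. indicator W w * H (y - t *\<^sub>R w) \<partial>lborel) =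
         (\<integral>\<^sup>+v. indicator ?T t * (ennreal (1 / t) * (indicator W (v /\<^sub>R t) * H (y - v))) \<partial>lborel)"
      proof (cases "t \<in> ?T")
        case True
        then have t: "t > 0" by simp
        have "(\<integral>\<^sup>+v. indicator W (v /\<^sub>R t) * H (y - v) \<partial>lborel)
           = ennreal t * (\<integral>\<^sup>+w. indicator W w * H (y - t *\<^sub>R w) \<partial>lborel)"
          using nn_integral_lborel_affine[of "\<lambda>v. indicator W (v /\<^sub>R t) * H (y - v)" t 0] t dim by simp
        then have "ennreal (1 / t) * (\<integral>\<^sup>+v. indicator W (v /\<^sub>R t) * H (y - v) \<partial>lborel)
           = ennreal (1 / t * t) * (\<integral>\<^sup>+w. indicator W w * H (y - t *\<^sub>R w) \<partial>lborel)"
          using t by (simp only: mult.assoc[symmetric] ennreal_mult'' less_imp_le)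
        then show ?thesis using t by (simp add: nn_integral_cmult)
      qed simp
    qed
    also have "\<dots> = (\<integral>\<^sup>+v. \<integral>\<^sup>+t. indicator ?T t * (ennreal (1 / t) * (indicator W (v /\<^sub>R t) * H (y - v))) \<partial>lborel \<partial>lborel)"
      by (rule lborel_pair.Fubini') measurable
    also have "\<dots> \<le> (\<integral>\<^sup>+v. ennreal (d / a) * (indicator (ball 0 (d / 2)) v * H (y - v)) \<partial>lborel)"
    proof (intro nn_integral_mono)
      fix v :: 'a
      have "(\<integral>\<^sup>+t. indicator ?T t * (ennreal (1 / t) * (indicator W (v /\<^sub>R t) * H (y - v))) \<partial>lborel)
         \<le> (\<integral>\<^sup>+t. (ennreal (d / norm v) * (indicator (ball 0 (d / 2)) v * H (y - v))) * indicator {0..norm v / a} t \<partial>lborel)"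
      proof (intro nn_integral_mono)
        fix t
        show "indicator ?T t * (ennreal (1 / t) * (indicator W (v /\<^sub>R t) * H (y - v))) \<le>
           (ennreal (d / norm v) * (indicator (ball 0 (d / 2)) v * H (y - v))) * indicator {0..norm v / a} t"
        \<comment> \<open>If \<open>v /\<^sub>R t\<close> lies in \<open>W\<close>, then
          \<open>1 / t \<le> d / norm v\<close> and \<open>t \<le> norm v / a\<close>. The integral
          of \<open>1 / t\<close> over these \<open>t\<close> is thus at most the product
          \<open>d / a\<close>, uniformly in \<open>v\<close>.\<close>
        proof (cases "t \<in> ?T \<and> v /\<^sub>R t \<in> W")
          case True
          then have t: "0 < t" "t < 1/2" by auto
          have "norm (v /\<^sub>R t) < d" "norm (v /\<^sub>R t) \<ge> a" using True W by (auto simp: disjoint_iff subset_eq)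
          then have v: "norm v < d * t" "a * t \<le> norm v" using t by (auto simp: field_simps)
          then have v0: "norm v > 0" using t W(3) by (smt (verit) mult_pos_pos)
          have "d * t \<le> d * (1/2)" using t d by (intro mult_left_mono) auto
          then have "norm v < d / 2" using v by simp
          moreover have "1 / t \<le> d / norm v" using v v0 t by (simp add: field_simps)
          moreover have "t \<le> norm v / a" using v W(3) by (simp add: field_simps)
          ultimately show ?thesis using True t by (auto intro!: mult_right_mono ennreal_leI)
        qed auto
      qed
      also have "\<dots> = (ennreal (d / norm v) * (indicator (ball 0 (d / 2)) v * H (y - v))) * ennreal (norm v / a)"
        using W(3) by (simp add: nn_integral_cmult)
      also have "\<dots> = (ennreal (d / norm v) * ennreal (norm v / a)) * (indicator (ball 0 (d / 2)) v * H (y - v))"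
        by (simp add: ac_simps)
      also have "\<dots> \<le> ennreal (d / a) * (indicator (ball 0 (d / 2)) v * H (y - v))"
        using d W(3) by (intro mult_right_mono) (auto simp flip: ennreal_mult)
      finally show "(\<integral>\<^sup>+t. indicator ?T t * (ennreal (1 / t) * (indicator W (v /\<^sub>R t) * H (y - v))) \<partial>lborel)
        \<le> ennreal (d / a) * (indicator (ball 0 (d / 2)) v * H (y - v))" .
    qed
    also have "\<dots> = ennreal (d / a) * (\<integral>\<^sup>+v. indicator (ball 0 (d / 2)) v * H (y - v) \<partial>lborel)"
      by (rule nn_integral_cmult) measurable
    also have "(\<integral>\<^sup>+v. indicator (ball 0 (d / 2)) v * H (y - v) \<partial>lborel) = (\<integral>\<^sup>+x. indicator (ball y (d / 2)) x * H x \<partial>lborel)"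
    proof -
      have *: "(\<lambda>v. indicator (ball 0 (d / 2)) v * H (y - v)) \<in> borel_measurable lborel"
        by measurable
      have "(\<integral>\<^sup>+v. indicator (ball 0 (d / 2)) v * H (y - v) \<partial>lborel) = (\<integral>\<^sup>+x. indicator (ball 0 (d / 2)) (y - x) * H (y - (y - x)) \<partial>lborel)"
        by (rule nn_integral_lborel_reflect[symmetric]) (rule *[unfolded measurable_lborel2])
      then show ?thesis by (simp add: indicator_def dist_norm norm_minus_commute)
    qed
    also have "\<dots> \<le> ennreal C" by (rule HB)
    finally show "(\<integral>\<^sup>+t. indicator ?T t * (\<integral>\<^sup>+w. indicator W w * H (y - t *\<^sub>R w) \<partial>lborel) \<partial>lborel) \<le> ennreal (d / a) * ennreal C"
      by (simp add: mult_left_mono)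
  qed simp
  also have "\<dots> = ennreal (d / a) * ennreal C * (\<integral>\<^sup>+x. f x \<partial>lborel)"
    by (simp add: nn_integral_multc mult.commute)
  finally show ?thesis .
qed

section \<open>Comparison of exponents by splitting at a level\<close>

lemma powr_split_le:
  assumes "0 \<le> g" "0 < \<mu>" "p \<le> (q::real)" "0 \<le> p"
  shows "g powr p \<le> \<mu> powr (p - q) * g powr q + \<mu> powr p"
proof (cases "g \<le> \<mu>")
  case True
  then have "g powr p \<le> \<mu> powr p" using assms by (intro powr_mono2) auto
  then show ?thesis by (smt (verit) powr_ge_zero mult_nonneg_nonneg)
next
  case False
  then have "g powr (p - q) \<le> \<mu> powr (p - q)" using assms by (intro powr_mono2') auto
  then have "g powr (p - q) * g powr q \<le> \<mu> powr (p - q) * g powr q"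
    by (intro mult_right_mono) auto
  moreover have "g powr (p - q) * g powr q = g powr p" using assms by (simp flip: powr_add)
  ultimately show ?thesis by (smt (verit) powr_ge_zero)
qed

text \<open>A substitute for Hoelder's inequality between the exponents \<open>p\<close> and
  \<open>q\<close> on a set of finite measure: above the level \<mu> the power \<open>q\<close>
  dominates, below it the measure of \<open>S\<close> does. A level that balances the two terms
  gives the usual exponents, up to a constant.\<close>

lemma nn_integral_powr_split_le:
  fixes G :: "'a \<Rightarrow> real"
  assumes [measurable]: "G \<in> borel_measurable M" "S \<in> sets M"
    and G: "\<And>x. 0 \<le> G x" and \<mu>: "0 < \<mu>" and pq: "p \<le> q" "0 \<le> p"
    and "(\<integral>\<^sup>+x. indicator S x * ennreal (G x powr q) \<partial>M) \<le> ennreal A" "A \<ge> 0"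
    and "emeasure M S \<le> ennreal s" "s \<ge> 0"
  shows "(\<integral>\<^sup>+x. indicator S x * ennreal (G x powr p) \<partial>M) \<le> ennreal (\<mu> powr (p - q) * A + \<mu> powr p * s)"
proof -
  have "(\<integral>\<^sup>+x. indicator S x * ennreal (G x powr p) \<partial>M) \<le>
    (\<integral>\<^sup>+x. ennreal (\<mu> powr (p - q)) * (indicator S x * ennreal (G x powr q)) + ennreal (\<mu> powr p) * indicator S x \<partial>M)"
  proof (rule nn_integral_mono)
    fix x
    show "indicator S x * ennreal (G x powr p) \<le>
      ennreal (\<mu> powr (p - q)) * (indicator S x * ennreal (G x powr q)) + ennreal (\<mu> powr p) * indicator S x"
      using powr_split_le[OF G[of x] \<mu> pq]
      by (cases "x \<in> S") (auto simp flip: ennreal_mult ennreal_plus)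
  qed
  also have "\<dots> = ennreal (\<mu> powr (p - q)) * (\<integral>\<^sup>+x. indicator S x * ennreal (G x powr q) \<partial>M) + ennreal (\<mu> powr p) * emeasure M S"
    by (simp add: nn_integral_add nn_integral_cmult)
  also have "\<dots> \<le> ennreal (\<mu> powr (p - q)) * ennreal A + ennreal (\<mu> powr p) * ennreal s"
    by (intro add_mono mult_left_mono assms) auto
  also have "\<dots> = ennreal (\<mu> powr (p - q) * A + \<mu> powr p * s)"
    using assms by (simp flip: ennreal_mult ennreal_plus)
  finally show ?thesis .
qed

section \<open>The critical exponent: weak type estimate and level sets\<close>

lemma nn_integral_powr_tail:
  assumes "e > 1" "\<eta> > 0"
  shows "(\<integral>\<^sup>+t. indicator {\<eta>..} t * ennreal (t powr - e) \<partial>lborel) = ennreal (\<eta> powr (1 - e) / (e - 1))"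
proof -
  have "((\<lambda>t. t powr - e) has_integral - (\<eta> powr (- e + 1)) / (- e + 1)) {\<eta>..}"
    using has_integral_powr_to_inf[of "- e" \<eta>] assms by auto
  then have "(\<integral>\<^sup>+t. ennreal (t powr - e) * indicator {\<eta>..} t \<partial>lborel) = ennreal (- (\<eta> powr (- e + 1)) / (- e + 1))"
    by (intro nn_integral_has_integral_lebesgue') auto
  moreover have "- (\<eta> powr (- e + 1)) / (- e + 1) = \<eta> powr (1 - e) / (e - 1)"
    using assms by (simp add: field_simps)
  ultimately show ?thesis by (simp add: mult.commute)
qed

text \<open>Jensen's inequality and the substitution \<open>y = x + t w\<close>, after which the
  restriction to \<open>W\<close> is dropped. In dimension \<open>n\<close> the resulting power
  \<open>t powr (- (n / p))\<close> is integrable at infinity for \<open>p < n\<close>, which is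
  what makes the far part of the potential small.\<close>

lemma avg_le_norm:
  fixes f :: "'a::euclidean_space \<Rightarrow> ennreal"
  assumes [measurable]: "f \<in> borel_measurable borel" "W \<in> sets borel"
    and W: "emeasure lborel W = ennreal \<omega>" "\<omega> \<ge> 0" and p: "1 \<le> p" and t: "t > 0"
    and \<Phi>: "(\<integral>\<^sup>+x. epow (f x) p \<partial>lborel) = ennreal \<Phi>" "\<Phi> \<ge> 0"
  shows "avg W t f x \<le> ennreal (\<omega> powr ((p - 1) / p) * \<Phi> powr (1 / p) * t powr (- (DIM('a) / p)))"
proof -
  have "epow (avg W t f x) p \<le> ennreal (\<omega> powr (p - 1)) * (\<integral>\<^sup>+w. indicator W w * epow (f (x + t *\<^sub>R w)) p \<partial>lborel)"
    using nn_integral_Jensen_powr[of "indicator W" lborel "\<lambda>w. f (x + t *\<^sub>R w)" p] p W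
    by (simp add: avg_def epow_ennreal)
  also have "(\<integral>\<^sup>+w. indicator W w * epow (f (x + t *\<^sub>R w)) p \<partial>lborel) \<le> (\<integral>\<^sup>+w. epow (f (x + t *\<^sub>R w)) p \<partial>lborel)"
    by (intro nn_integral_mono) (auto simp: indicator_def)
  also have "\<dots> = ennreal (1 / t ^ DIM('a)) * ennreal \<Phi>"
  proof -
    have "ennreal (1 / t ^ DIM('a)) * ennreal \<Phi> = ennreal (1 / t ^ DIM('a)) * (ennreal (t ^ DIM('a)) * (\<integral>\<^sup>+w. epow (f (x + t *\<^sub>R w)) p \<partial>lborel))"
      using nn_integral_lborel_affine[of "\<lambda>x. epow (f x) p" t x] t unfolding \<Phi>(1) by simp
    also have "\<dots> = (\<integral>\<^sup>+w. epow (f (x + t *\<^sub>R w)) p \<partial>lborel)"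
      using t by (simp add: mult.assoc[symmetric] flip: ennreal_mult)
    finally show ?thesis ..
  qed
  also have "ennreal (\<omega> powr (p - 1)) * (ennreal (1 / t ^ DIM('a)) * ennreal \<Phi>) = ennreal (\<omega> powr (p - 1) * (1 / t ^ DIM('a) * \<Phi>))"
    using \<Phi> t by (simp flip: ennreal_mult)
  finally have "epow (avg W t f x) p \<le> ennreal (\<omega> powr (p - 1) * (1 / t ^ DIM('a) * \<Phi>))"
    by (simp add: mult_left_mono)
  then have "avg W t f x \<le> ennreal ((\<omega> powr (p - 1) * (1 / t ^ DIM('a) * \<Phi>)) powr (1 / p))"
    by (rule epow_le_ennrealD) (use p t \<Phi> in auto)
  also have "(\<omega> powr (p - 1) * (1 / t ^ DIM('a) * \<Phi>)) powr (1 / p) = \<omega> powr ((p - 1) / p) * \<Phi> powr (1 / p) * t powr (- (DIM('a) / p))"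
    using t \<Phi> W by (simp add: powr_mult powr_powr powr_minus_divide powr_divide flip: powr_realpow)
  finally show ?thesis .
qed

lemma pot_split:
  assumes [measurable]: "f \<in> borel_measurable borel" "W \<in> sets borel" "T \<in> sets borel"
  shows "pot W T m f x = pot W (T \<inter> {..<\<eta>}) m f x + pot W (T \<inter> {\<eta>..}) m f x"
proof -
  have "pot W T m f x = (\<integral>\<^sup>+t. indicator (T \<inter> {..<\<eta>}) t * (ennreal (t ^ m) * avg W t f x) +
      indicator (T \<inter> {\<eta>..}) t * (ennreal (t ^ m) * avg W t f x) \<partial>lborel)"
    unfolding pot_def by (intro nn_integral_cong) (auto simp: indicator_def)
  also have "\<dots> = pot W (T \<inter> {..<\<eta>}) m f x + pot W (T \<inter> {\<eta>..}) m f x"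
    unfolding pot_def by (rule nn_integral_add) measurable
  finally show ?thesis .
qed

lemma ennreal_half_le:
  assumes "ennreal a \<le> x + y" "x \<le> ennreal (a / 2)" "a \<ge> 0"
  shows "ennreal (a / 2) \<le> y"
proof (cases y)
  case (real b)
  have "x < top" using assms(2) le_less_trans by fastforce
  then obtain c where c: "x = ennreal c" "c \<ge> 0" by (cases x) auto
  have "a \<le> c + b" "c \<le> a / 2"
    using assms c real by (auto simp flip: ennreal_plus)
  then show ?thesis unfolding real by (intro ennreal_leI) auto
qed simp

text \<open>A weak type estimate for the potential on the set \<open>S\<close>: the part of the potential over
  \<open>t \<ge> \<eta>\<close> is bounded by a negative power of \<open>\<eta>\<close>, which is chosen so that this part is at most
  \<open>\<nu> / 2\<close>.\<close>

lemma nn_integral_superlevel_pot_le: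
  fixes W :: "'a::euclidean_space set" and n :: real
  assumes [measurable]: "W \<in> sets borel"
    and W: "emeasure lborel W = ennreal \<omega>" "\<omega> > 0" and p: "1 \<le> p" "p < n"
    and n: "n = DIM('a)" and A: "A \<ge> 0"
  obtains C where "C > 0" "\<And>f G S \<nu>. f \<in> borel_measurable borel \<Longrightarrow> G \<in> borel_measurable borel \<Longrightarrow> S \<in> sets borel \<Longrightarrow>
    (\<And>x. (0::real) \<le> G x) \<Longrightarrow> (\<integral>\<^sup>+x. indicator S x * ennreal (G x powr n) \<partial>lborel) \<le> ennreal A \<Longrightarrow> \<nu> > 0 \<Longrightarrow>
    (\<And>x. x \<in> S \<Longrightarrow> ennreal \<nu> \<le> pot W {0<..<1/2} 0 f x) \<Longrightarrow>
    (\<integral>\<^sup>+x. indicator S x * ennreal (G x powr p) \<partial>lborel) \<le> ennreal (C * \<nu> powr (- p)) * (\<integral>\<^sup>+x. epow (f x) p \<partial>lborel)"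
proof -
  \<comment> \<open>The decay rate of the tail: the integral of \<open>t powr (- (n / p))\<close>
    over \<open>t \<ge> \<eta>\<close> is
    \<open>\<eta> powr (- \<theta>) / \<theta>\<close>.\<close>
  define \<theta> where "\<theta> = n / p - 1"
  have \<theta>: "\<theta> > 0" using p by (simp add: \<theta>_def)
  define K where "K = \<omega> powr ((p - 1) / p) / \<theta>"
  have K: "K > 0" using W \<theta> by (simp add: K_def)
  \<comment> \<open>What remains when the measure bound \<open>s\<close> below is written as a
    multiple of a power of \<open>X\<close> and raised to the exponent
    \<open>1 - p / n\<close>.\<close>
  define C0 where "C0 = ((2 * \<omega>) powr p * (2 * K) powr (p / \<theta>)) powr (1 - p / n)"
  have C0: "C0 > 0" using W K by (simp add: C0_def)
  show ?thesis
  proof (rule that)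
    show "C0 * (A + 1) > 0" using C0 A by simp
    fix f :: "'a \<Rightarrow> ennreal" and G :: "'a \<Rightarrow> real" and S \<nu>
    assume [measurable]: "f \<in> borel_measurable borel" "G \<in> borel_measurable borel" "S \<in> sets borel"
      and G: "\<And>x. 0 \<le> G x" and GA: "(\<integral>\<^sup>+x. indicator S x * ennreal (G x powr n) \<partial>lborel) \<le> ennreal A"
      and \<nu>: "(\<nu>::real) > 0" and S: "\<And>x. x \<in> S \<Longrightarrow> ennreal \<nu> \<le> pot W {0<..<1/2} 0 f x"
    let ?T = "{0<..<1/2} :: real set"
    show "(\<integral>\<^sup>+x. indicator S x * ennreal (G x powr p) \<partial>lborel) \<le> ennreal (C0 * (A + 1) * \<nu> powr (- p)) * (\<integral>\<^sup>+x. epow (f x) p \<partial>lborel)"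
    proof (cases "\<integral>\<^sup>+x. epow (f x) p \<partial>lborel")
      case top
      have "C0 * (A + 1) * \<nu> powr (- p) > 0" using C0 A \<nu> by simp
      then have "ennreal (C0 * (A + 1) * \<nu> powr (- p)) \<noteq> 0" by (simp only: ennreal_eq_0_iff not_le)
      then show ?thesis unfolding top by (simp only: ennreal_mult_top top_greatest if_False)
    next
      case (real \<Phi>)
      note avg_le = avg_le_norm[OF _ _ W(1) _ p(1) _ real(2,1), simplified]
      show ?thesis
      proof (cases "\<Phi> = 0")
        case True
        have "pot W ?T 0 f x = 0" for x
        proof -
          have "pot W ?T 0 f x \<le> (\<integral>\<^sup>+t. 0 \<partial>(lborel :: real measure))"
            unfolding pot_def
          proof (rule nn_integral_mono)
            fix t show "indicator ?T t * (ennreal (t ^ 0) * avg W t f x) \<le> 0"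
              using avg_le[of t x] True W by (cases "t \<in> ?T") auto
          qed
          then show ?thesis by simp
        qed
        then have "S = {}" using S \<nu> by fastforce
        then show ?thesis by simp
      next
        case False
        with real have \<Phi>: "\<Phi> > 0" by simp
        define X where "X = \<Phi> powr (1 / p) / \<nu>"
        have X: "X > 0" using \<Phi> \<nu> by (simp add: X_def)
        define \<eta> where "\<eta> = (2 * K * X) powr (1 / \<theta>)"
        have \<eta>: "\<eta> > 0" using K X by (simp add: \<eta>_def)
        have tail: "pot W (?T \<inter> {\<eta>..}) 0 f x \<le> ennreal (\<nu> / 2)" for x
        proof -
          let ?M = "\<omega> powr ((p - 1) / p) * \<Phi> powr (1 / p)"
          have "pot W (?T \<inter> {\<eta>..}) 0 f x \<le> (\<integral>\<^sup>+t. ennreal ?M * (indicator {\<eta>..} t * ennreal (t powr (- (n / p)))) \<partial>lborel)"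
            unfolding pot_def
          proof (rule nn_integral_mono)
            fix t
            show "indicator (?T \<inter> {\<eta>..}) t * (ennreal (t ^ 0) * avg W t f x) \<le> ennreal ?M * (indicator {\<eta>..} t * ennreal (t powr (- (n / p))))"
              using avg_le[of t x] W n \<eta> by (cases "t \<in> ?T \<inter> {\<eta>..}") (auto simp: ennreal_mult'')
          qed
          also have "\<dots> = ennreal ?M * ennreal (\<eta> powr (1 - n / p) / (n / p - 1))"
            using \<eta> p by (simp add: nn_integral_cmult nn_integral_powr_tail)
          also have "\<dots> = ennreal (K * \<Phi> powr (1 / p) * \<eta> powr (- \<theta>))"
            using \<theta> by (simp add: \<theta>_def K_def flip: ennreal_mult)
          also have "K * \<Phi> powr (1 / p) * \<eta> powr (- \<theta>) = \<nu> / 2"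
            using \<theta> K X \<nu> \<Phi> by (simp add: \<eta>_def powr_powr powr_minus_divide X_def)
          finally show ?thesis .
        qed
        have S': "ennreal (\<nu> / 2) \<le> pot W (?T \<inter> {..<\<eta>}) 0 f x" if "x \<in> S" for x
          using S[OF that] pot_split[of f W ?T 0 x \<eta>] tail[of x] \<nu> by (intro ennreal_half_le[of \<nu> _ "pot W (?T \<inter> {..<\<eta>}) 0 f x"]) (auto simp: add.commute)
        \<comment> \<open>Chebyshev's bound for the measure of \<open>S\<close>: there the part of
          the potential over \<open>t < \<eta>\<close> is at least \<open>\<nu> / 2\<close>, while
          its \<open>L^p\<close> norm is at most
          \<open>\<eta> * \<omega> * \<Phi> powr (1 / p)\<close>.\<close>
        define s where "s = (2 * \<omega> * \<eta> / \<nu>) powr p * \<Phi>"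
        have s: "s > 0" using W \<eta> \<nu> \<Phi> by (simp add: s_def)
        have "emeasure lborel S \<le> ennreal s"
        proof -
          define c where "c = measure lborel (?T \<inter> {..<\<eta>})"
          have "emeasure lborel (?T \<inter> {..<\<eta>}) \<le> emeasure lborel {0..\<eta>}"
            by (intro emeasure_mono) auto
          then have "emeasure lborel (?T \<inter> {..<\<eta>}) \<le> ennreal \<eta>" using \<eta> by simp
          moreover from this have "emeasure lborel (?T \<inter> {..<\<eta>}) = ennreal c"
            unfolding c_def by (intro emeasure_eq_ennreal_measure) (auto simp: top_unique)
          ultimately have c: "emeasure lborel (?T \<inter> {..<\<eta>}) = ennreal c" "0 \<le> c" "c \<le> \<eta>"
            using \<eta> by (auto simp: c_def)
          have cI: "(\<integral>\<^sup>+t. indicator (?T \<inter> {..<\<eta>}) t * ennreal (t powr - 0) \<partial>lborel) = ennreal c"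
          proof -
            have "(\<integral>\<^sup>+t. indicator (?T \<inter> {..<\<eta>}) t * ennreal (t powr - 0) \<partial>lborel) = (\<integral>\<^sup>+t. indicator (?T \<inter> {..<\<eta>}) t \<partial>lborel)"
              by (intro nn_integral_cong) (auto simp: indicator_def)
            then show ?thesis using c(1) by simp
          qed
          have "ennreal ((\<nu> / 2) powr p) * emeasure lborel S = (\<integral>\<^sup>+x. ennreal ((\<nu> / 2) powr p) * indicator S x \<partial>lborel)"
            by (simp add: nn_integral_cmult)
          also have "\<dots> \<le> (\<integral>\<^sup>+x. 1 * epow (pot W (?T \<inter> {..<\<eta>}) 0 f x) p \<partial>lborel)"
          proof (rule nn_integral_mono)
            fix x
            show "ennreal ((\<nu> / 2) powr p) * indicator S x \<le> 1 * epow (pot W (?T \<inter> {..<\<eta>}) 0 f x) p"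
              using epow_mono[OF _ S', of p x] p \<nu> by (cases "x \<in> S") (auto simp: epow_ennreal)
          qed
          also have "\<dots> \<le> ennreal (c powr p) * (ennreal (\<omega> powr p) * ennreal \<Phi>)"
          proof (rule nn_integral_pot_le[OF _ _ _ _ _ p(1) cI c(2)])
            fix t :: real assume "t \<in> ?T \<inter> {..<\<eta>}"
            then have t: "t > 0" by simp
            have "(\<integral>\<^sup>+x. 1 * epow (avg W t f x) p \<partial>lborel) \<le> epow (emeasure lborel W) (p - 1) * emeasure lborel W * (\<integral>\<^sup>+x. epow (f x) p \<partial>lborel)"
              by (rule nn_integral_avg_le[where H = "\<lambda>_. 1"]) (use p W in auto)
            also have "epow (emeasure lborel W) (p - 1) * emeasure lborel W = ennreal (\<omega> powr p)"
              using W by (simp add: epow_ennreal powr_diff flip: ennreal_mult)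
            finally show "(\<integral>\<^sup>+x. 1 * epow (avg W t f x) p \<partial>lborel) \<le> ennreal (t powr - (p * (real 0 + 0))) * (ennreal (\<omega> powr p) * ennreal \<Phi>)"
              using t real by simp
          qed auto
          also have "\<dots> \<le> ennreal (\<eta> powr p * \<omega> powr p * \<Phi>)"
            using c \<Phi> p by (auto simp: mult.assoc simp flip: ennreal_mult intro!: ennreal_leI mult_right_mono powr_mono2)
          finally have "ennreal (1 / (\<nu> / 2) powr p) * (ennreal ((\<nu> / 2) powr p) * emeasure lborel S) \<le> ennreal (1 / (\<nu> / 2) powr p) * ennreal (\<eta> powr p * \<omega> powr p * \<Phi>)"
            by (intro mult_left_mono) auto
          also have "\<dots> = ennreal s"
            using \<nu> \<eta> W \<Phi> by (simp add: s_def powr_mult powr_divide field_simps flip: ennreal_mult)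
          also have "ennreal (1 / (\<nu> / 2) powr p) * (ennreal ((\<nu> / 2) powr p) * emeasure lborel S) = emeasure lborel S"
            using \<nu> by (simp add: mult.assoc[symmetric] flip: ennreal_mult)
          finally show ?thesis .
        qed
        then have "(\<integral>\<^sup>+x. indicator S x * ennreal (G x powr p) \<partial>lborel) \<le>
           ennreal ((s powr (- 1 / n)) powr (p - n) * A + (s powr (- 1 / n)) powr p * s)"
          using s p A by (intro nn_integral_powr_split_le[where q = n] G GA) auto
        \<comment> \<open>The splitting level \<open>s powr (- 1 / n)\<close> is the one at which
          both terms scale like \<open>s powr (1 - p / n)\<close>.\<close>
        also have "(s powr (- 1 / n)) powr (p - n) * A + (s powr (- 1 / n)) powr p * s = s powr (1 - p / n) * (A + 1)"
        proof -
          have "- 1 / n * (p - n) = 1 - p / n" using p by (simp add: field_simps)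
          moreover have "(s powr (- 1 / n)) powr p * s = s powr (1 - p / n)"
          proof -
            have "(s powr (- 1 / n)) powr p * s = s powr (- 1 / n * p) * s powr 1"
              using s by (simp only: powr_powr powr_one less_imp_le)
            also have "\<dots> = s powr (1 - p / n)" unfolding powr_add[symmetric] by simp
            finally show ?thesis .
          qed
          ultimately show ?thesis by (simp add: powr_powr distrib_left)
        qed
        also have "s powr (1 - p / n) = C0 * \<nu> powr (- p) * \<Phi>"
        proof -
          have XP: "X powr p = \<nu> powr (- p) * \<Phi>"
            using \<Phi> \<nu> p by (simp add: X_def powr_divide powr_powr powr_minus_divide)
          have "s = (2 * \<omega>) powr p * \<eta> powr p * X powr p"
            unfolding XP s_def using W \<eta> \<nu> by (simp add: powr_divide powr_mult powr_minus_divide)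
          also have "\<eta> powr p = (2 * K) powr (p / \<theta>) * X powr (p / \<theta>)"
            using K X by (simp add: \<eta>_def powr_powr powr_mult)
          finally have "s = ((2 * \<omega>) powr p * (2 * K) powr (p / \<theta>)) * X powr (p / \<theta> + p)"
            by (simp add: powr_add)
          then have "s powr (1 - p / n) = C0 * X powr ((p / \<theta> + p) * (1 - p / n))"
            using X by (simp add: C0_def powr_mult powr_powr)
          \<comment> \<open>The first factor is the Sobolev exponent \<open>n p / (n - p)\<close>.
            The exponent \<open>1 - p / n\<close> brings it back to \<open>p\<close>, so the bound
            is linear in the integral of the \<open>p\<close>-th power of \<open>f\<close>.\<close>
          also have "(p / \<theta> + p) * (1 - p / n) = p"
            using p \<theta> by (simp add: \<theta>_def divide_simps) (simp add: algebra_simps)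
          finally show ?thesis unfolding XP by simp
        qed
        also have "ennreal (C0 * \<nu> powr (- p) * \<Phi> * (A + 1)) = ennreal (C0 * (A + 1) * \<nu> powr (- p)) * ennreal \<Phi>"
          using C0 A \<Phi> by (simp add: ac_simps flip: ennreal_mult)
        finally show ?thesis using real by simp
      qed
    qed
  qed
qed

section \<open>From weak type on dyadic levels to a global bound\<close>

text \<open>For fixed \<open>x\<close> the centres whose balls contain \<open>x\<close> fill a ball
  of the same radius, whose volume does not depend on \<open>x\<close>. Integration over all centres
  glues local estimates together, in place of a covering with bounded overlap.\<close>

lemma nn_integral_lborel_ball_swap:
  fixes h :: "'a::euclidean_space \<Rightarrow> ennreal"
  assumes [measurable]: "h \<in> borel_measurable borel" and r: "r \<ge> 0"
  shows "(\<integral>\<^sup>+z. \<integral>\<^sup>+x. indicator (ball z r) x * h x \<partial>lborel \<partial>lborel)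
    = ennreal (unit_ball_vol (real DIM('a)) * r ^ DIM('a)) * (\<integral>\<^sup>+x. h x \<partial>lborel)"
proof -
  have eq: "indicator (ball z r) x = (if dist z x < r then 1 else 0 :: ennreal)" for x z :: 'a
    by (simp add: indicator_def)
  have "(\<integral>\<^sup>+z. \<integral>\<^sup>+x. indicator (ball z r) x * h x \<partial>lborel \<partial>lborel) = (\<integral>\<^sup>+x. \<integral>\<^sup>+z. indicator (ball z r) x * h x \<partial>lborel \<partial>lborel)"
    unfolding eq by (rule lborel_pair.Fubini') measurable
  also have "\<dots> = (\<integral>\<^sup>+x. emeasure lborel (ball x r) * h x \<partial>lborel)"
  proof (rule nn_integral_cong)
    fix x :: 'a
    have "(\<integral>\<^sup>+z. indicator (ball z r) x * h x \<partial>lborel) = (\<integral>\<^sup>+z. indicator (ball x r) z * h x \<partial>lborel)"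
      by (intro nn_integral_cong) (auto simp: indicator_def dist_commute)
    also have "\<dots> = emeasure lborel (ball x r) * h x"
      by (subst nn_integral_multc) auto
    finally show "(\<integral>\<^sup>+z. indicator (ball z r) x * h x \<partial>lborel) = emeasure lborel (ball x r) * h x" .
  qed
  also have "\<dots> = ennreal (unit_ball_vol (real DIM('a)) * r ^ DIM('a)) * (\<integral>\<^sup>+x. h x \<partial>lborel)"
    using r by (simp add: emeasure_ball nn_integral_cmult)
  finally show ?thesis .
qed

lemma ennreal_mult_le_imp_le:
  assumes "ennreal a * x \<le> y" "a > 0"
  shows "x \<le> ennreal (1 / a) * y"
proof -
  have "ennreal (1 / a) * (ennreal a * x) \<le> ennreal (1 / a) * y"
    using assms(1) by (intro mult_left_mono) auto
  then show ?thesis using assms(2) by (simp add: mult.assoc[symmetric] flip: ennreal_mult)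
qed

text \<open>The index is one less than the usual one: a value between \<open>2 powr (k + 1)\<close>
  and \<open>2 powr (k + 2)\<close> is attached to the band from \<open>2 powr k\<close> to
  \<open>2 powr (k + 1)\<close> just below it, which a path that descends far enough has to
  cross.\<close>

lemma dyadic_level:
  assumes "(u::real) > 0" obtains k :: int where "2 powr (real_of_int k + 1) \<le> u" "u < 2 powr (real_of_int k + 2)"
proof (rule that[of "\<lfloor>log 2 u\<rfloor> - 1"])
  have "2 powr real_of_int \<lfloor>log 2 u\<rfloor> \<le> 2 powr (log 2 u)" by (intro powr_mono) auto
  then show "2 powr (real_of_int (\<lfloor>log 2 u\<rfloor> - 1) + 1) \<le> u" using assms by simp
  have "2 powr (log 2 u) < 2 powr (real_of_int \<lfloor>log 2 u\<rfloor> + 1)" by (intro powr_less_mono) linarith+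
  then show "u < 2 powr (real_of_int (\<lfloor>log 2 u\<rfloor> - 1) + 2)" using assms by (simp add: add.commute)
qed

text \<open>\<open>int_decode\<close> turns the family over the integers into one over the naturals,
  as series require.\<close>

lemma disjoint_dyadic_levels:
  "disjoint_family (\<lambda>i. {y. 2 powr real_of_int (int_decode i) < u y \<and> u y < 2 powr (real_of_int (int_decode i) + 1)})"
proof -
  have "\<not> (2 powr real_of_int k < v \<and> v < 2 powr (real_of_int k + 1) \<and> 2 powr real_of_int l < v \<and> v < 2 powr (real_of_int l + 1))"
    if "k < l" for k l :: int and v :: real
  proof
    assume *: "2 powr real_of_int k < v \<and> v < 2 powr (real_of_int k + 1) \<and> 2 powr real_of_int l < v \<and> v < 2 powr (real_of_int l + 1)"
    have "2 powr (real_of_int k + 1) \<le> 2 powr real_of_int l" using that by (intro powr_mono) auto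
    then show False using * by linarith
  qed
  then show ?thesis
    unfolding disjoint_family_on_def disjoint_iff
    by (metis (mono_tags, lifting) int_decode_eq linorder_neqE_linordered_idom mem_Collect_eq)
qed

text \<open>The upgrade from weak to strong type. Where the average at distance 1/2 is comparable to
  \<open>u\<close>, it suffices alone. Elsewhere the hypothesis forces a large potential of the part
  of \<open>F\<close> on one band; multiplied by the height, the weak type constant is free of
  \<open>k\<close>, and the disjointness of the bands lets the bounds add up to a single integral of
  \<open>F\<close>. The argument is run in balls because the integrals of \<open>G powr n\<close>
  are bounded over balls only.\<close>

lemma nn_integral_level_sets_le:
  fixes W :: "'a::euclidean_space set" and n :: real
  assumes [measurable]: "W \<in> sets borel"
    and W: "emeasure lborel W = ennreal \<omega>" "\<omega> > 0" "W \<subseteq> ball 0 d" and d: "d > 0" and p: "1 \<le> p" "p < n"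
    and n: "n = DIM('a)" and A: "A \<ge> 0"
  obtains C where "C \<ge> 0" "\<And>u F G D. u \<in> borel_measurable borel \<Longrightarrow> F \<in> borel_measurable borel \<Longrightarrow>
    G \<in> borel_measurable borel \<Longrightarrow> D \<in> sets borel \<Longrightarrow>
    (\<And>x. (0::real) \<le> u x) \<Longrightarrow> (\<And>x. (0::real) \<le> G x) \<Longrightarrow>
    (\<And>z. (\<integral>\<^sup>+x. indicator (ball z (d / 2)) x * ennreal (G x powr n) \<partial>lborel) \<le> ennreal A) \<Longrightarrow>
    (\<And>x (k::int). x \<in> D \<Longrightarrow> 2 powr (real_of_int k + 1) \<le> u x \<Longrightarrow>
       ennreal (\<omega> * 2 powr k) \<le> avg W (1/2) (\<lambda>x. ennreal (u x)) x
         + ennreal d * pot W {0<..<1/2} 0 (\<lambda>y. indicator {y. 2 powr k < u y \<and> u y < 2 powr (real_of_int k + 1)} y * F y) x) \<Longrightarrow>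
    (\<integral>\<^sup>+x. indicator D x * ennreal (G x powr p * u x powr p) \<partial>lborel) \<le>
      ennreal C * ((\<integral>\<^sup>+x. ennreal (u x powr p) \<partial>lborel) + (\<integral>\<^sup>+x. epow (F x) p \<partial>lborel))"
proof -
  obtain C1 where C1: "C1 > 0" "\<And>f G S \<nu>. f \<in> borel_measurable borel \<Longrightarrow> G \<in> borel_measurable borel \<Longrightarrow> S \<in> sets borel \<Longrightarrow>
    (\<And>x. (0::real) \<le> G x) \<Longrightarrow> (\<integral>\<^sup>+x. indicator S x * ennreal (G x powr n) \<partial>lborel) \<le> ennreal A \<Longrightarrow> \<nu> > 0 \<Longrightarrow>
    (\<And>x. x \<in> S \<Longrightarrow> ennreal \<nu> \<le> pot W {0<..<1/2} 0 f x) \<Longrightarrow>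
    (\<integral>\<^sup>+x. indicator S x * ennreal (G x powr p) \<partial>lborel) \<le> ennreal (C1 * \<nu> powr (- p)) * (\<integral>\<^sup>+x. epow (f x) p \<partial>lborel)"
    using nn_integral_superlevel_pot_le[OF assms(1) W(1,2) p n A] by blast
  define vol where "vol r = unit_ball_vol n * r ^ DIM('a)" for r
  have vol: "vol r > 0" if "r > 0" for r using that by (simp add: vol_def n)
  define C2 where "C2 = (8 / \<omega>) powr p * (\<omega> powr (p - 1) * ((A + vol (d / 2)) * 2 powr n))"
  define C3 where "C3 = C1 * (8 * d / \<omega>) powr p"
  define C4 where "C4 = 1 / vol (d / 2) * (C3 * vol d)"
  have C2: "C2 \<ge> 0" using A vol[of "d/2"] d by (simp add: C2_def)
  have C3: "C3 > 0" using C1 W d by (simp add: C3_def)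
  have C4: "C4 \<ge> 0" using C3 d vol[of d] vol[of "d/2"] by (simp add: C4_def)
  show ?thesis
  proof (rule that)
    show "max C2 C4 \<ge> 0" using C2 by simp
    fix u :: "'a \<Rightarrow> real" and F :: "'a \<Rightarrow> ennreal" and G :: "'a \<Rightarrow> real" and D
    assume [measurable]: "u \<in> borel_measurable borel" "F \<in> borel_measurable borel" "G \<in> borel_measurable borel" "D \<in> sets borel"
      and u: "\<And>x. 0 \<le> u x" and G: "\<And>x. 0 \<le> G x"
      and GA: "\<And>z. (\<integral>\<^sup>+x. indicator (ball z (d / 2)) x * ennreal (G x powr n) \<partial>lborel) \<le> ennreal A"
      and ray: "\<And>x (k::int). x \<in> D \<Longrightarrow> 2 powr (real_of_int k + 1) \<le> u x \<Longrightarrow>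
       ennreal (\<omega> * 2 powr k) \<le> avg W (1/2) (\<lambda>x. ennreal (u x)) x
         + ennreal d * pot W {0<..<1/2} 0 (\<lambda>y. indicator {y. 2 powr k < u y \<and> u y < 2 powr (real_of_int k + 1)} y * F y) x"
    let ?T = "{0<..<1/2} :: real set"
    let ?a = "\<lambda>x. avg W (1/2) (\<lambda>x. ennreal (u x)) x"
    let ?h = "\<lambda>x. ennreal (G x powr p * u x powr p)"
    \<comment> \<open>The factor 1/8 is what the dyadic step needs: if
      \<open>u x < 2 powr (k + 2)\<close>, an average below \<open>\<omega> * u x / 8\<close> is at
      most half of \<open>\<omega> * 2 powr k\<close>, the left-hand side of
      \<open>ray\<close>.\<close>
    define D1 where "D1 = D \<inter> {x. ennreal (\<omega> * u x / 8) \<le> ?a x}"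
    define D2 where "D2 = D \<inter> {x. ?a x < ennreal (\<omega> * u x / 8)}"
    have [measurable]: "{x. ennreal (\<omega> * u x / 8) \<le> ?a x} \<in> sets borel" "{x. ?a x < ennreal (\<omega> * u x / 8)} \<in> sets borel"
      by measurable
    have [measurable]: "D1 \<in> sets borel" "D2 \<in> sets borel"
      by (auto simp: D1_def D2_def)
    \<comment> \<open>The radius is fixed, so splitting at the level 1 is enough.\<close>
    have HB: "(\<integral>\<^sup>+x. indicator (ball y (d / 2)) x * ennreal (G x powr p) \<partial>lborel) \<le> ennreal (A + vol (d / 2))" for y
    proof -
      have "emeasure lborel (ball y (d / 2)) \<le> ennreal (vol (d / 2))"
        using d by (simp add: emeasure_ball vol_def n)
      then have "(\<integral>\<^sup>+x. indicator (ball y (d / 2)) x * ennreal (G x powr p) \<partial>lborel) \<le> ennreal (1 powr (p - n) * A + 1 powr p * vol (d / 2))"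
        using A p d vol[of "d/2"] by (intro nn_integral_powr_split_le[OF _ _ G _ _ _ GA]) auto
      then show ?thesis by simp
    qed
    have I1: "(\<integral>\<^sup>+x. indicator D1 x * ?h x \<partial>lborel) \<le> ennreal C2 * (\<integral>\<^sup>+x. ennreal (u x powr p) \<partial>lborel)"
    proof -
      have "(\<integral>\<^sup>+x. indicator D1 x * ?h x \<partial>lborel) \<le> (\<integral>\<^sup>+x. ennreal ((8 / \<omega>) powr p) * (ennreal (G x powr p) * epow (?a x) p) \<partial>lborel)"
      proof (rule nn_integral_mono)
        fix x
        show "indicator D1 x * ?h x \<le> ennreal ((8 / \<omega>) powr p) * (ennreal (G x powr p) * epow (?a x) p)"
        proof (cases "x \<in> D1")
          case True
          then have "epow (ennreal (\<omega> * u x / 8)) p \<le> epow (?a x) p"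
            using p by (intro epow_mono) (auto simp: D1_def)
          then have "ennreal ((8 / \<omega>) powr p) * (ennreal (G x powr p) * ennreal ((\<omega> * u x / 8) powr p)) \<le> ennreal ((8 / \<omega>) powr p) * (ennreal (G x powr p) * epow (?a x) p)"
            using W u by (intro mult_left_mono) (auto simp: epow_ennreal)
          moreover have "ennreal ((8 / \<omega>) powr p) * (ennreal (G x powr p) * ennreal ((\<omega> * u x / 8) powr p)) = ?h x"
          proof -
            have "(8 / \<omega>) powr p * (\<omega> * u x / 8) powr p = u x powr p"
              using W u[of x] by (simp flip: powr_mult)
            then have "(8 / \<omega>) powr p * (G x powr p * (\<omega> * u x / 8) powr p) = G x powr p * u x powr p"
              by (metis mult.left_commute)
            then show ?thesis by (simp flip: ennreal_mult)
          qed
          ultimately show ?thesis using True by simp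
        qed simp
      qed
      also have "\<dots> = ennreal ((8 / \<omega>) powr p) * (\<integral>\<^sup>+x. ennreal (G x powr p) * epow (?a x) p \<partial>lborel)"
        by (intro nn_integral_cmult) measurable
      also have "(\<integral>\<^sup>+x. ennreal (G x powr p) * epow (?a x) p \<partial>lborel) \<le> ennreal ((1/2) powr (- (p * 0))) * (ennreal (\<omega> powr (p - 1) * ((A + vol (d / 2)) * 2 powr n)) * (\<integral>\<^sup>+x. epow (ennreal (u x)) p \<partial>lborel))"
      proof (rule nn_integral_avg_le_powr[OF _ _ _ W(3,1)])
        fix y
        have "(2::real) powr n * (1 / 2) powr n = 1" by (simp flip: powr_mult)
        then have *: "(A + vol (d / 2)) * 2 powr n * (1 / 2) powr (n - 0 * p) = A + vol (d / 2)" by (simp add: mult.assoc)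
        then show "(\<integral>\<^sup>+x. indicator (ball y (d * (1 / 2))) x * ennreal (G x powr p) \<partial>lborel) \<le> ennreal ((A + vol (d / 2)) * 2 powr n * (1 / 2) powr (real DIM('a) - 0 * p))"
          unfolding n[symmetric] * using HB[of y] by simp
      qed (use W p A vol[of "d/2"] d in auto)
      also have "\<dots> = ennreal (\<omega> powr (p - 1) * ((A + vol (d / 2)) * 2 powr n)) * (\<integral>\<^sup>+x. ennreal (u x powr p) \<partial>lborel)"
        using u by (simp add: epow_ennreal)
      finally show ?thesis
        using A vol[of "d/2"] d by (simp add: C2_def ennreal_mult mult.assoc mult_left_mono)
    qed
    let ?L = "\<lambda>k::int. {y. 2 powr k < u y \<and> u y < 2 powr (real_of_int k + 1)}"
    have piece: "(\<integral>\<^sup>+x. indicator (D2 \<inter> ball z (d / 2) \<inter> {x. 2 powr (real_of_int k + 1) \<le> u x \<and> u x < 2 powr (real_of_int k + 2)}) x * ?h x \<partial>lborel)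
       \<le> ennreal C3 * (\<integral>\<^sup>+y. indicator (?L k) y * (indicator (ball z d) y * epow (F y) p) \<partial>lborel)" for z and k :: int
    proof -
      define S where "S = D2 \<inter> ball z (d / 2) \<inter> {x. 2 powr (real_of_int k + 1) \<le> u x \<and> u x < 2 powr (real_of_int k + 2)}"
      have [measurable]: "S \<in> sets borel" unfolding S_def by measurable
      \<comment> \<open>For \<open>x\<close> within \<open>d / 2\<close> of \<open>z\<close> the
        points \<open>x + t w\<close> with \<open>t < 1/2\<close> stay within \<open>d\<close> of
        \<open>z\<close>, so cutting \<open>F\<close> off to that ball does not change the potential
        at \<open>x\<close>.\<close>
      define f where "f y = indicator (ball z d) y * (indicator (?L k) y * F y)" for y
      have [measurable]: "f \<in> borel_measurable borel" unfolding f_def by measurable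
      define \<nu> where "\<nu> = 1 / d * (\<omega> * 2 powr k / 2)"
      have \<nu>: "\<nu> > 0" using W d by (simp add: \<nu>_def)
      have "(\<integral>\<^sup>+x. indicator S x * ennreal (G x powr p) \<partial>lborel) \<le> ennreal (C1 * \<nu> powr (- p)) * (\<integral>\<^sup>+x. epow (f x) p \<partial>lborel)"
      proof (rule C1(2)[OF _ _ _ G _ \<nu>])
        have "(\<integral>\<^sup>+x. indicator S x * ennreal (G x powr n) \<partial>lborel) \<le> (\<integral>\<^sup>+x. indicator (ball z (d / 2)) x * ennreal (G x powr n) \<partial>lborel)"
          by (intro nn_integral_mono mult_right_mono) (auto simp: S_def indicator_def)
        also have "\<dots> \<le> ennreal A" by (rule GA)
        finally show "(\<integral>\<^sup>+x. indicator S x * ennreal (G x powr n) \<partial>lborel) \<le> ennreal A" .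
        fix x assume x: "x \<in> S"
        have "pot W ?T 0 (\<lambda>y. indicator (?L k) y * F y) x = pot W ?T 0 f x"
          unfolding pot_def avg_def
        proof (rule nn_integral_cong)
          fix t :: real
          have "x + t *\<^sub>R w \<in> ball z d" if "t \<in> ?T" "w \<in> W" for w
          proof -
            have "norm w < d" using W(3) that by auto
            then have "norm (t *\<^sub>R w) < d / 2" using that mult_strict_mono[of t "1/2" "norm w" d] d by auto
            moreover have "dist z x < d / 2" using x by (simp add: S_def)
            moreover have "dist z (x + t *\<^sub>R w) \<le> dist z x + norm (t *\<^sub>R w)"
              by (metis add_diff_cancel_left' dist_norm dist_triangle dist_commute)
            ultimately show ?thesis by simp
          qed
          then show "indicator ?T t * (ennreal (t ^ 0) * (\<integral>\<^sup>+w. indicator W w * (indicator (?L k) (x + t *\<^sub>R w) * F (x + t *\<^sub>R w)) \<partial>lborel)) =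
            indicator ?T t * (ennreal (t ^ 0) * (\<integral>\<^sup>+w. indicator W w * f (x + t *\<^sub>R w) \<partial>lborel))"
            by (cases "t \<in> ?T") (auto simp: f_def indicator_def intro!: nn_integral_cong)
        qed
        with ray[of x k] x have "ennreal (\<omega> * 2 powr k) \<le> ?a x + ennreal d * pot W ?T 0 f x"
          by (auto simp: S_def D2_def)
        moreover have "?a x \<le> ennreal (\<omega> * 2 powr k / 2)"
        proof -
          have "\<omega> * u x / 8 \<le> \<omega> * 2 powr (real_of_int k + 2) / 8" using x W by (intro divide_right_mono mult_left_mono) (auto simp: S_def)
          also have "\<dots> = \<omega> * 2 powr k / 2" by (simp add: powr_add)
          finally have "ennreal (\<omega> * u x / 8) \<le> ennreal (\<omega> * 2 powr k / 2)" by (rule ennreal_leI)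
          moreover have "?a x < ennreal (\<omega> * u x / 8)" using x by (auto simp: S_def D2_def)
          ultimately show ?thesis by (meson less_imp_le order_trans)
        qed
        ultimately have "ennreal (\<omega> * 2 powr k / 2) \<le> ennreal d * pot W ?T 0 f x"
          using W by (intro ennreal_half_le) auto
        then have "ennreal (1 / d) * ennreal (\<omega> * 2 powr k / 2) \<le> ennreal (1 / d) * (ennreal d * pot W ?T 0 f x)"
          by (intro mult_left_mono) auto
        then show "ennreal \<nu> \<le> pot W ?T 0 f x"
          using d W by (simp add: \<nu>_def mult.assoc[symmetric] flip: ennreal_mult)
      qed auto
      also have "(\<integral>\<^sup>+x. epow (f x) p \<partial>lborel) = (\<integral>\<^sup>+y. indicator (?L k) y * (indicator (ball z d) y * epow (F y) p) \<partial>lborel)"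
        by (intro nn_integral_cong) (auto simp: f_def indicator_def)
      finally have *: "(\<integral>\<^sup>+x. indicator S x * ennreal (G x powr p) \<partial>lborel) \<le> ennreal (C1 * \<nu> powr (- p)) * \<dots>" .
      have "(\<integral>\<^sup>+x. indicator S x * ?h x \<partial>lborel) \<le> (\<integral>\<^sup>+x. ennreal ((4 * 2 powr k) powr p) * (indicator S x * ennreal (G x powr p)) \<partial>lborel)"
      proof (rule nn_integral_mono)
        fix x
        show "indicator S x * ?h x \<le> ennreal ((4 * 2 powr k) powr p) * (indicator S x * ennreal (G x powr p))"
        proof (cases "x \<in> S")
          case True
          then have "u x powr p \<le> (4 * 2 powr k) powr p" using u p by (intro powr_mono2) (auto simp: S_def powr_add)
          then show ?thesis using True by (auto simp: mult.commute simp flip: ennreal_mult intro!: ennreal_leI mult_left_mono)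
        qed simp
      qed
      also have "\<dots> = ennreal ((4 * 2 powr k) powr p) * (\<integral>\<^sup>+x. indicator S x * ennreal (G x powr p) \<partial>lborel)"
        by (intro nn_integral_cmult) measurable
      also have "\<dots> \<le> ennreal ((4 * 2 powr k) powr p) * (ennreal (C1 * \<nu> powr (- p)) * (\<integral>\<^sup>+y. indicator (?L k) y * (indicator (ball z d) y * epow (F y) p) \<partial>lborel))"
        by (intro mult_left_mono *) auto
      also have "ennreal ((4 * 2 powr k) powr p) * (ennreal (C1 * \<nu> powr (- p)) * (\<integral>\<^sup>+y. indicator (?L k) y * (indicator (ball z d) y * epow (F y) p) \<partial>lborel))
        = ennreal ((4 * 2 powr k) powr p * (C1 * \<nu> powr (- p))) * (\<integral>\<^sup>+y. indicator (?L k) y * (indicator (ball z d) y * epow (F y) p) \<partial>lborel)"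
        using C1 by (simp add: ennreal_mult mult.assoc)
      also have "(4 * 2 powr k) powr p * (C1 * \<nu> powr (- p)) = C3"
      proof -
        have "(4 * 2 powr k) powr p * \<nu> powr (- p) = (4 * 2 powr k / \<nu>) powr p"
          using \<nu> by (simp add: powr_divide powr_minus_divide)
        \<comment> \<open>The height of \<open>u\<close> on the piece and the threshold for the
          potential are both proportional to \<open>2 powr k\<close>, so \<open>k\<close> cancels;
          this is what permits the summation over all levels.\<close>
        also have "4 * 2 powr k / \<nu> = 8 * d / \<omega>" using W d by (simp add: \<nu>_def field_simps)
        finally show ?thesis by (simp add: C3_def)
      qed
      finally show ?thesis unfolding S_def .
    qed
    have local: "(\<integral>\<^sup>+x. indicator (ball z (d / 2)) x * (indicator D2 x * ?h x) \<partial>lborel) \<le> ennreal C3 * (\<integral>\<^sup>+y. indicator (ball z d) y * epow (F y) p \<partial>lborel)" for z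
    proof -
      let ?S = "\<lambda>i. D2 \<inter> ball z (d / 2) \<inter> {x. 2 powr (real_of_int (int_decode i) + 1) \<le> u x \<and> u x < 2 powr (real_of_int (int_decode i) + 2)}"
      have "(\<integral>\<^sup>+x. indicator (ball z (d / 2)) x * (indicator D2 x * ?h x) \<partial>lborel) \<le> (\<integral>\<^sup>+x. (\<Sum>i. indicator (?S i) x * ?h x) \<partial>lborel)"
      proof (rule nn_integral_mono)
        fix x
        show "indicator (ball z (d / 2)) x * (indicator D2 x * ?h x) \<le> (\<Sum>i. indicator (?S i) x * ?h x)"
        proof (cases "x \<in> D2 \<inter> ball z (d / 2)")
          case True
          then have "u x \<noteq> 0" by (auto simp: D2_def)
          with u[of x] have "u x > 0" by simp
          then obtain k :: int where k: "2 powr (real_of_int k + 1) \<le> u x" "u x < 2 powr (real_of_int k + 2)" by (rule dyadic_level)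
          have "?h x = (\<Sum>i\<in>{int_encode k}. indicator (?S i) x * ?h x)"
            using True k by simp
          also have "\<dots> \<le> (\<Sum>i. indicator (?S i) x * ?h x)"
            by (rule sum_le_suminf) auto
          finally show ?thesis using True by simp
        qed (auto simp: indicator_def)
      qed
      also have "\<dots> = (\<Sum>i. \<integral>\<^sup>+x. indicator (?S i) x * ?h x \<partial>lborel)"
        by (rule nn_integral_suminf) measurable
      also have "\<dots> \<le> (\<Sum>i. ennreal C3 * (\<integral>\<^sup>+y. indicator (?L (int_decode i)) y * (indicator (ball z d) y * epow (F y) p) \<partial>lborel))"
        by (intro suminf_le piece) auto
      also have "\<dots> = ennreal C3 * (\<Sum>i. \<integral>\<^sup>+y. indicator (?L (int_decode i)) y * (indicator (ball z d) y * epow (F y) p) \<partial>lborel)"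
        by (rule ennreal_suminf_cmult)
      also have "(\<Sum>i. \<integral>\<^sup>+y. indicator (?L (int_decode i)) y * (indicator (ball z d) y * epow (F y) p) \<partial>lborel)
          = (\<integral>\<^sup>+y. (\<Sum>i. indicator (?L (int_decode i)) y * (indicator (ball z d) y * epow (F y) p)) \<partial>lborel)"
        by (rule nn_integral_suminf[symmetric]) measurable
      also have "\<dots> \<le> (\<integral>\<^sup>+y. indicator (ball z d) y * epow (F y) p \<partial>lborel)"
      proof (rule nn_integral_mono)
        fix y
        have "(\<Sum>i. indicator (?L (int_decode i)) y * (indicator (ball z d) y * epow (F y) p)) = (\<Sum>i. indicator (?L (int_decode i)) y) * (indicator (ball z d) y * epow (F y) p)"
          by (rule ennreal_suminf_multc)
        also have "(\<Sum>i. indicator (?L (int_decode i)) y :: ennreal) = indicator (\<Union>i. ?L (int_decode i)) y"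
          by (rule suminf_indicator[OF disjoint_dyadic_levels])
        also have "\<dots> * (indicator (ball z d) y * epow (F y) p) \<le> indicator (ball z d) y * epow (F y) p"
          by (auto simp: indicator_def)
        finally show "(\<Sum>i. indicator (?L (int_decode i)) y * (indicator (ball z d) y * epow (F y) p)) \<le> indicator (ball z d) y * epow (F y) p" .
      qed
      finally show ?thesis by (simp add: mult_left_mono)
    qed
    have I2: "(\<integral>\<^sup>+x. indicator D2 x * ?h x \<partial>lborel) \<le> ennreal C4 * (\<integral>\<^sup>+x. epow (F x) p \<partial>lborel)"
    proof -
      \<comment> \<open>Integrating the local bound over all centres counts each point with the
        volume of a ball, of radius \<open>d / 2\<close> on the left and of radius \<open>d\<close>
        on the right.\<close>
      have "ennreal (vol (d / 2)) * (\<integral>\<^sup>+x. indicator D2 x * ?h x \<partial>lborel) = (\<integral>\<^sup>+z. \<integral>\<^sup>+x. indicator (ball z (d / 2)) x * (indicator D2 x * ?h x) \<partial>lborel \<partial>lborel)"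
        unfolding vol_def n by (rule nn_integral_lborel_ball_swap[symmetric]) (measurable, use d in simp)
      also have "\<dots> \<le> (\<integral>\<^sup>+z. ennreal C3 * (\<integral>\<^sup>+y. indicator (ball z d) y * epow (F y) p \<partial>lborel) \<partial>lborel)"
        by (intro nn_integral_mono local)
      also have "\<dots> = ennreal C3 * (\<integral>\<^sup>+z. \<integral>\<^sup>+y. indicator (ball z d) y * epow (F y) p \<partial>lborel \<partial>lborel)"
      proof (rule nn_integral_cmult)
        have eq: "indicator (ball z d) x = (if dist z x < d then 1 else 0 :: ennreal)" for x z :: 'a
          by (simp add: indicator_def)
        show "(\<lambda>z. \<integral>\<^sup>+y. indicator (ball z d) y * epow (F y) p \<partial>lborel) \<in> borel_measurable lborel"
          unfolding eq by measurable
      qed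
      also have "(\<integral>\<^sup>+z. \<integral>\<^sup>+y. indicator (ball z d) y * epow (F y) p \<partial>lborel \<partial>lborel) = ennreal (vol d) * (\<integral>\<^sup>+x. epow (F x) p \<partial>lborel)"
        unfolding vol_def n by (rule nn_integral_lborel_ball_swap) (measurable, use d in simp)
      finally have "(\<integral>\<^sup>+x. indicator D2 x * ?h x \<partial>lborel) \<le> ennreal (1 / vol (d / 2)) * (ennreal C3 * (ennreal (vol d) * (\<integral>\<^sup>+x. epow (F x) p \<partial>lborel)))"
        using d by (intro ennreal_mult_le_imp_le vol) auto
      also have "\<dots> = ennreal C4 * (\<integral>\<^sup>+x. epow (F x) p \<partial>lborel)"
        using C3 vol[of "d/2"] vol[of d] d by (simp add: C4_def mult.assoc[symmetric] flip: ennreal_mult)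
      finally show ?thesis .
    qed
    have "(\<integral>\<^sup>+x. indicator D x * ?h x \<partial>lborel) = (\<integral>\<^sup>+x. indicator D1 x * ?h x + indicator D2 x * ?h x \<partial>lborel)"
      by (intro nn_integral_cong) (auto simp: D1_def D2_def indicator_def)
    also have "\<dots> = (\<integral>\<^sup>+x. indicator D1 x * ?h x \<partial>lborel) + (\<integral>\<^sup>+x. indicator D2 x * ?h x \<partial>lborel)"
      by (intro nn_integral_add) measurable
    also have "\<dots> \<le> ennreal (max C2 C4) * (\<integral>\<^sup>+x. ennreal (u x powr p) \<partial>lborel) + ennreal (max C2 C4) * (\<integral>\<^sup>+x. epow (F x) p \<partial>lborel)"
      by (intro add_mono order_trans[OF I1] order_trans[OF I2] mult_right_mono ennreal_leI) auto
    finally show "(\<integral>\<^sup>+x. indicator D x * ?h x \<partial>lborel) \<le> ennreal (max C2 C4) * ((\<integral>\<^sup>+x. ennreal (u x powr p) \<partial>lborel) + (\<integral>\<^sup>+x. epow (F x) p \<partial>lborel))"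
      by (simp add: distrib_left)
  qed
qed

section \<open>Smearing weakly differentiable functions and differentiation along rays\<close>

text \<open>Limits of difference quotients can be taken along sequences, the form to which dominated
  convergence applies.\<close>

lemma has_vector_derivative_iff_Lim:
  fixes f :: "real \<Rightarrow> 'a::real_normed_vector"
  shows "(f has_vector_derivative D) (at t) \<longleftrightarrow> ((\<lambda>s. (f s - f t) /\<^sub>R (s - t)) \<longlongrightarrow> D) (at t)"
proof -
  have eq: "norm (f s - f t - (s - t) *\<^sub>R D) / norm (s - t) = norm ((f s - f t) /\<^sub>R (s - t) - D)" if "s \<noteq> t" for s
  proof -
    have "(f s - f t) /\<^sub>R (s - t) - D = (f s - f t - (s - t) *\<^sub>R D) /\<^sub>R (s - t)"
      using that by (simp add: scaleR_right_diff_distrib)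
    then show ?thesis by (simp add: divide_inverse abs_inverse mult.commute)
  qed
  have "((\<lambda>s. norm (f s - f t - (s - t) *\<^sub>R D) / norm (s - t)) \<longlongrightarrow> 0) (at t) \<longleftrightarrow>
     ((\<lambda>s. norm ((f s - f t) /\<^sub>R (s - t) - D)) \<longlongrightarrow> 0) (at t)"
    by (intro filterlim_cong refl) (use eq in \<open>auto simp: eventually_at_filter\<close>)
  then show ?thesis
    unfolding has_vector_derivative_def has_derivative_iff_norm Lim_null[of _ D] tendsto_norm_zero_iff
    by (simp add: bounded_linear_scaleR_left)
qed

lemma norm_diff_le_nn_integral_deriv:
  fixes h :: "real \<Rightarrow> complex"
  assumes ab: "a \<le> b" and h: "\<And>t. a \<le> t \<Longrightarrow> t \<le> b \<Longrightarrow> (h has_vector_derivative h' t) (at t within {a..b})"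
    and h': "continuous_on {a..b} h'"
  shows "ennreal (norm (h b - h a)) \<le> (\<integral>\<^sup>+t. indicator {a<..<b} t * ennreal (norm (h' t)) \<partial>lborel)"
proof -
  have I: "(h' has_integral (h b - h a)) {a..b}"
    by (rule fundamental_theorem_of_calculus) (use ab h in auto)
  have N: "(\<lambda>t. norm (h' t)) integrable_on {a..b}"
    by (intro integrable_continuous_interval continuous_intros h')
  have "norm (h b - h a) \<le> integral {a..b} (\<lambda>t. norm (h' t))"
    using integral_norm_bound_integral[of h' "{a..b}" "\<lambda>t. norm (h' t)"] I N
    by (auto simp: integrable_on_def integral_unique)
  then have "ennreal (norm (h b - h a)) \<le> ennreal (integral {a..b} (\<lambda>t. norm (h' t)))"
    by (rule ennreal_leI)
  also have "\<dots> = (\<integral>\<^sup>+t. ennreal (norm (h' t)) * indicator {a..b} t \<partial>lborel)"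
    by (rule nn_integral_has_integral_lebesgue'[symmetric]) (use N integrable_integral in auto)
  also have "\<dots> = (\<integral>\<^sup>+t. indicator {a<..<b} t * ennreal (norm (h' t)) \<partial>lborel)"
  proof (rule nn_integral_cong_AE)
    have "AE t in lborel. t \<noteq> a" "AE t in lborel. t \<noteq> b" by (rule AE_lborel_singleton)+
    then show "AE t in lborel. ennreal (norm (h' t)) * indicator {a..b} t = indicator {a<..<b} t * ennreal (norm (h' t))"
      by eventually_elim (auto simp: indicator_def)
  qed
  finally show ?thesis .
qed

text \<open>Taylor's formula at the far endpoint \<open>b\<close>, from the fundamental theorem
  applied to \<open>h t - t h' t\<close>, whose derivative is \<open>- t h'' t\<close>. Expanding
  there gives the remainder the weight \<open>t\<close>, which vanishes at the end where the
  potential is singular.\<close>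

lemma norm_le_nn_integral_deriv2:
  fixes h :: "real \<Rightarrow> complex"
  assumes b: "0 \<le> b" and h: "\<And>t. 0 \<le> t \<Longrightarrow> t \<le> b \<Longrightarrow> (h has_vector_derivative h' t) (at t within {0..b})"
    and h': "\<And>t. 0 \<le> t \<Longrightarrow> t \<le> b \<Longrightarrow> (h' has_vector_derivative h'' t) (at t within {0..b})"
    and h'': "continuous_on {0..b} h''"
  shows "ennreal (norm (h 0)) \<le> ennreal (norm (h b)) + ennreal b * ennreal (norm (h' b))
    + (\<integral>\<^sup>+t. indicator {0<..<b} t * (ennreal t * ennreal (norm (h'' t))) \<partial>lborel)"
proof -
  let ?g = "\<lambda>t. h t - t *\<^sub>R h' t"
  have "ennreal (norm (?g b - ?g 0)) \<le> (\<integral>\<^sup>+t. indicator {0<..<b} t * ennreal (norm (- (t *\<^sub>R h'' t))) \<partial>lborel)"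
  proof (rule norm_diff_le_nn_integral_deriv[OF b])
    fix t assume t: "0 \<le> t" "t \<le> b"
    show "(?g has_vector_derivative - (t *\<^sub>R h'' t)) (at t within {0..b})"
      by (rule has_vector_derivative_eq_rhs, rule has_vector_derivative_diff[OF h[OF t]],
          rule has_vector_derivative_scaleR[OF _ h'[OF t]], rule DERIV_ident) simp
  qed (intro continuous_intros h'')
  also have "\<dots> = (\<integral>\<^sup>+t. indicator {0<..<b} t * (ennreal t * ennreal (norm (h'' t))) \<partial>lborel)"
    by (intro nn_integral_cong) (auto simp: indicator_def ennreal_mult)
  finally have *: "ennreal (norm (?g b - ?g 0)) \<le> \<dots>" .
  have "norm (h 0) \<le> norm (h b) + b * norm (h' b) + norm (?g b - ?g 0)"
  proof -
    have "h 0 = h b - b *\<^sub>R h' b - (?g b - ?g 0)" by simp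
    then have "norm (h 0) \<le> norm (h b - b *\<^sub>R h' b) + norm (?g b - ?g 0)" by (metis norm_triangle_ineq4)
    also have "norm (h b - b *\<^sub>R h' b) \<le> norm (h b) + b * norm (h' b)"
      using norm_triangle_ineq4[of "h b" "b *\<^sub>R h' b"] b by simp
    finally show ?thesis by simp
  qed
  then have "ennreal (norm (h 0)) \<le> ennreal (norm (h b)) + ennreal b * ennreal (norm (h' b)) + ennreal (norm (?g b - ?g 0))"
    using b by (simp flip: ennreal_plus ennreal_mult)
  also have "\<dots> \<le> ennreal (norm (h b)) + ennreal b * ennreal (norm (h' b))
    + (\<integral>\<^sup>+t. indicator {0<..<b} t * (ennreal t * ennreal (norm (h'' t))) \<partial>lborel)"
    by (intro add_left_mono *)
  finally show ?thesis .
qed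

text \<open>This replaces the truncation of Sobolev functions at dyadic levels: a path that descends from
  level \<open>2 M\<close> to level \<open>M\<close> has length at least \<open>M\<close> between the two levels.\<close>

lemma level_le_nn_integral_deriv:
  fixes h :: "real \<Rightarrow> complex"
  assumes b: "0 \<le> b" and h: "\<And>t. 0 \<le> t \<Longrightarrow> t \<le> b \<Longrightarrow> (h has_vector_derivative h' t) (at t within {0..b})"
    and h': "continuous_on {0..b} h'" and M: "2 * M \<le> norm (h 0)" "0 < M"
  shows "ennreal M \<le> ennreal (norm (h b)) +
    (\<integral>\<^sup>+t. indicator {0<..<b} t * (indicator {y. M < norm y \<and> norm y < 2 * M} (h t) * ennreal (norm (h' t))) \<partial>lborel)"
proof (cases "norm (h b) \<ge> M")
  case True
  then have "ennreal M \<le> ennreal (norm (h b))" by (rule ennreal_leI)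
  then show ?thesis by (simp add: add_increasing2)
next
  case False
  have cont: "continuous_on {0..b} (\<lambda>t. norm (h t))"
    using has_vector_derivative_continuous[OF h]
    by (intro continuous_on_norm) (auto simp: continuous_on_eq_continuous_within)
  \<comment> \<open>\<open>t0\<close> will be the last time at height at least \<open>2 * M\<close>
    and \<open>t1\<close> the first later time at height at most \<open>M\<close>; strictly between
    them the height lies in the open band.\<close>
  let ?A = "{t \<in> {0..b}. 2 * M \<le> norm (h t)}"
  have "compact ?A"
    unfolding compact_eq_bounded_closed
    by (intro conjI continuous_on_closed_Collect_le cont continuous_on_const closed_atLeastAtMost
          bounded_subset[OF bounded_closed_interval[of 0 b]]) auto
  moreover have "?A \<noteq> {}" using M b by auto
  ultimately obtain t0 where t0: "t0 \<in> ?A" "\<And>t. t \<in> ?A \<Longrightarrow> t \<le> t0"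
    using compact_attains_sup[of ?A] by blast
  let ?B = "{t \<in> {t0..b}. norm (h t) \<le> M}"
  have cont': "continuous_on {t0..b} (\<lambda>t. norm (h t))"
    using cont by (rule continuous_on_subset) (use t0 in auto)
  have "compact ?B"
    unfolding compact_eq_bounded_closed
    by (intro conjI continuous_on_closed_Collect_le cont' continuous_on_const closed_atLeastAtMost
          bounded_subset[OF bounded_closed_interval[of t0 b]]) auto
  moreover have "?B \<noteq> {}" using False t0 by auto
  ultimately obtain t1 where t1: "t1 \<in> ?B" "\<And>t. t \<in> ?B \<Longrightarrow> t1 \<le> t"
    using compact_attains_inf[of ?B] by blast
  have "t0 \<le> t1" using t1 by auto
  have sub: "{t0..t1} \<subseteq> {0..b}" using t0 t1 by auto
  have "ennreal M \<le> ennreal (norm (h t1 - h t0))"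
    using t0(1) t1(1) norm_triangle_ineq3[of "h t1" "h t0"] by (intro ennreal_leI) auto
  also have "\<dots> \<le> (\<integral>\<^sup>+t. indicator {t0<..<t1} t * ennreal (norm (h' t)) \<partial>lborel)"
    using sub \<open>t0 \<le> t1\<close>
    by (intro norm_diff_le_nn_integral_deriv continuous_on_subset[OF h'] has_vector_derivative_within_subset[OF h]) auto
  also have "\<dots> \<le> (\<integral>\<^sup>+t. indicator {0<..<b} t * (indicator {y. M < norm y \<and> norm y < 2 * M} (h t) * ennreal (norm (h' t))) \<partial>lborel)"
  proof (rule nn_integral_mono)
    fix t
    show "indicator {t0<..<t1} t * ennreal (norm (h' t)) \<le> indicator {0<..<b} t * (indicator {y. M < norm y \<and> norm y < 2 * M} (h t) * ennreal (norm (h' t)))"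
    proof (cases "t \<in> {t0<..<t1}")
      case True
      then have "M < norm (h t)" "norm (h t) < 2 * M"
        using t0(2)[of t] t1(2)[of t] t0(1) t1(1) by force+
      then show ?thesis using True t0(1) t1(1) by auto
    qed simp
  qed
  finally show ?thesis by (simp add: add_increasing)
qed

lemma norm_scaleR_inverse_le:
  fixes v :: "'a::real_normed_vector"
  assumes "norm v \<le> L * \<bar>a\<bar>" "a \<noteq> 0" shows "norm (v /\<^sub>R a) \<le> L"
proof -
  have "norm (v /\<^sub>R a) = norm v / \<bar>a\<bar>" by (simp add: divide_inverse mult.commute)
  then show ?thesis using assms by (simp add: pos_divide_le_eq)
qed

section \<open>Differentiating pairings with a moving test function\<close>

text \<open>Functions on \<Omega> are used extended by zero, so local integrability is required on
  the whole space; pairings with translated test functions are then defined without regard to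
  \<Omega>.\<close>

definition loc_int :: "('a::euclidean_space \<Rightarrow> complex) \<Rightarrow> bool" where
  "loc_int U \<longleftrightarrow> U \<in> borel_measurable borel \<and> (\<forall>r. integrable lborel (\<lambda>x. indicator (cball 0 r) x *\<^sub>R U x))"

lemma loc_int_mult_integrable:
  assumes U: "loc_int U" and [measurable]: "\<phi> \<in> borel_measurable borel"
    and B: "\<And>y. norm (\<phi> y) \<le> B" and supp: "\<And>y. y \<notin> cball 0 r \<Longrightarrow> \<phi> y = 0"
  shows "integrable lborel (\<lambda>y. U y * \<phi> y)"
proof (rule Bochner_Integration.integrable_bound)
  have [measurable]: "U \<in> borel_measurable borel" using U by (simp add: loc_int_def)
  show "integrable lborel (\<lambda>y. B *\<^sub>R norm (indicator (cball 0 r) y *\<^sub>R U y))"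
    using U by (intro integrable_scaleR_right integrable_norm) (simp add: loc_int_def)
  show "(\<lambda>y. U y * \<phi> y) \<in> borel_measurable lborel" by measurable
  have "norm (U y * \<phi> y) \<le> norm (B *\<^sub>R norm (indicator (cball 0 r) y *\<^sub>R U y))" for y
  proof (cases "y \<in> cball 0 r")
    case True
    have "B \<ge> 0" using B[of y] norm_ge_zero order_trans by blast
    then show ?thesis using True B[of y]
      by (simp add: norm_mult) (metis mult.commute mult_left_mono norm_ge_zero)
  qed (use supp in simp)
  then show "AE y in lborel. norm (U y * \<phi> y) \<le> norm (B *\<^sub>R norm (indicator (cball 0 r) y *\<^sub>R U y))" by simp
qed

definition shiftf :: "('n::finite \<Rightarrow> real \<Rightarrow> real) \<Rightarrow> real^'n \<Rightarrow> 'n \<Rightarrow> real \<Rightarrow> real" where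
  "shiftf F v k s = F k (s - v $ k)"

lemma prodf_shiftf: "prodf (shiftf F v) y = prodf F (y - v)"
  by (simp add: prodf_def shiftf_def)

lemma cprodf_shiftf: "cprodf (shiftf F v) y = cprodf F (y - v)"
  by (simp add: cprodf_def prodf_shiftf)

lemma bump1_shiftf:
  assumes "\<And>k. bump1 (l $ k) (u $ k) (F k)"
  shows "bump1 ((l + v) $ k) ((u + v) $ k) (shiftf F v k)"
  using bump1_affine[OF assms[of k], of 1 "v $ k"] by (simp add: shiftf_def[abs_def] add.commute)

lemma gradf_shiftf:
  assumes "\<And>k. smooth1 (F k)"
  shows "gradf (shiftf F v) i = shiftf (gradf F i) v"
  using deriv_affine[OF assms, of 1 _ "v $ i"] by (auto simp: gradf_def shiftf_def[abs_def] fun_eq_iff)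

lemma shiftf_line_has_derivative:
  assumes "\<And>k. smooth1 (F k)"
  shows "((\<lambda>t. cprodf F (y - t *\<^sub>R w)) has_vector_derivative - (\<Sum>i\<in>UNIV. complex_of_real (w $ i) * cprodf (gradf F i) (y - t *\<^sub>R w))) (at t)"
proof -
  have "((\<lambda>t. y - t *\<^sub>R w) has_derivative (\<lambda>s. - (s *\<^sub>R w))) (at t)"
    by (auto intro!: derivative_eq_intros)
  from has_derivative_compose[OF this cprodf_has_derivative[OF assms]]
  show ?thesis unfolding has_vector_derivative_def
    by (rule has_derivative_eq_rhs)
      (auto simp: fun_eq_iff sum_negf scaleR_sum_right scaleR_conv_of_real[where 'a = complex] mult_ac sum_distrib_left intro!: sum.cong)
qed

text \<open>Differentiation under the integral: the derivative falls on the test function, so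
  \<open>U\<close> only has to be locally integrable. The difference quotients are dominated by a
  Lipschitz constant of \<open>cprodf F\<close> along \<open>w\<close> times the modulus of
  \<open>U\<close> on a ball.\<close>

lemma pairing_has_derivative:
  fixes w :: "real^'n"
  assumes U: "loc_int U" and F: "\<And>k. bump1 (l $ k) (u $ k) (F k)"
  shows "((\<lambda>t. LINT y|lborel. U y * cprodf F (y - t *\<^sub>R w)) has_vector_derivative
    - (\<Sum>i\<in>UNIV. complex_of_real (w $ i) * (LINT y|lborel. U y * cprodf (gradf F i) (y - t *\<^sub>R w)))) (at t)"
proof -
  have sm: "\<And>k. smooth1 (F k)" using F by (simp add: bump1_def)
  note G = bump1_gradf[OF F]
  have [measurable]: "U \<in> borel_measurable borel" using U by (simp add: loc_int_def)
  have [measurable]: "cprodf F \<in> borel_measurable borel" "\<And>i. cprodf (gradf F i) \<in> borel_measurable borel"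
    using borel_measurable_prodf[OF F] borel_measurable_prodf[OF G] by (simp_all add: cprodf_def[abs_def])
  have [measurable]: "prodf F \<in> borel_measurable borel" "\<And>i. prodf (gradf F i) \<in> borel_measurable borel"
    by (intro borel_measurable_prodf[OF F] borel_measurable_prodf[OF G])+
  have "\<exists>B>0. \<forall>y. \<bar>prodf (gradf F i) y\<bar> \<le> B" for i
    using prodf_bounded[OF G[of _ i]] by metis
  then obtain B where B: "\<And>i. B i > 0" "\<And>i y. \<bar>prodf (gradf F i) y\<bar> \<le> B i" by metis
  obtain B0 where B0: "B0 > 0" "\<And>y. \<bar>prodf F y\<bar> \<le> B0" using prodf_bounded[OF F] by metis
  define L where "L = (\<Sum>i\<in>UNIV. \<bar>w $ i\<bar> * B i)"
  obtain r0 where r0: "cbox l u \<subseteq> cball 0 r0" using bounded_cbox[of l u] by (metis bounded_iff mem_cball_0 subsetI)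
  \<comment> \<open>One radius for the supports shifted by all \<open>s\<close> with
    \<open>\<bar>s\<bar> \<le> \<bar>t\<bar> + 1\<close>, which is enough near
    \<open>t\<close>.\<close>
  define r where "r = r0 + (\<bar>t\<bar> + 1) * norm w"
  have supp: "y - s *\<^sub>R w \<notin> cbox l u" if "y \<notin> cball 0 r" "\<bar>s\<bar> \<le> \<bar>t\<bar> + 1" for y s
  proof
    assume "y - s *\<^sub>R w \<in> cbox l u"
    then have "norm (y - s *\<^sub>R w) \<le> r0" using r0 by auto
    moreover have "norm y \<le> norm (y - s *\<^sub>R w) + norm (s *\<^sub>R w)" by (metis diff_add_cancel norm_triangle_ineq)
    moreover have "norm (s *\<^sub>R w) \<le> (\<bar>t\<bar> + 1) * norm w" using that(2) by (simp add: mult_right_mono)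
    ultimately show False using that(1) by (simp add: r_def)
  qed
  have int0: "integrable lborel (\<lambda>y. U y * cprodf F (y - s *\<^sub>R w))" if "\<bar>s\<bar> \<le> \<bar>t\<bar> + 1" for s
    by (rule loc_int_mult_integrable[OF U, where B = B0 and r = r])
      (use B0 prodf_eq_0[OF F] supp that in \<open>auto simp: cprodf_def\<close>)
  have int1: "integrable lborel (\<lambda>y. U y * cprodf (gradf F i) (y - t *\<^sub>R w))" for i
    by (rule loc_int_mult_integrable[OF U, where B = "B i" and r = r])
      (use B prodf_eq_0[OF G] supp in \<open>auto simp: cprodf_def\<close>)
  have lip: "norm (cprodf F (y - s *\<^sub>R w) - cprodf F (y - t *\<^sub>R w)) \<le> L * \<bar>s - t\<bar>" for y s
  proof -
    have "norm (cprodf F (y - s *\<^sub>R w) - cprodf F (y - t *\<^sub>R w)) \<le> L * norm (s - t)"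
    proof (rule differentiable_bound[of UNIV])
      fix s :: real
      show "((\<lambda>s. cprodf F (y - s *\<^sub>R w)) has_derivative (\<lambda>h. h *\<^sub>R - (\<Sum>i\<in>UNIV. complex_of_real (w $ i) * cprodf (gradf F i) (y - s *\<^sub>R w)))) (at s within UNIV)"
        using shiftf_line_has_derivative[where F = F and y = y and w = w and t = s, OF sm] by (simp add: has_vector_derivative_def)
      have "norm (\<Sum>i\<in>UNIV. complex_of_real (w $ i) * cprodf (gradf F i) (y - s *\<^sub>R w)) \<le> L"
        unfolding L_def by (intro sum_norm_le) (use B in \<open>auto simp: norm_mult cprodf_def intro!: mult_left_mono\<close>)
      then show "onorm (\<lambda>h. h *\<^sub>R - (\<Sum>i\<in>UNIV. complex_of_real (w $ i) * cprodf (gradf F i) (y - s *\<^sub>R w))) \<le> L"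
        by (intro onorm_le) (simp, metis abs_ge_zero mult.commute mult_left_mono)
    qed auto
    then show ?thesis by simp
  qed
  have L: "L \<ge> 0" unfolding L_def using B(1) by (intro sum_nonneg mult_nonneg_nonneg) (auto simp: less_imp_le)
  let ?K = "\<lambda>t. LINT y|lborel. U y * cprodf F (y - t *\<^sub>R w)"
  let ?D = "- (\<Sum>i\<in>UNIV. complex_of_real (w $ i) * (LINT y|lborel. U y * cprodf (gradf F i) (y - t *\<^sub>R w)))"
  have "((\<lambda>s. (?K s - ?K t) /\<^sub>R (s - t)) \<longlongrightarrow> ?D) (at t)"
  proof (subst tendsto_at_iff_sequentially, intro allI impI)
    fix X :: "nat \<Rightarrow> real" assume X: "\<forall>i. X i \<in> UNIV - {t}" "X \<longlonglongrightarrow> t"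
    let ?q = "\<lambda>i y. U y * ((cprodf F (y - X i *\<^sub>R w) - cprodf F (y - t *\<^sub>R w)) /\<^sub>R (X i - t))"
    let ?l = "\<lambda>y. U y * - (\<Sum>i\<in>UNIV. complex_of_real (w $ i) * cprodf (gradf F i) (y - t *\<^sub>R w))"
    have ev: "eventually (\<lambda>i. \<bar>X i\<bar> \<le> \<bar>t\<bar> + 1) sequentially"
    proof -
      have "eventually (\<lambda>i. dist (X i) t < 1) sequentially" using X(2) by (rule tendstoD) simp
      then show ?thesis by eventually_elim (auto simp: dist_real_def)
    qed
    then obtain N where N: "\<And>i. i \<ge> N \<Longrightarrow> \<bar>X i\<bar> \<le> \<bar>t\<bar> + 1" by (auto simp: eventually_sequentially)
    have lim: "(\<lambda>i. LINT y|lborel. ?q (i + N) y) \<longlonglongrightarrow> (LINT y|lborel. ?l y)"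
    proof (rule integral_dominated_convergence[where w = "\<lambda>y. L *\<^sub>R norm (indicator (cball 0 r) y *\<^sub>R U y)"])
      show "integrable lborel (\<lambda>y. L *\<^sub>R norm (indicator (cball 0 r) y *\<^sub>R U y))"
        using U by (intro integrable_scaleR_right integrable_norm) (simp add: loc_int_def)
      have "(\<lambda>i. ?q (i + N) y) \<longlonglongrightarrow> ?l y" for y
      proof (intro tendsto_mult_left)
        have "((\<lambda>s. (cprodf F (y - s *\<^sub>R w) - cprodf F (y - t *\<^sub>R w)) /\<^sub>R (s - t)) \<longlongrightarrow> - (\<Sum>i\<in>UNIV. complex_of_real (w $ i) * cprodf (gradf F i) (y - t *\<^sub>R w))) (at t)"
          using shiftf_line_has_derivative[where F = F and y = y and w = w and t = t, OF sm] by (simp add: has_vector_derivative_iff_Lim)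
        then have "(\<lambda>i. (cprodf F (y - X i *\<^sub>R w) - cprodf F (y - t *\<^sub>R w)) /\<^sub>R (X i - t)) \<longlonglongrightarrow> - (\<Sum>i\<in>UNIV. complex_of_real (w $ i) * cprodf (gradf F i) (y - t *\<^sub>R w))"
          using X by (subst (asm) tendsto_at_iff_sequentially) (auto simp: comp_def)
        then show "(\<lambda>i. (cprodf F (y - X (i + N) *\<^sub>R w) - cprodf F (y - t *\<^sub>R w)) /\<^sub>R (X (i + N) - t)) \<longlonglongrightarrow> - (\<Sum>i\<in>UNIV. complex_of_real (w $ i) * cprodf (gradf F i) (y - t *\<^sub>R w))"
          by (rule LIMSEQ_ignore_initial_segment)
      qed
      then show "AE y in lborel. (\<lambda>i. ?q (i + N) y) \<longlonglongrightarrow> ?l y" by simp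
      fix i
      show "?q (i + N) \<in> borel_measurable lborel" by measurable
      have "norm (?q (i + N) y) \<le> L *\<^sub>R norm (indicator (cball 0 r) y *\<^sub>R U y)" for y
      proof (cases "y \<in> cball 0 r")
        case True
        have "X (i + N) \<noteq> t" using X(1) by auto
        then have "norm ((cprodf F (y - X (i + N) *\<^sub>R w) - cprodf F (y - t *\<^sub>R w)) /\<^sub>R (X (i + N) - t)) \<le> L"
          using lip[of y "X (i + N)"] by (intro norm_scaleR_inverse_le) auto
        then show ?thesis using True by (simp only: norm_mult) (simp, metis mult.commute mult_left_mono norm_ge_zero)
      next
        case False
        then have "cprodf F (y - X (i + N) *\<^sub>R w) = 0" "cprodf F (y - t *\<^sub>R w) = 0"
          using prodf_eq_0[OF F] supp[OF False] N[of "i + N"] by (auto simp: cprodf_def)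
        then show ?thesis using L by simp
      qed
      then show "AE y in lborel. norm (?q (i + N) y) \<le> L *\<^sub>R norm (indicator (cball 0 r) y *\<^sub>R U y)" by simp
    qed measurable
    have D: "(LINT y|lborel. ?l y) = ?D"
    proof -
      have "(LINT y|lborel. ?l y) = (LINT y|lborel. - (\<Sum>i\<in>UNIV. complex_of_real (w $ i) * (U y * cprodf (gradf F i) (y - t *\<^sub>R w))))"
        by (intro Bochner_Integration.integral_cong) (auto simp: sum_distrib_left mult_ac)
      also have "\<dots> = - (LINT y|lborel. (\<Sum>i\<in>UNIV. complex_of_real (w $ i) * (U y * cprodf (gradf F i) (y - t *\<^sub>R w))))"
        by (rule Bochner_Integration.integral_minus)
      also have "\<dots> = ?D"
        by (subst Bochner_Integration.integral_sum) (use int1 in auto)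
      finally show ?thesis .
    qed
    have q: "(LINT y|lborel. ?q (i + N) y) = (?K (X (i + N)) - ?K t) /\<^sub>R (X (i + N) - t)" for i
    proof -
      have "(?K (X (i + N)) - ?K t) = (LINT y|lborel. U y * cprodf F (y - X (i + N) *\<^sub>R w) - U y * cprodf F (y - t *\<^sub>R w))"
        using int0[OF N[of "i + N"]] int0[of t] by (simp add: Bochner_Integration.integral_diff)
      then show ?thesis
        by (simp add: right_diff_distrib scaleR_right_diff_distrib flip: integral_scaleR_right)
    qed
    have "(\<lambda>i. (?K (X (i + N)) - ?K t) /\<^sub>R (X (i + N) - t)) \<longlonglongrightarrow> ?D"
      using lim unfolding D q .
    then show "((\<lambda>s. (?K s - ?K t) /\<^sub>R (s - t)) \<circ> X) \<longlonglongrightarrow> ?D"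
      unfolding comp_def by (rule LIMSEQ_offset)
  qed
  then show ?thesis by (simp add: has_vector_derivative_iff_Lim)
qed

section \<open>One-sided mollification with a product kernel\<close>

definition bumps :: "real^'n \<Rightarrow> real^'n \<Rightarrow> 'n::finite \<Rightarrow> real \<Rightarrow> real" where
  "bumps l u k = bump (l $ k) (u $ k)"

definition kern :: "real^'n \<Rightarrow> real^'n \<Rightarrow> real^'n::finite \<Rightarrow> real" where
  "kern l u = prodf (bumps l u)"

text \<open>The box from \<open>l\<close> to \<open>u\<close> may avoid the origin, so the values
  used at \<open>x\<close> may all come from one side of \<open>x\<close>. The kernel is not
  normalised: for small positive \<tau> the result is close to the integral of the kernel times
  \<open>f\<close>.\<close>

definition smear :: "real^'n \<Rightarrow> real^'n \<Rightarrow> real \<Rightarrow> (real^'n \<Rightarrow> complex) \<Rightarrow> real^'n::finite \<Rightarrow> complex" where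
  "smear l u \<tau> f x = (LINT w|lborel. kern l u w *\<^sub>R f (x + \<tau> *\<^sub>R w))"

lemma bump1_bumps: "bump1 (l $ k) (u $ k) (bumps l u k)"
  unfolding bumps_def by (rule bump1_bump)

lemma kern_nonneg: "0 \<le> kern l u y" and kern_le_1: "kern l u y \<le> 1"
  unfolding kern_def prodf_def bumps_def
  by (auto intro!: prod_nonneg prod_le_1 simp: bump_nonneg bump_le_1)

lemma kern_eq_0: "y \<notin> cbox l u \<Longrightarrow> kern l u y = 0"
  unfolding kern_def by (rule prodf_eq_0[OF bump1_bumps])

lemma borel_measurable_kern [measurable]: "kern l u \<in> borel_measurable borel"
  unfolding kern_def by (rule borel_measurable_prodf[OF bump1_bumps])

lemma kern_pos: "y \<in> box l u \<Longrightarrow> kern l u y > 0"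
  unfolding kern_def prodf_def bumps_def
  by (auto intro!: prod_pos simp: bump_pos_iff mem_box_cart)

lemma kern_le_indicator: "kern l u y \<le> indicator (cbox l u) y"
  using kern_eq_0[of y l u] kern_le_1[of l u y] by (cases "y \<in> cbox l u") auto

lemma integrable_kern: "integrable lborel (kern l u)"
proof (rule Bochner_Integration.integrable_bound)
  show "integrable lborel (indicator (cbox l u) :: real^'a \<Rightarrow> real)"
    using emeasure_bounded_finite[OF bounded_cbox[of l u]] by (simp add: integrable_indicator_iff)
  show "AE x in lborel. norm (kern l u x) \<le> norm (indicator (cbox l u) x :: real)"
    using kern_le_indicator[of l u] kern_nonneg[of l u] by (auto simp: abs_of_nonneg)
qed simp

lemma integral_kern_pos:
  assumes "\<And>k. l $ k < u $ k" shows "(LINT w|lborel. kern l u w) > 0"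
proof -
  have ne: "box l u \<noteq> {}"
    using assms by (auto simp: box_ne_empty Basis_vec_def inner_axis)
  have "\<not> (AE w in lborel. kern l u w = 0)"
  proof
    assume "AE w in lborel. kern l u w = 0"
    then have "AE w in lborel. w \<notin> box l u" by eventually_elim (use kern_pos in force)
    then have "emeasure lborel (box l u) = 0" by (simp add: AE_iff_null_sets null_setsD1)
    moreover have "emeasure lborel (box l u) = ennreal (\<Prod>b\<in>Basis. (u - l) \<bullet> b)"
      using ne by (intro emeasure_lborel_box) (auto simp: box_ne_empty less_imp_le)
    moreover have "(\<Prod>b\<in>Basis. (u - l) \<bullet> b) > 0"
      using ne by (intro prod_pos) (auto simp: box_ne_empty inner_diff_left)
    ultimately show False by (metis ennreal_eq_0_iff not_le)
  qed
  then have "(LINT w|lborel. kern l u w) \<noteq> 0"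
    using integral_nonneg_eq_0_iff_AE[OF integrable_kern[of l u]] kern_nonneg[of l u] by auto
  moreover have "(LINT w|lborel. kern l u w) \<ge> 0" by (simp add: kern_nonneg)
  ultimately show ?thesis by simp
qed

lemma borel_measurable_smear [measurable (raw)]:
  assumes [measurable]: "f \<in> borel_measurable borel" "h \<in> borel_measurable M"
  shows "(\<lambda>z. smear l u \<tau> f (h z)) \<in> borel_measurable M"
  unfolding smear_def by measurable

lemma norm_smear_le_avg:
  assumes W: "cbox l u \<subseteq> W"
  shows "ennreal (norm (smear l u \<tau> f x)) \<le> avg W \<tau> (\<lambda>y. ennreal (norm (f y))) x"
proof (cases "integrable lborel (\<lambda>w. kern l u w *\<^sub>R f (x + \<tau> *\<^sub>R w))")
  case True
  have "ennreal (norm (smear l u \<tau> f x)) \<le> (\<integral>\<^sup>+w. ennreal (norm (kern l u w *\<^sub>R f (x + \<tau> *\<^sub>R w))) \<partial>lborel)"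
    unfolding smear_def by (rule integral_norm_bound_ennreal[OF True])
  also have "\<dots> \<le> avg W \<tau> (\<lambda>y. ennreal (norm (f y))) x"
    unfolding avg_def
  proof (rule nn_integral_mono)
    fix w
    show "ennreal (norm (kern l u w *\<^sub>R f (x + \<tau> *\<^sub>R w))) \<le> indicator W w * ennreal (norm (f (x + \<tau> *\<^sub>R w)))"
      using kern_le_1[of l u w] kern_nonneg[of l u w] kern_eq_0[of w l u] W
      by (cases "w \<in> W") (auto intro!: ennreal_leI mult_left_le_one_le)
  qed
  finally show ?thesis .
\<comment> \<open>Without integrability the Bochner integral that defines \<open>smear\<close> is 0
  by convention.\<close>
qed (simp add: smear_def not_integrable_integral_eq)

text \<open>Young's convolution inequality, obtained from the averaging estimate with the weight
  \<open>H = 1\<close>.\<close>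

lemma nn_integral_smear_le:
  assumes [measurable]: "f \<in> borel_measurable borel" "W \<in> sets borel" and W: "cbox l u \<subseteq> W" "emeasure lborel W = ennreal \<omega>" "\<omega> \<ge> 0"
    and p: "1 \<le> p"
  shows "(\<integral>\<^sup>+x. ennreal (norm (smear l u \<tau> f x) powr p) \<partial>lborel) \<le> ennreal (\<omega> powr p) * (\<integral>\<^sup>+x. ennreal (norm (f x) powr p) \<partial>lborel)"
proof -
  have "(\<integral>\<^sup>+x. ennreal (norm (smear l u \<tau> f x) powr p) \<partial>lborel) \<le> (\<integral>\<^sup>+x. 1 * epow (avg W \<tau> (\<lambda>y. ennreal (norm (f y))) x) p \<partial>lborel)"
    using epow_mono[OF _ norm_smear_le_avg[OF W(1)], of p] p by (intro nn_integral_mono) (auto simp: epow_ennreal)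
  also have "\<dots> \<le> epow (emeasure lborel W) (p - 1) * emeasure lborel W * (\<integral>\<^sup>+x. epow (ennreal (norm (f x))) p \<partial>lborel)"
    by (rule nn_integral_avg_le[where H = "\<lambda>_. 1"]) (use p W in auto)
  also have "epow (emeasure lborel W) (p - 1) * emeasure lborel W = ennreal (\<omega> powr p)"
    using W by (cases "\<omega> = 0") (auto simp: epow_ennreal powr_diff simp flip: ennreal_mult)
  finally show ?thesis by (simp add: epow_ennreal)
qed

definition scalef :: "('n::finite \<Rightarrow> real \<Rightarrow> real) \<Rightarrow> real^'n \<Rightarrow> real \<Rightarrow> 'n \<Rightarrow> real \<Rightarrow> real" where
  "scalef F x \<tau> k s = F k ((s - x $ k) / \<tau>)"

lemma bump1_scalef:
  assumes "\<And>k. bump1 (l $ k) (u $ k) (F k)" "\<tau> > 0"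
  shows "bump1 ((x + \<tau> *\<^sub>R l) $ k) ((x + \<tau> *\<^sub>R u) $ k) (scalef F x \<tau> k)"
  using bump1_affine[OF assms(1)[of k] assms(2), of "x $ k"] by (simp add: scalef_def[abs_def])

lemma shiftf_scalef: "shiftf (scalef F x \<tau>) v = scalef F (x + v) \<tau>"
  by (simp add: shiftf_def scalef_def fun_eq_iff algebra_simps)

lemma lborel_integral_affine:
  fixes f :: "'a::euclidean_space \<Rightarrow> 'b::{banach, second_countable_topology}"
  assumes [measurable]: "f \<in> borel_measurable borel" and "c \<noteq> 0"
  shows "(LINT x|lborel. f x) = (\<bar>c\<bar> ^ DIM('a)) *\<^sub>R (LINT x|lborel. f (t + c *\<^sub>R x))"
  by (subst lborel_affine[OF assms(2), of t])
    (simp add: integral_density integral_distr ennreal_power)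

text \<open>The substitution \<open>y = x + \<tau> w\<close> turns a mollified value into a pairing
  with a test function of product form, which is where weak derivatives can act.\<close>

lemma smear_eq:
  fixes f :: "real^'n \<Rightarrow> complex"
  assumes [measurable]: "f \<in> borel_measurable borel" and \<tau>: "\<tau> > 0"
  shows "smear l u \<tau> f x = (1 / \<tau> ^ CARD('n)) *\<^sub>R (LINT y|lborel. f y * cprodf (scalef (bumps l u) x \<tau>) y)"
proof -
  have [measurable]: "prodf (scalef (bumps l u) x \<tau>) \<in> borel_measurable borel"
    by (rule borel_measurable_prodf[OF bump1_scalef[OF bump1_bumps \<tau>]])
  have [measurable]: "cprodf (scalef (bumps l u) x \<tau>) \<in> borel_measurable borel"
    unfolding cprodf_def[abs_def] by measurable
  have "(LINT y|lborel. f y * cprodf (scalef (bumps l u) x \<tau>) y) = (\<tau> ^ CARD('n)) *\<^sub>R (LINT w|lborel. f (x + \<tau> *\<^sub>R w) * cprodf (scalef (bumps l u) x \<tau>) (x + \<tau> *\<^sub>R w))"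
    using lborel_integral_affine[of "\<lambda>y. f y * cprodf (scalef (bumps l u) x \<tau>) y" \<tau> x] \<tau> by simp
  also have "(LINT w|lborel. f (x + \<tau> *\<^sub>R w) * cprodf (scalef (bumps l u) x \<tau>) (x + \<tau> *\<^sub>R w)) = smear l u \<tau> f x"
    unfolding smear_def
    by (intro Bochner_Integration.integral_cong)
      (use \<tau> in \<open>auto simp: cprodf_def kern_def prodf_def scalef_def scaleR_conv_of_real[where 'a = complex] mult.commute\<close>)
  finally show ?thesis using \<tau> by simp
qed

section \<open>Weak derivatives tested on products, and derivatives along rays\<close>

definition unit_index :: "'n \<Rightarrow> 'n \<Rightarrow> nat" where
  "unit_index i k = (if k = i then 1 else 0)"

text \<open>Testing on products of one-dimensional functions suffices for the estimates, and there partial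
  derivatives commute trivially.\<close>

definition wder :: "(real^'n::finite) set \<Rightarrow> ('n \<Rightarrow> nat) \<Rightarrow> (real^'n \<Rightarrow> complex) \<Rightarrow> (real^'n \<Rightarrow> complex) \<Rightarrow> bool" where
  "wder \<Omega> \<alpha> U V \<longleftrightarrow> (\<forall>F l u. (\<forall>k. bump1 (l $ k) (u $ k) (F k)) \<and> cbox l u \<subseteq> \<Omega> \<longrightarrow>
     (LINT y|lborel. U y * cprodf (\<lambda>k. (deriv ^^ \<alpha> k) (F k)) y) = (-1) ^ sum \<alpha> UNIV * (LINT y|lborel. V y * cprodf F y))"

lemma gradf_eq_unit_index: "gradf F i = (\<lambda>k. (deriv ^^ unit_index i k) (F k))"
  by (auto simp: gradf_def unit_index_def fun_eq_iff)

lemma sum_unit_index: "sum (unit_index i) UNIV = (1 :: nat)"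
  for i :: "'n::finite"
  by (simp add: unit_index_def)

lemma wder_unit_index:
  assumes "wder \<Omega> (unit_index i) U V" "\<And>k. bump1 (l $ k) (u $ k) (F k)" "cbox l u \<subseteq> \<Omega>"
  shows "(LINT y|lborel. U y * cprodf (gradf F i) y) = - (LINT y|lborel. V y * cprodf F y)"
  using assms unfolding wder_def gradf_eq_unit_index sum_unit_index by fastforce

text \<open>The Sobolev space provides weak derivatives of \<open>U\<close> only; here the second
  derivative of \<open>U\<close> is recognised as a first derivative of \<open>V\<close>. As
  \<open>gradf F j\<close> is itself an admissible test function, both hypotheses evaluate the same
  pairing of \<open>U\<close>.\<close>

lemma wder_trans:
  assumes "wder \<Omega> (unit_index i) U V" "wder \<Omega> (\<lambda>k. unit_index i k + unit_index j k) U V'"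
  shows "wder \<Omega> (unit_index j) V V'"
  unfolding wder_def
proof (intro allI impI)
  fix F l u assume *: "(\<forall>k. bump1 (l $ k) (u $ k) (F k)) \<and> cbox l u \<subseteq> \<Omega>"
  have "(\<lambda>k. (deriv ^^ (unit_index i k + unit_index j k)) (F k)) = gradf (gradf F j) i"
    by (auto simp: gradf_def unit_index_def fun_eq_iff)
  moreover have "(LINT y|lborel. U y * cprodf (\<lambda>k. (deriv ^^ (unit_index i k + unit_index j k)) (F k)) y)
     = (-1) ^ (\<Sum>k\<in>UNIV. unit_index i k + unit_index j k) * (LINT y|lborel. V' y * cprodf F y)"
    using assms(2) * unfolding wder_def by blast
  ultimately have "(LINT y|lborel. U y * cprodf (gradf (gradf F j) i) y) = (LINT y|lborel. V' y * cprodf F y)"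
    by (simp add: sum.distrib sum_unit_index)
  moreover have "(LINT y|lborel. U y * cprodf (gradf (gradf F j) i) y) = - (LINT y|lborel. V y * cprodf (gradf F j) y)"
    by (rule wder_unit_index[OF assms(1) bump1_gradf]) (use * in auto)
  ultimately show "(LINT y|lborel. V y * cprodf (\<lambda>k. (deriv ^^ unit_index j k) (F k)) y) = (-1) ^ sum (unit_index j) UNIV * (LINT y|lborel. V' y * cprodf F y)"
    by (simp add: sum_unit_index minus_equation_iff flip: gradf_eq_unit_index)
qed

lemma smear_line_eq:
  fixes U :: "real^'n \<Rightarrow> complex"
  assumes "U \<in> borel_measurable borel" "\<tau> > 0"
  shows "smear l u \<tau> U (x + t *\<^sub>R w) = (1 / \<tau> ^ CARD('n)) *\<^sub>R (LINT y|lborel. U y * cprodf (scalef (bumps l u) x \<tau>) (y - t *\<^sub>R w))"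
  using assms by (simp add: smear_eq shiftf_scalef flip: cprodf_shiftf)

text \<open>Moving \<open>x\<close> along \<open>w\<close> moves the test function, so the
  derivative is a pairing of \<open>U\<close> with partial derivatives of the shifted test function.
  As the support stays in \<Omega>, the weak derivative takes over, and the two minus signs
  cancel.\<close>

lemma smear_line_has_derivative:
  fixes U :: "real^'n \<Rightarrow> complex"
  assumes U: "loc_int U" and V: "\<And>i. loc_int (V i)" "\<And>i. wder \<Omega> (unit_index i) U (V i)" and \<tau>: "\<tau> > 0"
    and \<Omega>: "\<And>y. y \<in> cbox l u \<Longrightarrow> x + t *\<^sub>R w + \<tau> *\<^sub>R y \<in> \<Omega>"
  shows "((\<lambda>t. smear l u \<tau> U (x + t *\<^sub>R w)) has_vector_derivative (\<Sum>i\<in>UNIV. complex_of_real (w $ i) * smear l u \<tau> (V i) (x + t *\<^sub>R w))) (at t)"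
proof -
  let ?F = "scalef (bumps l u) x \<tau>" and ?c = "1 / \<tau> ^ CARD('n)"
  have F: "bump1 ((x + \<tau> *\<^sub>R l) $ k) ((x + \<tau> *\<^sub>R u) $ k) (?F k)" for k
    by (rule bump1_scalef[OF bump1_bumps \<tau>])
  have sm: "\<And>k. smooth1 (?F k)" using F unfolding bump1_def by blast
  have [measurable]: "U \<in> borel_measurable borel" "\<And>i. V i \<in> borel_measurable borel"
    using U V by (auto simp: loc_int_def)
  have "cbox (x + \<tau> *\<^sub>R l + t *\<^sub>R w) (x + \<tau> *\<^sub>R u + t *\<^sub>R w) \<subseteq> \<Omega>"
  proof
    fix z assume z: "z \<in> cbox (x + \<tau> *\<^sub>R l + t *\<^sub>R w) (x + \<tau> *\<^sub>R u + t *\<^sub>R w)"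
    have "(z - x - t *\<^sub>R w) /\<^sub>R \<tau> \<in> cbox l u"
      using z \<tau> by (auto simp: mem_box_cart field_simps)
    from \<Omega>[OF this] show "z \<in> \<Omega>" using \<tau> by simp
  qed
  then have *: "(LINT y|lborel. U y * cprodf (gradf ?F i) (y - t *\<^sub>R w)) = - (LINT y|lborel. V i y * cprodf ?F (y - t *\<^sub>R w))" for i
    using wder_unit_index[OF V(2)[of i] bump1_shiftf[OF F], of "t *\<^sub>R w"]
    by (simp add: gradf_shiftf[OF sm] cprodf_shiftf)
  have "((\<lambda>t. ?c *\<^sub>R (LINT y|lborel. U y * cprodf ?F (y - t *\<^sub>R w))) has_vector_derivative
     ?c *\<^sub>R - (\<Sum>i\<in>UNIV. complex_of_real (w $ i) * (LINT y|lborel. U y * cprodf (gradf ?F i) (y - t *\<^sub>R w)))) (at t)"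
    by (intro bounded_linear.has_vector_derivative[OF bounded_linear_scaleR_right] pairing_has_derivative[OF U F])
  then have "((\<lambda>t. smear l u \<tau> U (x + t *\<^sub>R w)) has_vector_derivative
     ?c *\<^sub>R - (\<Sum>i\<in>UNIV. complex_of_real (w $ i) * (LINT y|lborel. U y * cprodf (gradf ?F i) (y - t *\<^sub>R w)))) (at t)"
    using \<tau> by (simp add: smear_line_eq)
  then show ?thesis
    by (rule has_vector_derivative_eq_rhs)
      (use \<tau> in \<open>simp add: * smear_line_eq sum_negf scaleR_sum_right scaleR_conv_of_real[where 'a = complex] mult_ac sum_distrib_left\<close>)
qed

lemma continuous_smear_line:
  fixes U :: "real^'n \<Rightarrow> complex"
  assumes U: "loc_int U" and \<tau>: "\<tau> > 0"
  shows "continuous_on S (\<lambda>t. smear l u \<tau> U (x + t *\<^sub>R w))"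
proof -
  have "U \<in> borel_measurable borel" using U by (simp add: loc_int_def)
  moreover have "continuous_on S (\<lambda>t. LINT y|lborel. U y * cprodf (scalef (bumps l u) x \<tau>) (y - t *\<^sub>R w))"
    using has_vector_derivative_continuous[OF pairing_has_derivative[OF U bump1_scalef[OF bump1_bumps \<tau>]]]
    by (intro continuous_at_imp_continuous_on) auto
  ultimately show ?thesis using \<tau> by (simp add: smear_line_eq continuous_on_scaleR)
qed

text \<open>A bound along each ray is integrated over \<open>w\<close> in \<open>W\<close>, and
  Tonelli's theorem turns the ray integrals into the potential. The directions carry Lebesgue
  measure on \<open>W\<close> rather than surface measure on a sphere, which avoids polar
  coordinates.\<close>

lemma integral_rays:
  fixes g f :: "'a::euclidean_space \<Rightarrow> ennreal"
  assumes [measurable]: "g \<in> borel_measurable borel" "f \<in> borel_measurable borel" "W \<in> sets borel"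
    and *: "\<And>w. w \<in> W \<Longrightarrow> a \<le> g (x + (1/2) *\<^sub>R w) + c * (\<integral>\<^sup>+t. indicator {0<..<1/2} t * (ennreal (t ^ m) * f (x + t *\<^sub>R w)) \<partial>lborel)"
  shows "emeasure lborel W * a \<le> avg W (1/2) g x + c * pot W {0<..<1/2} m f x"
proof -
  let ?T = "{0<..<1/2} :: real set"
  have "emeasure lborel W * a = (\<integral>\<^sup>+w. indicator W w * a \<partial>lborel)"
    by (subst nn_integral_multc) auto
  also have "\<dots> \<le> (\<integral>\<^sup>+w. indicator W w * g (x + (1/2) *\<^sub>R w) +
      c * (\<integral>\<^sup>+t. indicator W w * (indicator ?T t * (ennreal (t ^ m) * f (x + t *\<^sub>R w))) \<partial>lborel) \<partial>lborel)"
    by (intro nn_integral_mono) (use * in \<open>auto simp: indicator_def\<close>)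
  also have "\<dots> = avg W (1/2) g x + c * (\<integral>\<^sup>+w. \<integral>\<^sup>+t. indicator W w * (indicator ?T t * (ennreal (t ^ m) * f (x + t *\<^sub>R w))) \<partial>lborel \<partial>lborel)"
    unfolding avg_def by (subst nn_integral_add) (auto simp: nn_integral_cmult)
  also have "(\<integral>\<^sup>+w. \<integral>\<^sup>+t. indicator W w * (indicator ?T t * (ennreal (t ^ m) * f (x + t *\<^sub>R w))) \<partial>lborel \<partial>lborel)
     = (\<integral>\<^sup>+t. \<integral>\<^sup>+w. indicator W w * (indicator ?T t * (ennreal (t ^ m) * f (x + t *\<^sub>R w))) \<partial>lborel \<partial>lborel)"
    by (rule lborel_pair.Fubini') measurable
  also have "\<dots> = pot W ?T m f x"
    unfolding pot_def avg_def
  proof (rule nn_integral_cong)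
    fix t :: real
    have "indicator ?T t * (ennreal (t ^ m) * (\<integral>\<^sup>+w. indicator W w * f (x + t *\<^sub>R w) \<partial>lborel)) =
      (\<integral>\<^sup>+w. indicator ?T t * (ennreal (t ^ m) * (indicator W w * f (x + t *\<^sub>R w))) \<partial>lborel)"
      by (simp add: nn_integral_cmult)
    then show "(\<integral>\<^sup>+w. indicator W w * (indicator ?T t * (ennreal (t ^ m) * f (x + t *\<^sub>R w))) \<partial>lborel)
      = indicator ?T t * (ennreal (t ^ m) * (\<integral>\<^sup>+w. indicator W w * f (x + t *\<^sub>R w) \<partial>lborel))"
      by (simp add: ac_simps)
  qed
  finally show ?thesis .
qed

section \<open>Continuity of translations and convergence of smeared functions\<close>

lemma sets_borel_cball [measurable]: "cball (x :: 'a::metric_space) r \<in> sets borel"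
  by simp

lemma integrable_translate:
  fixes f :: "'a::euclidean_space \<Rightarrow> 'b::{banach, second_countable_topology}"
  assumes "integrable lborel f" shows "integrable lborel (\<lambda>x. f (x + h))"
proof -
  have "integrable (distr lborel borel ((+) h)) f" using assms by (simp add: lborel_distr_plus)
  then show ?thesis
    using assms by (subst (asm) integrable_distr_eq) (auto simp: add.commute)
qed

lemma integral_translate:
  fixes f :: "'a::euclidean_space \<Rightarrow> 'b::{banach, second_countable_topology}"
  assumes "f \<in> borel_measurable borel"
  shows "(LINT x|lborel. f (x + h)) = (LINT x|lborel. f x)"
  using lborel_integral_affine[OF assms, of 1 h] by (simp add: add.commute)

definition L1_cont :: "('a::euclidean_space \<Rightarrow> 'b::{banach, second_countable_topology}) \<Rightarrow> bool" where
  "L1_cont f \<longleftrightarrow> ((\<lambda>h. LINT x|lborel. norm (f (x + h) - f x)) \<longlongrightarrow> 0) (at 0)"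

lemma L1_cont_approx:
  fixes f :: "'a::euclidean_space \<Rightarrow> 'b::{banach, second_countable_topology}"
  assumes f: "integrable lborel f"
    and g: "\<And>e. e > 0 \<Longrightarrow> \<exists>g. integrable lborel g \<and> L1_cont g \<and> (LINT x|lborel. norm (f x - g x)) < e"
  shows "L1_cont f"
  unfolding L1_cont_def
proof (rule tendstoI)
  fix e :: real assume e: "e > 0"
  then obtain g where g: "integrable lborel g" "L1_cont g" "(LINT x|lborel. norm (f x - g x)) < e / 3"
    using g[of "e/3"] by auto
  have "eventually (\<lambda>h. dist (LINT x|lborel. norm (g (x + h) - g x)) 0 < e / 3) (at 0)"
    using g(2) e unfolding L1_cont_def by (intro tendstoD) auto
  then show "eventually (\<lambda>h. dist (LINT x|lborel. norm (f (x + h) - f x)) 0 < e) (at 0)"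
  proof eventually_elim
    case (elim h)
    note int = f g(1) integrable_translate[OF f, of h] integrable_translate[OF g(1), of h]
    have "(LINT x|lborel. norm (f (x + h) - f x)) \<le> (LINT x|lborel. norm (f (x + h) - g (x + h)) + norm (g (x + h) - g x) + norm (f x - g x))"
    proof (intro integral_mono)
      fix x
      have "f (x + h) - f x = (f (x + h) - g (x + h)) + (g (x + h) - g x) - (f x - g x)" by simp
      then show "norm (f (x + h) - f x) \<le> norm (f (x + h) - g (x + h)) + norm (g (x + h) - g x) + norm (f x - g x)"
        by (smt (verit) norm_triangle_ineq norm_triangle_ineq4)
    qed (use int in auto)
    also have "\<dots> = (LINT x|lborel. norm (f (x + h) - g (x + h))) + (LINT x|lborel. norm (g (x + h) - g x)) + (LINT x|lborel. norm (f x - g x))"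
      using int by simp
    also have "(LINT x|lborel. norm (f (x + h) - g (x + h))) = (LINT x|lborel. norm (f x - g x))"
    proof -
      have [measurable]: "f \<in> borel_measurable borel" "g \<in> borel_measurable borel" using f g(1) by auto
      show ?thesis by (rule integral_translate) measurable
    qed
    finally have "(LINT x|lborel. norm (f (x + h) - f x)) < e" using elim g(3) by simp
    then show ?case by simp
  qed
qed

lemma L1_cont_add:
  fixes f g :: "'a::euclidean_space \<Rightarrow> 'b::{banach, second_countable_topology}"
  assumes "integrable lborel f" "integrable lborel g" "L1_cont f" "L1_cont g"
  shows "L1_cont (\<lambda>x. f x + g x)"
  unfolding L1_cont_def
proof (rule Lim_null_comparison)
  show "((\<lambda>h. (LINT x|lborel. norm (f (x + h) - f x)) + (LINT x|lborel. norm (g (x + h) - g x))) \<longlongrightarrow> 0) (at 0)"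
    using assms(3,4) unfolding L1_cont_def by (intro tendsto_add_zero)
  have "(LINT x|lborel. norm (f (x + h) + g (x + h) - (f x + g x))) \<le> (LINT x|lborel. norm (f (x + h) - f x)) + (LINT x|lborel. norm (g (x + h) - g x))" for h
  proof -
    note int = assms(1,2) integrable_translate[OF assms(1), of h] integrable_translate[OF assms(2), of h]
    have "(LINT x|lborel. norm (f (x + h) + g (x + h) - (f x + g x))) \<le> (LINT x|lborel. norm (f (x + h) - f x) + norm (g (x + h) - g x))"
    proof (intro integral_mono)
      fix x show "norm (f (x + h) + g (x + h) - (f x + g x)) \<le> norm (f (x + h) - f x) + norm (g (x + h) - g x)"
        by (metis add_diff_add norm_triangle_ineq)
    qed (use int in auto)
    then show ?thesis using int by simp
  qed
  then show "eventually (\<lambda>h. norm (LINT x|lborel. norm (f (x + h) + g (x + h) - (f x + g x))) \<le> (LINT x|lborel. norm (f (x + h) - f x)) + (LINT x|lborel. norm (g (x + h) - g x))) (at 0)"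
    by simp
qed

text \<open>Up to \<open>norm c\<close>, the distance between an indicator and its translate is
  twice the measure of \<open>S\<close> minus twice the overlap. A point of an open set remains in
  it after every small translation, so dominated convergence applies to the overlap.\<close>

lemma L1_cont_indicator_open:
  fixes S :: "'a::euclidean_space set" and c :: "'b::{banach, second_countable_topology}"
  assumes S: "open S" "emeasure lborel S < \<infinity>"
  shows "L1_cont (\<lambda>x. indicator S x *\<^sub>R c)"
proof -
  let ?i = "\<lambda>x. indicator S x :: real"
  have [measurable]: "S \<in> sets borel" using S by simp
  have int: "integrable lborel ?i" using S by (simp add: integrable_indicator_iff)
  have int2: "integrable lborel (\<lambda>x. ?i x * ?i (x + h))" for h
  proof (rule Bochner_Integration.integrable_bound[OF int])
    show "AE x in lborel. norm (?i x * ?i (x + h)) \<le> norm (?i x)" by (auto simp: indicator_def)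
  qed measurable
  have eq: "(LINT x|lborel. norm (?i (x + h) *\<^sub>R c - ?i x *\<^sub>R c)) = norm c * (2 * (LINT x|lborel. ?i x) - 2 * (LINT x|lborel. ?i x * ?i (x + h)))" for h
  proof -
    have "(LINT x|lborel. norm (?i (x + h) *\<^sub>R c - ?i x *\<^sub>R c)) = (LINT x|lborel. norm c * (?i (x + h) + ?i x - 2 * (?i x * ?i (x + h))))"
      by (intro Bochner_Integration.integral_cong) (auto simp: indicator_def)
    also have "\<dots> = norm c * ((LINT x|lborel. ?i (x + h)) + (LINT x|lborel. ?i x) - 2 * (LINT x|lborel. ?i x * ?i (x + h)))"
      using int int2[of h] integrable_translate[OF int, of h] by simp
    also have "(LINT x|lborel. ?i (x + h)) = (LINT x|lborel. ?i x)" by (rule integral_translate) measurable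
    finally show ?thesis by simp
  qed
  have lim: "((\<lambda>h. LINT x|lborel. ?i x * ?i (x + h)) \<longlongrightarrow> (LINT x|lborel. ?i x)) (at 0)"
  proof (subst tendsto_at_iff_sequentially, intro allI impI)
    fix X :: "nat \<Rightarrow> 'a" assume X: "\<forall>i. X i \<in> UNIV - {0}" "X \<longlonglongrightarrow> 0"
    show "((\<lambda>h. LINT x|lborel. ?i x * ?i (x + h)) \<circ> X) \<longlonglongrightarrow> (LINT x|lborel. ?i x)"
      unfolding comp_def
    proof (rule integral_dominated_convergence[OF _ _ int])
      show "AE x in lborel. (\<lambda>i. ?i x * ?i (x + X i)) \<longlonglongrightarrow> ?i x"
      proof (rule AE_I2)
        fix x
        show "(\<lambda>i. ?i x * ?i (x + X i)) \<longlonglongrightarrow> ?i x"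
        proof (cases "x \<in> S")
          case True
          have "(\<lambda>i. x + X i) \<longlonglongrightarrow> x + 0" by (intro tendsto_intros X(2))
          then have "eventually (\<lambda>i. x + X i \<in> S) sequentially"
            using topological_tendstoD[OF _ S(1)] True by fastforce
          then show ?thesis
            by (intro tendsto_eventually) (use True in \<open>auto elim: eventually_mono\<close>)
        qed simp
      qed
      show "AE x in lborel. norm (?i x * ?i (x + X i)) \<le> ?i x" for i by (auto simp: indicator_def)
    qed measurable
  qed
  have "((\<lambda>h. norm c * (2 * (LINT x|lborel. ?i x) - 2 * (LINT x|lborel. ?i x * ?i (x + h)))) \<longlongrightarrow> norm c * (2 * (LINT x|lborel. ?i x) - 2 * (LINT x|lborel. ?i x))) (at 0)"
    by (intro tendsto_intros lim)
  then show ?thesis unfolding L1_cont_def eq by simp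
qed

text \<open>Outer regularity reduces indicators to those of open sets, and
  \<open>integrable_induct\<close> passes to integrable functions, since the property survives sums
  and approximation in the mean.\<close>

lemma L1_cont_integrable:
  fixes f :: "'a::euclidean_space \<Rightarrow> 'b::{banach, second_countable_topology}"
  assumes "integrable lborel f" shows "L1_cont f"
  using assms
proof (induction rule: integrable_induct)
  case (base A c)
  then have [measurable]: "A \<in> sets borel" and A: "emeasure lborel A < \<infinity>" by auto
  show ?case
  proof (rule L1_cont_approx)
    show "integrable lborel (\<lambda>x. indicat_real A x *\<^sub>R c)" using A by (simp add: integrable_indicator_iff)
    fix e :: real assume e: "e > 0"
    define e' where "e' = e / (norm c + 1)"
    have e': "e' > 0" using e by (simp add: e'_def add_nonneg_pos)
    obtain S where S: "open S" "A \<subseteq> S" "emeasure lborel (S - A) < e'"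
      using outer_regular_lborel[of A e'] e' by auto
    have [measurable]: "S \<in> sets borel" using S by simp
    have fin: "emeasure lborel (S - A) < \<infinity>" using order.strict_trans[OF S(3) ennreal_less_top] by simp
    have "emeasure lborel S \<le> emeasure lborel A + emeasure lborel (S - A)"
      using emeasure_subadditive[of A lborel "S - A"] S(2) by (simp add: Un_absorb1)
    then have Sfin: "emeasure lborel S < \<infinity>" using A fin
      by (metis ennreal_add_less_top infinity_ennreal_def order_le_less_trans)
    have "(LINT x|lborel. norm (indicat_real A x *\<^sub>R c - indicat_real S x *\<^sub>R c)) = (LINT x|lborel. norm c * indicator (S - A) x)"
      using S(2) by (intro Bochner_Integration.integral_cong) (auto simp: indicator_def)
    also have "\<dots> = norm c * measure lborel (S - A)" by simp
    also have "\<dots> \<le> norm c * e'"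
    proof (intro mult_left_mono)
      have "ennreal (measure lborel (S - A)) < ennreal e'" using S(3) fin by (subst emeasure_eq_ennreal_measure[symmetric]) auto
      then show "measure lborel (S - A) \<le> e'" using e' by (simp add: ennreal_less_iff)
    qed simp
    also have "\<dots> < e"
    proof -
      have "norm c + 1 > 0" by (simp add: add_nonneg_pos)
      then have "e' * (norm c + 1) = e" by (simp add: e'_def)
      then show ?thesis using e' by (simp add: algebra_simps)
    qed
    finally show "\<exists>g. integrable lborel g \<and> L1_cont g \<and> (LINT x|lborel. norm (indicat_real A x *\<^sub>R c - g x)) < e"
      using L1_cont_indicator_open[OF S(1) Sfin] Sfin
      by (intro exI[of _ "\<lambda>x. indicat_real S x *\<^sub>R c"]) (auto simp: integrable_indicator_iff)
  qed
next
  case (add f g)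
  then show ?case by (intro L1_cont_add)
next
  case (lim f s)
  have "(\<lambda>i. LINT x|lborel. norm (f x - s i x)) \<longlonglongrightarrow> (LINT x|lborel. norm (f x - f x))"
  proof (rule integral_dominated_convergence[where w = "\<lambda>x. 3 * norm (f x)"])
    show "AE x in lborel. (\<lambda>i. norm (f x - s i x)) \<longlonglongrightarrow> norm (f x - f x)"
      using lim by (intro AE_I2 tendsto_intros) auto
    show "AE x in lborel. norm (norm (f x - s i x)) \<le> 3 * norm (f x)" for i
    proof (rule AE_I2)
      fix x have "norm (s i x) \<le> 2 * norm (f x)" using lim(3) by auto
      then show "norm (norm (f x - s i x)) \<le> 3 * norm (f x)" using norm_triangle_ineq4[of "f x" "s i x"] by simp
    qed
  qed (use lim in auto)
  then have "(\<lambda>i. LINT x|lborel. norm (f x - s i x)) \<longlonglongrightarrow> 0" by simp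
  then have "eventually (\<lambda>i. (LINT x|lborel. norm (f x - s i x)) < e) sequentially" if "e > 0" for e
    using order_tendstoD(2) that by blast
  then have "\<exists>i. (LINT x|lborel. norm (f x - s i x)) < e" if "e > 0" for e
    using that by (force simp: eventually_sequentially)
  then show ?case using lim by (intro L1_cont_approx) blast+
qed

section \<open>Convergence of the mollification in the mean and almost everywhere\<close>

text \<open>The distance in the mean is at most the integral of the kernel at \<open>w\<close> times
  the distance between \<open>f\<close> and its translate by \<open>\<tau> w\<close>. The kernel has
  bounded support, so all these translations become small together.\<close>

lemma smear_tendsto_L1:
  fixes f :: "real^'n \<Rightarrow> complex"
  assumes f: "integrable lborel f"
  shows "((\<lambda>\<tau>. LINT x|lborel. norm (smear l u \<tau> f x - (LINT w|lborel. kern l u w) *\<^sub>R f x)) \<longlongrightarrow> 0) (at_right 0)"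
    "\<And>\<tau>. integrable lborel (\<lambda>x. smear l u \<tau> f x - (LINT w|lborel. kern l u w) *\<^sub>R f x)"
proof -
  have [measurable]: "f \<in> borel_measurable borel" using f by auto
  define \<phi> where "\<phi> h = (LINT x|lborel. norm (f (x + h) - f x))" for h
  define \<kappa> where "\<kappa> = (LINT w|lborel. kern l u w)"
  have \<kappa>: "\<kappa> \<ge> 0" unfolding \<kappa>_def by (simp add: kern_nonneg)
  have \<kappa>nn: "(\<integral>\<^sup>+w. ennreal (kern l u w) \<partial>lborel) = ennreal \<kappa>"
    unfolding \<kappa>_def by (intro nn_integral_eq_integral integrable_kern) (simp add: kern_nonneg)
  have \<phi>: "(\<integral>\<^sup>+x. ennreal (norm (f (x + h) - f x)) \<partial>lborel) = ennreal (\<phi> h)" for h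
    unfolding \<phi>_def using f integrable_translate[OF f, of h] by (intro nn_integral_eq_integral) auto
  have bound: "ennreal (norm (smear l u \<tau> f x - \<kappa> *\<^sub>R f x)) \<le> (\<integral>\<^sup>+w. ennreal (kern l u w) * ennreal (norm (f (x + \<tau> *\<^sub>R w) - f x)) \<partial>lborel)"
    if "integrable lborel (\<lambda>w. kern l u w *\<^sub>R f (x + \<tau> *\<^sub>R w))" for x \<tau>
  proof -
    have "smear l u \<tau> f x - \<kappa> *\<^sub>R f x = (LINT w|lborel. kern l u w *\<^sub>R f (x + \<tau> *\<^sub>R w) - kern l u w *\<^sub>R f x)"
      unfolding smear_def \<kappa>_def using that integrable_kern[of l u] by simp
    then have "ennreal (norm (smear l u \<tau> f x - \<kappa> *\<^sub>R f x)) \<le> (\<integral>\<^sup>+w. ennreal (norm (kern l u w *\<^sub>R f (x + \<tau> *\<^sub>R w) - kern l u w *\<^sub>R f x)) \<partial>lborel)"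
      using that integrable_kern[of l u] integral_norm_bound_ennreal[of lborel "\<lambda>w. kern l u w *\<^sub>R f (x + \<tau> *\<^sub>R w) - kern l u w *\<^sub>R f x"]
      by simp
    also have "\<dots> = (\<integral>\<^sup>+w. ennreal (kern l u w) * ennreal (norm (f (x + \<tau> *\<^sub>R w) - f x)) \<partial>lborel)"
      by (intro nn_integral_cong) (simp add: kern_nonneg flip: ennreal_mult scaleR_diff_right)
    finally show ?thesis .
  qed
  have kint: "integrable lborel (\<lambda>w. kern l u w *\<^sub>R f (x + \<tau> *\<^sub>R w))" if "\<tau> \<noteq> 0" for x \<tau>
  proof (rule Bochner_Integration.integrable_bound)
    have "integrable lborel (\<lambda>w. f (x + \<tau> *\<^sub>R w))"
    proof -
      have "integrable (density (distr lborel borel (\<lambda>w. x + \<tau> *\<^sub>R w)) (\<lambda>_. ennreal (\<bar>\<tau>\<bar> ^ CARD('n)))) f"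
        using f lborel_affine[OF that, of x] by (simp add: ennreal_power)
      then have "integrable lborel (\<lambda>w. \<bar>\<tau>\<bar> ^ CARD('n) *\<^sub>R f (x + \<tau> *\<^sub>R w))"
        by (simp add: integrable_density integrable_distr_eq)
      then have "integrable lborel (\<lambda>w. inverse (\<bar>\<tau>\<bar> ^ CARD('n)) *\<^sub>R (\<bar>\<tau>\<bar> ^ CARD('n) *\<^sub>R f (x + \<tau> *\<^sub>R w)))"
        by (rule integrable_scaleR_right)
      then show ?thesis using that by simp
    qed
    then show "integrable lborel (\<lambda>w. norm (f (x + \<tau> *\<^sub>R w)))" by (rule integrable_norm)
    show "AE w in lborel. norm (kern l u w *\<^sub>R f (x + \<tau> *\<^sub>R w)) \<le> norm (norm (f (x + \<tau> *\<^sub>R w)))"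
      using kern_le_1[of l u] kern_nonneg[of l u] by (intro AE_I2) (simp add: mult_left_le_one_le)
  qed measurable
  have main: "(\<integral>\<^sup>+x. ennreal (norm (smear l u \<tau> f x - \<kappa> *\<^sub>R f x)) \<partial>lborel) \<le> (\<integral>\<^sup>+w. ennreal (kern l u w) * ennreal (\<phi> (\<tau> *\<^sub>R w)) \<partial>lborel)" if "\<tau> \<noteq> 0" for \<tau>
  proof -
    have "(\<integral>\<^sup>+x. ennreal (norm (smear l u \<tau> f x - \<kappa> *\<^sub>R f x)) \<partial>lborel) \<le> (\<integral>\<^sup>+x. \<integral>\<^sup>+w. ennreal (kern l u w) * ennreal (norm (f (x + \<tau> *\<^sub>R w) - f x)) \<partial>lborel \<partial>lborel)"
      by (intro nn_integral_mono bound kint that)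
    also have "\<dots> = (\<integral>\<^sup>+w. \<integral>\<^sup>+x. ennreal (kern l u w) * ennreal (norm (f (x + \<tau> *\<^sub>R w) - f x)) \<partial>lborel \<partial>lborel)"
      by (rule lborel_pair.Fubini') measurable
    also have "\<dots> = (\<integral>\<^sup>+w. ennreal (kern l u w) * ennreal (\<phi> (\<tau> *\<^sub>R w)) \<partial>lborel)"
      by (simp add: nn_integral_cmult \<phi>)
    finally show ?thesis .
  qed
  have \<phi>2: "\<phi> h \<le> 2 * (LINT x|lborel. norm (f x))" for h
  proof -
    have "\<phi> h \<le> (LINT x|lborel. norm (f (x + h)) + norm (f x))"
      unfolding \<phi>_def using f integrable_translate[OF f, of h] by (intro integral_mono) (auto intro: norm_triangle_ineq4)
    also have "\<dots> = 2 * (LINT x|lborel. norm (f x))"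
      using f integrable_translate[OF f, of h] integral_translate[of "\<lambda>x. norm (f x)" h] by simp
    finally show ?thesis .
  qed
  have int: "integrable lborel (\<lambda>x. smear l u \<tau> f x - \<kappa> *\<^sub>R f x)" for \<tau>
  proof (cases "\<tau> = 0")
    case True
    then show ?thesis by (simp add: smear_def \<kappa>_def integrable_kern)
  next
    case False
    have "(\<integral>\<^sup>+x. ennreal (norm (smear l u \<tau> f x - \<kappa> *\<^sub>R f x)) \<partial>lborel) \<le> (\<integral>\<^sup>+w. ennreal (kern l u w) * ennreal (2 * (LINT x|lborel. norm (f x))) \<partial>lborel)"
      by (intro order_trans[OF main[OF False]] nn_integral_mono mult_left_mono ennreal_leI \<phi>2) auto
    also have "\<dots> < \<infinity>" by (simp add: nn_integral_multc \<kappa>nn ennreal_mult_less_top)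
    finally show ?thesis by (simp add: integrable_iff_bounded)
  qed
  then show "\<And>\<tau>. integrable lborel (\<lambda>x. smear l u \<tau> f x - (LINT w|lborel. kern l u w) *\<^sub>R f x)"
    by (simp add: \<kappa>_def)
  have "((\<lambda>\<tau>. LINT x|lborel. norm (smear l u \<tau> f x - \<kappa> *\<^sub>R f x)) \<longlongrightarrow> 0) (at_right 0)"
  proof (rule tendstoI)
    fix e :: real assume e: "e > 0"
    define e' where "e' = e / (\<kappa> + 1)"
    have e': "e' > 0" using e \<kappa> by (simp add: e'_def)
    have "eventually (\<lambda>h. dist (\<phi> h) 0 < e') (at 0)"
      using L1_cont_integrable[OF f] e' unfolding L1_cont_def \<phi>_def[symmetric] by (rule tendstoD)
    then obtain r where r: "r > 0" "\<And>h. h \<noteq> 0 \<Longrightarrow> norm h < r \<Longrightarrow> dist (\<phi> h) 0 < e'"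
      by (auto simp: eventually_at)
    have \<phi>e: "\<phi> h \<le> e'" if "norm h < r" for h
      using r(2)[of h] that e' by (cases "h = 0") (auto simp: \<phi>_def)
    obtain R where R: "R > 0" "\<And>w. w \<in> cbox l u \<Longrightarrow> norm w \<le> R"
      using bounded_cbox[of l u] unfolding bounded_pos by blast
    have "eventually (\<lambda>\<tau>::real. 0 < \<tau>) (at_right 0)" "eventually (\<lambda>\<tau>. \<tau> < r / R) (at_right 0)"
      using r R by (auto simp: eventually_at_right_less intro!: eventually_at_right_real order_tendstoD(2)[of _ 0] tendsto_intros)
    then show "eventually (\<lambda>\<tau>. dist (LINT x|lborel. norm (smear l u \<tau> f x - \<kappa> *\<^sub>R f x)) 0 < e) (at_right 0)"
    proof eventually_elim
      case (elim \<tau>)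
      have "ennreal (LINT x|lborel. norm (smear l u \<tau> f x - \<kappa> *\<^sub>R f x)) = (\<integral>\<^sup>+x. ennreal (norm (smear l u \<tau> f x - \<kappa> *\<^sub>R f x)) \<partial>lborel)"
        by (intro nn_integral_eq_integral[symmetric] integrable_norm int) auto
      also have "\<dots> \<le> (\<integral>\<^sup>+w. ennreal (kern l u w) * ennreal (\<phi> (\<tau> *\<^sub>R w)) \<partial>lborel)"
        using main elim by auto
      also have "\<dots> \<le> (\<integral>\<^sup>+w. ennreal (kern l u w) * ennreal e' \<partial>lborel)"
      proof (rule nn_integral_mono)
        fix w
        show "ennreal (kern l u w) * ennreal (\<phi> (\<tau> *\<^sub>R w)) \<le> ennreal (kern l u w) * ennreal e'"
        proof (cases "w \<in> cbox l u")
          case True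
          have "norm (\<tau> *\<^sub>R w) \<le> \<tau> * R" using R(2)[OF True] elim by simp
          also have "\<dots> < r" using elim R by (simp add: field_simps)
          finally show ?thesis by (intro mult_left_mono ennreal_leI \<phi>e) auto
        qed (simp add: kern_eq_0)
      qed
      also have "\<dots> = ennreal (\<kappa> * e')" using \<kappa> e' by (simp add: nn_integral_multc \<kappa>nn flip: ennreal_mult)
      finally have "(LINT x|lborel. norm (smear l u \<tau> f x - \<kappa> *\<^sub>R f x)) \<le> \<kappa> * e'"
        using \<kappa> e' by (simp add: ennreal_le_iff)
      also have "\<dots> < e" using e \<kappa> by (simp add: e'_def field_simps)
      finally show ?case by simp
    qed
  qed
  then show "((\<lambda>\<tau>. LINT x|lborel. norm (smear l u \<tau> f x - (LINT w|lborel. kern l u w) *\<^sub>R f x)) \<longlongrightarrow> 0) (at_right 0)"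
    by (simp add: \<kappa>_def)
qed

text \<open>Convergence in the mean yields almost everywhere convergence along a subsequence of
  scales, which is all that Fatou's lemma requires.\<close>

lemma smear_tendsto_AE:
  fixes f :: "real^'n \<Rightarrow> complex"
  assumes f: "integrable lborel f" and \<tau>0: "\<tau>0 > 0"
  obtains \<tau> :: "nat \<Rightarrow> real" where "\<And>i. 0 < \<tau> i" "\<And>i. \<tau> i \<le> \<tau>0"
    "AE x in lborel. (\<lambda>i. smear l u (\<tau> i) f x) \<longlonglongrightarrow> (LINT w|lborel. kern l u w) *\<^sub>R f x"
proof -
  define s where "s i = \<tau>0 / real (Suc i)" for i
  have s: "s i > 0" "s i \<le> \<tau>0" for i using \<tau>0 by (auto simp: s_def divide_simps)
  have "s \<longlonglongrightarrow> 0" unfolding s_def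
    using tendsto_mult[OF tendsto_const[of \<tau>0] LIMSEQ_inverse_real_of_nat] by (simp add: divide_inverse)
  then have "filterlim s (at_right 0) sequentially"
    using s(1) by (auto simp: filterlim_at less_imp_neq[OF s(1), symmetric])
  from filterlim_compose[OF smear_tendsto_L1(1)[OF f, of l u] this]
  obtain r where r: "strict_mono r" "AE x in lborel. (\<lambda>i. smear l u (s (r i)) f x - (LINT w|lborel. kern l u w) *\<^sub>R f x) \<longlonglongrightarrow> 0"
    using tendsto_L1_AE_subseq[of lborel "\<lambda>i x. smear l u (s i) f x - (LINT w|lborel. kern l u w) *\<^sub>R f x",
        OF smear_tendsto_L1(2)[OF f]] by blast
  show ?thesis
  proof (rule that)
    show "0 < s (r i)" "s (r i) \<le> \<tau>0" for i by (rule s)+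
    show "AE x in lborel. (\<lambda>i. smear l u (s (r i)) f x) \<longlonglongrightarrow> (LINT w|lborel. kern l u w) *\<^sub>R f x"
      using r(2) by (simp only: LIM_zero_iff)
  qed
qed

lemma smear_cong:
  assumes "\<And>w. w \<in> cbox l u \<Longrightarrow> f (x + \<tau> *\<^sub>R w) = g (x + \<tau> *\<^sub>R w)"
  shows "smear l u \<tau> f x = smear l u \<tau> g x"
  unfolding smear_def
proof (intro Bochner_Integration.integral_cong refl)
  fix w show "kern l u w *\<^sub>R f (x + \<tau> *\<^sub>R w) = kern l u w *\<^sub>R g (x + \<tau> *\<^sub>R w)"
    using assms kern_eq_0[of w l u] by (cases "w \<in> cbox l u") auto
qed

text \<open>Fatou's lemma along a sequence of scales. Almost everywhere convergence is available for
  integrable functions, so \<open>U\<close> is cut off to a ball exceeding the one considered by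
  \<open>\<tau>0 * R\<close>, the reach of the kernel; monotone convergence then exhausts the
  space.\<close>

lemma nn_integral_le_smear:
  fixes U :: "real^'n \<Rightarrow> complex"
  assumes U: "loc_int U" and [measurable]: "H \<in> borel_measurable borel" and p: "p > 0" and \<tau>0: "\<tau>0 > 0"
    and B: "\<And>\<tau>. 0 < \<tau> \<Longrightarrow> \<tau> \<le> \<tau>0 \<Longrightarrow> (\<integral>\<^sup>+x. H x * ennreal (norm (smear l u \<tau> U x) powr p) \<partial>lborel) \<le> B"
  shows "(\<integral>\<^sup>+x. H x * ennreal (norm ((LINT w|lborel. kern l u w) *\<^sub>R U x) powr p) \<partial>lborel) \<le> B"
proof -
  have [measurable]: "U \<in> borel_measurable borel" using U by (simp add: loc_int_def)
  define \<kappa> where "\<kappa> = (LINT w|lborel. kern l u w)"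
  obtain R where R: "R > 0" "\<And>w. w \<in> cbox l u \<Longrightarrow> norm w \<le> R"
    using bounded_cbox[of l u] unfolding bounded_pos by blast
  have local: "(\<integral>\<^sup>+x. indicator (cball 0 (real m)) x * (H x * ennreal (norm (\<kappa> *\<^sub>R U x) powr p)) \<partial>lborel) \<le> B" for m :: nat
  proof -
    let ?M = "cball 0 (real m) :: (real^'n) set"
    define f where "f x = indicator (cball 0 (m + \<tau>0 * R)) x *\<^sub>R U x" for x
    have f: "integrable lborel f" unfolding f_def using U by (simp add: loc_int_def)
    obtain \<tau> where \<tau>: "\<And>i. 0 < \<tau> i" "\<And>i. \<tau> i \<le> \<tau>0" "AE x in lborel. (\<lambda>i. smear l u (\<tau> i) f x) \<longlonglongrightarrow> \<kappa> *\<^sub>R f x"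
      by (rule smear_tendsto_AE[OF f \<tau>0, of l u]) (unfold \<kappa>_def, blast)
    have eq: "smear l u (\<tau> i) f x = smear l u (\<tau> i) U x" if "x \<in> ?M" for i x
    proof (rule smear_cong)
      fix w assume "w \<in> cbox l u"
      then have "norm (\<tau> i *\<^sub>R w) \<le> \<tau>0 * R" using R \<tau>(1)[of i] \<tau>(2)[of i] by (auto intro!: mult_mono)
      then have "norm (x + \<tau> i *\<^sub>R w) \<le> m + \<tau>0 * R" using that norm_triangle_ineq[of x "\<tau> i *\<^sub>R w"] by simp
      then show "f (x + \<tau> i *\<^sub>R w) = U (x + \<tau> i *\<^sub>R w)" by (simp add: f_def)
    qed
    have fU: "f x = U x" if "x \<in> ?M" for x
      using that R \<tau>0 by (simp add: f_def add_increasing2)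
    have "(\<integral>\<^sup>+x. indicator ?M x * (H x * ennreal (norm (\<kappa> *\<^sub>R U x) powr p)) \<partial>lborel) \<le>
      (\<integral>\<^sup>+x. liminf (\<lambda>i. indicator ?M x * (H x * ennreal (norm (smear l u (\<tau> i) U x) powr p))) \<partial>lborel)"
    proof (rule nn_integral_mono_AE)
      show "AE x in lborel. indicator ?M x * (H x * ennreal (norm (\<kappa> *\<^sub>R U x) powr p)) \<le> liminf (\<lambda>i. indicator ?M x * (H x * ennreal (norm (smear l u (\<tau> i) U x) powr p)))"
        using \<tau>(3)
      proof eventually_elim
        case (elim x)
        show ?case
        proof (cases "x \<in> ?M")
          case True
          then have lim: "(\<lambda>i. norm (smear l u (\<tau> i) U x)) \<longlonglongrightarrow> norm (\<kappa> *\<^sub>R U x)"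
            using tendsto_norm[OF elim] by (simp add: eq fU)
          have "(\<lambda>i. norm (smear l u (\<tau> i) U x) powr p) \<longlonglongrightarrow> norm (\<kappa> *\<^sub>R U x) powr p"
            using p by (intro tendsto_powr' lim tendsto_const) auto
          then have "(\<lambda>i. ennreal (norm (smear l u (\<tau> i) U x) powr p)) \<longlonglongrightarrow> ennreal (norm (\<kappa> *\<^sub>R U x) powr p)"
            by (rule tendsto_ennrealI)
          then have l: "ennreal (norm (\<kappa> *\<^sub>R U x) powr p) = liminf (\<lambda>i. ennreal (norm (smear l u (\<tau> i) U x) powr p))"
            by (rule lim_imp_Liminf[OF sequentially_bot, symmetric])
          show ?thesis
          \<comment> \<open>The weight \<open>H x\<close> may be infinite, where multiplication is
            not continuous. It still commutes with suprema, hence the detour through the supremum of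
            infima.\<close>
          proof (rule le_Liminf_iff[THEN iffD2], intro allI impI)
            fix y assume y: "y < indicator ?M x * (H x * ennreal (norm (\<kappa> *\<^sub>R U x) powr p))"
            have "(H x) * ennreal (norm (\<kappa> *\<^sub>R U x) powr p) = (SUP n. H x * (INF i\<in>{n..}. ennreal (norm (smear l u (\<tau> i) U x) powr p)))"
              unfolding l liminf_SUP_INF by (rule SUP_mult_left_ennreal)
            then obtain n where "y < H x * (INF i\<in>{n..}. ennreal (norm (smear l u (\<tau> i) U x) powr p))"
              using y True by (auto simp: less_SUP_iff)
            then have "y < H x * ennreal (norm (smear l u (\<tau> i) U x) powr p)" if "i \<ge> n" for i
              by (rule less_le_trans) (intro mult_left_mono INF_lower, use that in auto)
            then show "eventually (\<lambda>i. y < indicator ?M x * (H x * ennreal (norm (smear l u (\<tau> i) U x) powr p))) sequentially"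
              using True by (auto simp: eventually_sequentially)
          qed
        qed simp
      qed
    qed
    also have "\<dots> \<le> liminf (\<lambda>i. \<integral>\<^sup>+x. indicator ?M x * (H x * ennreal (norm (smear l u (\<tau> i) U x) powr p)) \<partial>lborel)"
      by (rule nn_integral_liminf) measurable
    also have "\<dots> \<le> liminf (\<lambda>i. B)"
    proof (intro Liminf_mono always_eventually allI)
      fix i
      have "(\<integral>\<^sup>+x. indicator ?M x * (H x * ennreal (norm (smear l u (\<tau> i) U x) powr p)) \<partial>lborel) \<le> (\<integral>\<^sup>+x. H x * ennreal (norm (smear l u (\<tau> i) U x) powr p) \<partial>lborel)"
        by (intro nn_integral_mono) (auto simp: indicator_def)
      also have "\<dots> \<le> B" by (rule B[OF \<tau>(1,2)])
      finally show "(\<integral>\<^sup>+x. indicator ?M x * (H x * ennreal (norm (smear l u (\<tau> i) U x) powr p)) \<partial>lborel) \<le> B" .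
    qed
    also have "\<dots> = B" by (simp add: Liminf_const)
    finally show ?thesis .
  qed
  have "(\<integral>\<^sup>+x. H x * ennreal (norm (\<kappa> *\<^sub>R U x) powr p) \<partial>lborel) = (\<integral>\<^sup>+x. (SUP m. indicator (cball 0 (real m)) x * (H x * ennreal (norm (\<kappa> *\<^sub>R U x) powr p))) \<partial>lborel)"
  proof (rule nn_integral_cong, rule antisym)
    fix x :: "real^'n"
    obtain m :: nat where "norm x \<le> m" using real_arch_simple by blast
    then show "H x * ennreal (norm (\<kappa> *\<^sub>R U x) powr p) \<le> (SUP m. indicator (cball 0 (real m)) x * (H x * ennreal (norm (\<kappa> *\<^sub>R U x) powr p)))"
      by (intro SUP_upper2[of m]) auto
  qed (auto intro!: SUP_least simp: indicator_def)
  also have "\<dots> = (SUP m. \<integral>\<^sup>+x. indicator (cball 0 (real m)) x * (H x * ennreal (norm (\<kappa> *\<^sub>R U x) powr p)) \<partial>lborel)"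
    by (rule nn_integral_monotone_convergence_SUP) (auto simp: incseq_def le_fun_def indicator_def)
  also have "\<dots> \<le> B" by (intro SUP_least local)
  finally show ?thesis by (simp add: \<kappa>_def)
qed

section \<open>Estimates on the points carrying a fixed cone\<close>

text \<open>The cone is spanned by a ball \<open>W\<close> around \<open>c\<close> with radius
  \<open>a\<close> instead of a spherical cap. The conditions keep \<open>W\<close> at distance
  \<open>norm c - a\<close> from the vertex and inside the ball of radius \<open>d\<close>, the
  largest radius in the Morrey norm.\<close>

locale finite_cone =
  fixes c :: "real^'n::finite" and a d :: real and \<Omega> :: "(real^'n) set"
  assumes a: "0 < a" "a < norm c" "norm c + a < d" and open_\<Omega>: "open \<Omega>"
begin

definition "W = cball c a"
text \<open>A cube inscribed in \<open>W\<close>: with half side \<open>a\<close> divided by the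
  dimension, the coordinate differences to \<open>c\<close> sum up to at most \<open>a\<close> in
  absolute value, which bounds the Euclidean distance.\<close>

definition "lo = c - (\<chi> k. a / real CARD('n))"
definition "up = c + (\<chi> k. a / real CARD('n))"
definition "\<omega> = measure lborel W"
definition "\<kappa> = (LINT w|lborel. kern lo up w)"
definition "D = {x. \<forall>t\<in>{0..1}. \<forall>w\<in>W. x + t *\<^sub>R w \<in> \<Omega>}"

abbreviation "sm \<equiv> smear lo up"
abbreviation "TT \<equiv> {0<..<1/2::real}"

lemma d: "d > 0" using a norm_ge_zero[of c] by linarith

lemma W_borel [measurable]: "W \<in> sets borel" by (simp add: W_def)

lemma W_ball: "W \<subseteq> ball 0 d"
proof
  fix w assume "w \<in> W"
  then have "norm (w - c) \<le> a" by (simp add: W_def dist_norm norm_minus_commute)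
  then show "w \<in> ball 0 d" using a norm_triangle_ineq[of c "w - c"] by simp
qed

lemma W_disjnt: "W \<inter> ball 0 (norm c - a) = {}"
proof -
  have "w \<notin> ball 0 (norm c - a)" if "w \<in> W" for w
    using that norm_triangle_ineq2[of c w] by (auto simp: W_def dist_norm)
  then show ?thesis by auto
qed

lemma cbox_W: "cbox lo up \<subseteq> W"
proof
  fix y assume y: "y \<in> cbox lo up"
  have "norm (y - c) \<le> (\<Sum>k\<in>UNIV. \<bar>(y - c) $ k\<bar>)" by (rule norm_le_l1_cart)
  also have "\<dots> \<le> (\<Sum>k\<in>(UNIV :: 'n set). a / real CARD('n))"
    using y by (intro sum_mono) (auto simp: mem_box_cart lo_def up_def abs_le_iff algebra_simps)
  also have "\<dots> = a" by simp
  finally show "y \<in> W" by (simp add: W_def dist_norm norm_minus_commute)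
qed

lemma \<omega>: "emeasure lborel W = ennreal \<omega>" "\<omega> > 0"
proof -
  have fin: "emeasure lborel W < \<infinity>" unfolding W_def using emeasure_bounded_finite[OF bounded_cball] .
  then show "emeasure lborel W = ennreal \<omega>" unfolding \<omega>_def by (simp add: emeasure_eq_ennreal_measure less_top)
  have "\<omega> = unit_ball_vol (real CARD('n)) * a ^ CARD('n)"
    unfolding \<omega>_def W_def using a content_cball[of a c] by simp
  then show "\<omega> > 0" using a by simp
qed

lemma \<kappa>: "\<kappa> > 0"
  unfolding \<kappa>_def by (rule integral_kern_pos) (use a in \<open>simp add: lo_def up_def\<close>)

text \<open>\<open>D\<close> is open: its complement consists of the differences between a closed
  set, the complement of \<Omega>, and a compact one, the truncated cone.\<close>

lemma D_borel [measurable]: "D \<in> sets borel"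
proof -
  let ?K = "(\<lambda>(t, w). t *\<^sub>R w) ` ({0..1::real} \<times> W)"
  have "compact ?K"
    by (intro compact_continuous_image compact_Times) (auto simp: W_def case_prod_beta intro!: continuous_intros)
  then have "closed (\<Union>x\<in>- \<Omega>. \<Union>y\<in>?K. {x - y})"
    using open_\<Omega> by (intro closed_compact_differences) auto
  moreover have "D = - (\<Union>x\<in>- \<Omega>. \<Union>y\<in>?K. {x - y})"
  proof -
    have "x \<notin> D \<longleftrightarrow> (\<exists>z\<in>-\<Omega>. \<exists>y\<in>?K. x = z - y)" for x
    proof
      assume "x \<notin> D"
      then obtain t w where "t \<in> {0..1}" "w \<in> W" "x + t *\<^sub>R w \<notin> \<Omega>" by (auto simp: D_def)
      then show "\<exists>z\<in>-\<Omega>. \<exists>y\<in>?K. x = z - y"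
        by (intro bexI[of _ "x + t *\<^sub>R w"] bexI[of _ "t *\<^sub>R w"]) auto
    next
      assume "\<exists>z\<in>-\<Omega>. \<exists>y\<in>?K. x = z - y"
      then obtain z t w where "z \<notin> \<Omega>" "t \<in> {0..1}" "w \<in> W" "x = z - t *\<^sub>R w" by auto
      then show "x \<notin> D"
        unfolding D_def mem_Collect_eq by (metis diff_add_cancel)
    qed
    then have "x \<in> D \<longleftrightarrow> x \<in> - (\<Union>x\<in>- \<Omega>. \<Union>y\<in>?K. {x - y})" for x
      by (simp only: Compl_iff UN_iff singleton_iff) blast
    then show ?thesis by blast
  qed
  ultimately show ?thesis by (metis borel_open open_Compl)
qed

text \<open>The vector \<open>t w + \<tau> y\<close> is \<open>t + \<tau>\<close> times a convex
  combination of two points of \<open>W\<close>. This is why rays and kernel scales are both limited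
  to 1/2.\<close>

lemma segment:
  assumes "x \<in> D" "0 \<le> t" "t \<le> 1/2" "w \<in> W" "0 < \<tau>" "\<tau> \<le> 1/2" "y \<in> cbox lo up"
  shows "x + t *\<^sub>R w + \<tau> *\<^sub>R y \<in> \<Omega>"
proof -
  have "(t / (t + \<tau>)) *\<^sub>R w + (\<tau> / (t + \<tau>)) *\<^sub>R y \<in> W"
    using assms cbox_W convex_cball[of c a] unfolding W_def
    by (intro convexD) (auto simp: add_divide_distrib[symmetric])
  moreover have "t + \<tau> \<in> {0..1}" using assms by auto
  ultimately have "x + (t + \<tau>) *\<^sub>R ((t / (t + \<tau>)) *\<^sub>R w + (\<tau> / (t + \<tau>)) *\<^sub>R y) \<in> \<Omega>"
    using assms(1) unfolding D_def by blast
  moreover have "(t + \<tau>) *\<^sub>R ((t / (t + \<tau>)) *\<^sub>R w + (\<tau> / (t + \<tau>)) *\<^sub>R y) = t *\<^sub>R w + \<tau> *\<^sub>R y"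
    using assms by (simp add: scaleR_add_right)
  ultimately show ?thesis by (simp add: add.assoc)
qed

lemma norm_sum_W:
  assumes "w \<in> W" shows "norm (\<Sum>i\<in>UNIV. complex_of_real (w $ i) * z i) \<le> d * (\<Sum>i\<in>UNIV. norm (z i))"
proof -
  have wd: "\<bar>w $ i\<bar> \<le> d" for i
    using assms W_ball component_le_norm_cart[of w i] by (auto simp: subset_eq intro: order_trans less_imp_le)
  have "norm (\<Sum>i\<in>UNIV. complex_of_real (w $ i) * z i) \<le> (\<Sum>i\<in>UNIV. d * norm (z i))"
    by (intro sum_norm_le) (simp add: norm_mult wd mult_right_mono)
  then show ?thesis by (simp add: sum_distrib_left)
qed

section \<open>Estimates along single rays, integrated over the cone\<close>

text \<open>A sum of moduli in place of the Euclidean length of the gradient: up to the factor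
  \<open>d\<close> it dominates the derivatives along all directions in \<open>W\<close>, and it
  splits into one term for each partial derivative.\<close>

definition "grad_sm \<tau> V y = (\<Sum>i\<in>UNIV. norm (sm \<tau> (V i) y))"

lemma grad_sm_nonneg: "0 \<le> grad_sm \<tau> V y" by (simp add: grad_sm_def sum_nonneg)

lemma grad_sm_borel [measurable (raw)]:
  assumes "\<And>i. loc_int (V i)" "h \<in> borel_measurable M"
  shows "(\<lambda>z. grad_sm \<tau> V (h z)) \<in> borel_measurable M"
proof -
  have [measurable]: "\<And>i. V i \<in> borel_measurable borel" "h \<in> borel_measurable M"
    using assms by (auto simp: loc_int_def)
  show ?thesis unfolding grad_sm_def by measurable
qed

lemma ray_deriv:
  assumes U: "loc_int U" and V: "\<And>i. loc_int (V i)" "\<And>i. wder \<Omega> (unit_index i) U (V i)"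
    and x: "x \<in> D" "w \<in> W" "0 < \<tau>" "\<tau> \<le> 1/2" "0 \<le> t" "t \<le> 1/2"
  shows "((\<lambda>t. sm \<tau> U (x + t *\<^sub>R w)) has_vector_derivative (\<Sum>i\<in>UNIV. complex_of_real (w $ i) * sm \<tau> (V i) (x + t *\<^sub>R w))) (at t)"
  by (rule smear_line_has_derivative[OF U V x(3)]) (use x segment in blast)

text \<open>The fundamental theorem between \<open>t = 0\<close> and \<open>t = 1/2\<close>. The far
  value enters only through its average over \<open>x + W / 2\<close>, a set of fixed size, where no
  singularity arises.\<close>

lemma ray_first_order:
  assumes U: "loc_int U" and V: "\<And>i. loc_int (V i)" "\<And>i. wder \<Omega> (unit_index i) U (V i)"
    and x: "x \<in> D" and \<tau>: "0 < \<tau>" "\<tau> \<le> 1/2"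
  shows "ennreal \<omega> * ennreal (norm (sm \<tau> U x)) \<le> avg W (1/2) (\<lambda>y. ennreal (norm (sm \<tau> U y))) x
     + ennreal d * pot W TT 0 (\<lambda>y. ennreal (grad_sm \<tau> V y)) x"
  unfolding \<omega>(1)[symmetric]
proof (rule integral_rays)
  have [measurable]: "U \<in> borel_measurable borel" using U by (simp add: loc_int_def)
  show "(\<lambda>y. ennreal (norm (sm \<tau> U y))) \<in> borel_measurable borel" by measurable
  show "(\<lambda>y. ennreal (grad_sm \<tau> V y)) \<in> borel_measurable borel" using V by measurable
  fix w assume w: "w \<in> W"
  let ?h = "\<lambda>t. sm \<tau> U (x + t *\<^sub>R w)" and ?h' = "\<lambda>t. \<Sum>i\<in>UNIV. complex_of_real (w $ i) * sm \<tau> (V i) (x + t *\<^sub>R w)"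
  have "ennreal (norm (?h (1/2) - ?h 0)) \<le> (\<integral>\<^sup>+t. indicator TT t * ennreal (norm (?h' t)) \<partial>lborel)"
  proof (rule norm_diff_le_nn_integral_deriv)
    fix t :: real assume t: "0 \<le> t" "t \<le> 1/2"
    show "(?h has_vector_derivative ?h' t) (at t within {0..1/2})"
      by (rule has_vector_derivative_at_within[OF ray_deriv[OF U V x w \<tau> t]])
  qed (simp, intro continuous_on_sum continuous_on_mult continuous_on_const continuous_smear_line V \<tau>)
  also have "\<dots> \<le> (\<integral>\<^sup>+t. ennreal d * (indicator TT t * ennreal (grad_sm \<tau> V (x + t *\<^sub>R w))) \<partial>lborel)"
    using norm_sum_W[OF w] d
    by (intro nn_integral_mono) (auto simp: indicator_def grad_sm_def sum_nonneg simp flip: ennreal_mult intro!: ennreal_leI)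
  also have "\<dots> = ennreal d * (\<integral>\<^sup>+t. indicator TT t * ennreal (grad_sm \<tau> V (x + t *\<^sub>R w)) \<partial>lborel)"
    using V by (intro nn_integral_cmult) measurable
  finally have *: "ennreal (norm (?h (1/2) - ?h 0)) \<le> \<dots>" .
  have "norm (?h 0) \<le> norm (?h (1/2)) + norm (?h (1/2) - ?h 0)"
    using norm_triangle_sub[of "?h 0" "?h (1/2)"] by (simp only: norm_minus_commute)
  then have "ennreal (norm (sm \<tau> U x)) \<le> ennreal (norm (?h (1/2))) + ennreal (norm (?h (1/2) - ?h 0))"
    by (simp flip: ennreal_plus)
  also have "\<dots> \<le> ennreal (norm (?h (1/2))) + ennreal d * (\<integral>\<^sup>+t. indicator TT t * ennreal (grad_sm \<tau> V (x + t *\<^sub>R w)) \<partial>lborel)"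
    by (intro add_left_mono *)
  finally show "ennreal (norm (sm \<tau> U x)) \<le> ennreal (norm (sm \<tau> U (x + (1/2) *\<^sub>R w))) +
      ennreal d * (\<integral>\<^sup>+t. indicator TT t * (ennreal (t ^ 0) * ennreal (grad_sm \<tau> V (x + t *\<^sub>R w))) \<partial>lborel)"
    by simp
qed measurable

text \<open>On each ray the total variation is replaced by the crossing of the band between
  \<open>M\<close> and \<open>2 * M\<close>, so only the gradient inside that band enters the
  potential.\<close>

lemma ray_level:
  assumes U: "loc_int U" and V: "\<And>i. loc_int (V i)" "\<And>i. wder \<Omega> (unit_index i) U (V i)"
    and x: "x \<in> D" and \<tau>: "0 < \<tau>" "\<tau> \<le> 1/2" and M: "M > 0" "2 * M \<le> norm (sm \<tau> U x)"
  shows "ennreal \<omega> * ennreal M \<le> avg W (1/2) (\<lambda>y. ennreal (norm (sm \<tau> U y))) x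
     + ennreal d * pot W TT 0 (\<lambda>y. indicator {y. M < norm (sm \<tau> U y) \<and> norm (sm \<tau> U y) < 2 * M} y * ennreal (grad_sm \<tau> V y)) x"
  unfolding \<omega>(1)[symmetric]
proof (rule integral_rays)
  have [measurable]: "U \<in> borel_measurable borel" using U by (simp add: loc_int_def)
  note [measurable] = grad_sm_borel[where V = V, OF V(1)]
  show "(\<lambda>y. ennreal (norm (sm \<tau> U y))) \<in> borel_measurable borel" by measurable
  show "(\<lambda>y. indicator {y. M < norm (sm \<tau> U y) \<and> norm (sm \<tau> U y) < 2 * M} y * ennreal (grad_sm \<tau> V y)) \<in> borel_measurable borel"
    by measurable
  fix w assume w: "w \<in> W"
  let ?h = "\<lambda>t. sm \<tau> U (x + t *\<^sub>R w)" and ?h' = "\<lambda>t. \<Sum>i\<in>UNIV. complex_of_real (w $ i) * sm \<tau> (V i) (x + t *\<^sub>R w)"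
  let ?i = "\<lambda>t. indicator {y. M < norm y \<and> norm y < 2 * M} (?h t) :: ennreal"
  have "ennreal M \<le> ennreal (norm (?h (1/2))) + (\<integral>\<^sup>+t. indicator TT t * (?i t * ennreal (norm (?h' t))) \<partial>lborel)"
  proof (rule level_le_nn_integral_deriv)
    fix t :: real assume t: "0 \<le> t" "t \<le> 1/2"
    show "(?h has_vector_derivative ?h' t) (at t within {0..1/2})"
      by (rule has_vector_derivative_at_within[OF ray_deriv[OF U V x w \<tau> t]])
  next
    show "continuous_on {0..1/2} ?h'"
      by (intro continuous_on_sum continuous_on_mult continuous_on_const continuous_smear_line V \<tau>)
  qed (use M in simp_all)
  also have "(\<integral>\<^sup>+t. indicator TT t * (?i t * ennreal (norm (?h' t))) \<partial>lborel) \<le> (\<integral>\<^sup>+t. ennreal d * (indicator TT t * (?i t * ennreal (grad_sm \<tau> V (x + t *\<^sub>R w)))) \<partial>lborel)"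
    using norm_sum_W[OF w] d
    by (intro nn_integral_mono) (auto simp: indicator_def grad_sm_def sum_nonneg simp flip: ennreal_mult intro!: ennreal_leI)
  also have "\<dots> = ennreal d * (\<integral>\<^sup>+t. indicator TT t * (?i t * ennreal (grad_sm \<tau> V (x + t *\<^sub>R w))) \<partial>lborel)"
    by (intro nn_integral_cmult) measurable
  also have "(\<integral>\<^sup>+t. indicator TT t * (?i t * ennreal (grad_sm \<tau> V (x + t *\<^sub>R w))) \<partial>lborel) =
    (\<integral>\<^sup>+t. indicator TT t * (ennreal (t ^ 0) * (indicator {y. M < norm (sm \<tau> U y) \<and> norm (sm \<tau> U y) < 2 * M} (x + t *\<^sub>R w) * ennreal (grad_sm \<tau> V (x + t *\<^sub>R w)))) \<partial>lborel)"
    by (intro nn_integral_cong) (auto simp: indicator_def)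
  finally show "ennreal M \<le> ennreal (norm (sm \<tau> U (x + (1/2) *\<^sub>R w))) + ennreal d * \<dots>"
    by (simp add: add_left_mono)
qed measurable

text \<open>Expansion at the far end leaves first derivatives only as averages at distance 1/2; the
  potential contains second derivatives with the milder weight \<open>t\<close>. That the smeared
  first derivatives can be differentiated along the ray again is due to
  \<open>wder_trans\<close>.\<close>

lemma ray_second_order:
  assumes U: "loc_int U" and V: "\<And>i. loc_int (V i)" "\<And>i. wder \<Omega> (unit_index i) U (V i)"
    and V2: "\<And>i j. loc_int (V2 i j)" "\<And>i j. wder \<Omega> (\<lambda>k. unit_index i k + unit_index j k) U (V2 i j)"
    and x: "x \<in> D" and \<tau>: "0 < \<tau>" "\<tau> \<le> 1/2"
  shows "ennreal \<omega> * ennreal (norm (sm \<tau> U x)) \<le>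
     avg W (1/2) (\<lambda>y. ennreal (norm (sm \<tau> U y) + d * grad_sm \<tau> V y)) x
     + ennreal (d * d) * pot W TT 1 (\<lambda>y. ennreal (\<Sum>i\<in>UNIV. grad_sm \<tau> (V2 i) y)) x"
  unfolding \<omega>(1)[symmetric]
proof (rule integral_rays)
  have [measurable]: "U \<in> borel_measurable borel" using U by (simp add: loc_int_def)
  note [measurable] = grad_sm_borel[where V = V, OF V(1)] grad_sm_borel[where V = "V2 i" for i, OF V2(1)]
  show "(\<lambda>y. ennreal (norm (sm \<tau> U y) + d * grad_sm \<tau> V y)) \<in> borel_measurable borel" by measurable
  show "(\<lambda>y. ennreal (\<Sum>i\<in>UNIV. grad_sm \<tau> (V2 i) y)) \<in> borel_measurable borel" by measurable
  fix w assume w: "w \<in> W"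
  let ?h = "\<lambda>t. sm \<tau> U (x + t *\<^sub>R w)" and ?h' = "\<lambda>t. \<Sum>i\<in>UNIV. complex_of_real (w $ i) * sm \<tau> (V i) (x + t *\<^sub>R w)"
  let ?h'' = "\<lambda>t. \<Sum>i\<in>UNIV. complex_of_real (w $ i) * (\<Sum>j\<in>UNIV. complex_of_real (w $ j) * sm \<tau> (V2 i j) (x + t *\<^sub>R w))"
  have D2: "((\<lambda>t. sm \<tau> (V i) (x + t *\<^sub>R w)) has_vector_derivative (\<Sum>j\<in>UNIV. complex_of_real (w $ j) * sm \<tau> (V2 i j) (x + t *\<^sub>R w))) (at t within S)"
    if "0 \<le> t" "t \<le> 1/2" for i t S
    by (rule has_vector_derivative_at_within[OF ray_deriv[OF V(1) V2(1) wder_trans[OF V(2) V2(2)] x w \<tau> that]])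
  have *: "ennreal (norm (?h 0)) \<le> ennreal (norm (?h (1/2))) + ennreal (1/2) * ennreal (norm (?h' (1/2)))
    + (\<integral>\<^sup>+t. indicator TT t * (ennreal t * ennreal (norm (?h'' t))) \<partial>lborel)"
  proof (rule norm_le_nn_integral_deriv2)
    fix t :: real assume t: "0 \<le> t" "t \<le> 1/2"
    show "(?h has_vector_derivative ?h' t) (at t within {0..1/2})"
      by (rule has_vector_derivative_at_within[OF ray_deriv[OF U V x w \<tau> t]])
    show "(?h' has_vector_derivative ?h'' t) (at t within {0..1/2})"
      by (intro has_vector_derivative_sum has_vector_derivative_mult_right D2 t)
  qed (simp, intro continuous_on_sum continuous_on_mult continuous_on_const continuous_smear_line V2 \<tau>)
  have "norm (?h'' t) \<le> d * (d * (\<Sum>i\<in>UNIV. grad_sm \<tau> (V2 i) (x + t *\<^sub>R w)))" for t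
  proof -
    have "norm (?h'' t) \<le> d * (\<Sum>i\<in>UNIV. norm (\<Sum>j\<in>UNIV. complex_of_real (w $ j) * sm \<tau> (V2 i j) (x + t *\<^sub>R w)))"
      by (rule norm_sum_W[OF w])
    also have "\<dots> \<le> d * (\<Sum>i\<in>UNIV. d * grad_sm \<tau> (V2 i) (x + t *\<^sub>R w))"
      unfolding grad_sm_def using d by (intro mult_left_mono sum_mono norm_sum_W[OF w]) auto
    finally show ?thesis by (simp add: sum_distrib_left)
  qed
  then have "(\<integral>\<^sup>+t. indicator TT t * (ennreal t * ennreal (norm (?h'' t))) \<partial>lborel) \<le>
     (\<integral>\<^sup>+t. ennreal (d * d) * (indicator TT t * (ennreal (t ^ 1) * ennreal (\<Sum>i\<in>UNIV. grad_sm \<tau> (V2 i) (x + t *\<^sub>R w)))) \<partial>lborel)"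
    using d
    by (intro nn_integral_mono)
      (auto simp: indicator_def sum_nonneg grad_sm_nonneg mult.left_commute[of _ "ennreal _" "ennreal _"] simp flip: ennreal_mult intro!: ennreal_leI mult_left_mono)
  also have "\<dots> = ennreal (d * d) * (\<integral>\<^sup>+t. indicator TT t * (ennreal (t ^ 1) * ennreal (\<Sum>i\<in>UNIV. grad_sm \<tau> (V2 i) (x + t *\<^sub>R w))) \<partial>lborel)"
    by (intro nn_integral_cmult) measurable
  finally have I: "(\<integral>\<^sup>+t. indicator TT t * (ennreal t * ennreal (norm (?h'' t))) \<partial>lborel) \<le> \<dots>" .
  have "ennreal (norm (?h (1/2))) + ennreal (1/2) * ennreal (norm (?h' (1/2))) \<le> ennreal (norm (?h (1/2)) + d * grad_sm \<tau> V (x + (1/2) *\<^sub>R w))"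
  proof -
    have "1/2 * norm (?h' (1/2)) \<le> d * grad_sm \<tau> V (x + (1/2) *\<^sub>R w)"
      using norm_sum_W[OF w, of "\<lambda>i. sm \<tau> (V i) (x + (1/2) *\<^sub>R w)"] norm_ge_zero[of "?h' (1/2)"] unfolding grad_sm_def by linarith
    then have "norm (?h (1/2)) + 1/2 * norm (?h' (1/2)) \<le> norm (?h (1/2)) + d * grad_sm \<tau> V (x + (1/2) *\<^sub>R w)" by linarith
    then have "ennreal (norm (?h (1/2)) + 1/2 * norm (?h' (1/2))) \<le> ennreal (norm (?h (1/2)) + d * grad_sm \<tau> V (x + (1/2) *\<^sub>R w))"
      by (rule ennreal_leI)
    then show ?thesis by (simp only: ennreal_plus ennreal_mult norm_ge_zero mult_nonneg_nonneg zero_le_divide_1_iff zero_le_numeral)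
  qed
  then show "ennreal (norm (sm \<tau> U x)) \<le> ennreal (norm (sm \<tau> U (x + (1/2) *\<^sub>R w)) + d * grad_sm \<tau> V (x + (1/2) *\<^sub>R w)) +
     ennreal (d * d) * (\<integral>\<^sup>+t. indicator TT t * (ennreal (t ^ 1) * ennreal (\<Sum>i\<in>UNIV. grad_sm \<tau> (V2 i) (x + t *\<^sub>R w))) \<partial>lborel)"
    using order_trans[OF *[simplified scaleR_zero_left add_0_right] add_mono[OF _ I]] by blast
qed measurable

lemma nn_integral_sm_le:
  assumes "loc_int f" and p: "1 \<le> p"
  shows "(\<integral>\<^sup>+x. ennreal (norm (sm \<tau> f x) powr p) \<partial>lborel) \<le> ennreal (\<omega> powr p) * (\<integral>\<^sup>+x. ennreal (norm (f x) powr p) \<partial>lborel)"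
  by (rule nn_integral_smear_le[OF _ W_borel cbox_W]) (use assms \<omega> in \<open>auto simp: loc_int_def\<close>)

lemma nn_integral_grad_sm_le:
  fixes V :: "'n \<Rightarrow> real^'n \<Rightarrow> complex"
  assumes V: "\<And>i. loc_int (V i)" and p: "1 \<le> p"
  shows "(\<integral>\<^sup>+x. ennreal (grad_sm \<tau> V x powr p) \<partial>lborel) \<le> ennreal (real CARD('n) powr p * \<omega> powr p) * (\<Sum>i\<in>UNIV. \<integral>\<^sup>+x. ennreal (norm (V i x) powr p) \<partial>lborel)"
proof -
  have [measurable]: "\<And>i. V i \<in> borel_measurable borel" using V by (simp add: loc_int_def)
  have "(\<integral>\<^sup>+x. ennreal (grad_sm \<tau> V x powr p) \<partial>lborel) = (\<integral>\<^sup>+x. epow (\<Sum>i\<in>UNIV. ennreal (norm (sm \<tau> (V i) x))) p \<partial>lborel)"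
    unfolding grad_sm_def by (simp add: sum_ennreal epow_ennreal sum_nonneg)
  also have "\<dots> \<le> (\<integral>\<^sup>+x. ennreal (real CARD('n) powr p) * (\<Sum>i\<in>UNIV. epow (ennreal (norm (sm \<tau> (V i) x))) p) \<partial>lborel)"
    using epow_sum[of p "UNIV :: 'n set" "\<lambda>i. ennreal (norm (sm \<tau> (V i) x))" for x] p by (intro nn_integral_mono) simp
  also have "\<dots> = ennreal (real CARD('n) powr p) * (\<Sum>i\<in>UNIV. \<integral>\<^sup>+x. ennreal (norm (sm \<tau> (V i) x) powr p) \<partial>lborel)"
    by (simp add: nn_integral_cmult nn_integral_sum epow_ennreal del: sum_ennreal)
  also have "\<dots> \<le> ennreal (real CARD('n) powr p) * (\<Sum>i\<in>UNIV. ennreal (\<omega> powr p) * (\<integral>\<^sup>+x. ennreal (norm (V i x) powr p) \<partial>lborel))"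
    by (intro mult_left_mono sum_mono nn_integral_sm_le V p) auto
  finally show ?thesis by (simp add: sum_distrib_left[symmetric] ennreal_mult mult.assoc)
qed

text \<open>The limit in \<tau> gives the bound for \<open>\<kappa> U\<close>, and the power of
  \<kappa> is divided out.\<close>

lemma nn_integral_unsmear:
  assumes U: "loc_int U" and [measurable]: "H \<in> borel_measurable borel" and p: "1 \<le> p"
    and B: "\<And>\<tau>. 0 < \<tau> \<Longrightarrow> \<tau> \<le> 1/2 \<Longrightarrow> (\<integral>\<^sup>+x. H x * ennreal (norm (sm \<tau> U x) powr p) \<partial>lborel) \<le> B"
  shows "(\<integral>\<^sup>+x. H x * ennreal (norm (U x) powr p) \<partial>lborel) \<le> ennreal (1 / \<kappa> powr p) * B"
proof (rule ennreal_mult_le_imp_le)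
  have [measurable]: "U \<in> borel_measurable borel" using U by (simp add: loc_int_def)
  have half: "0 < (1/2 :: real)" by simp
  have le: "(\<integral>\<^sup>+x. H x * ennreal (norm (\<kappa> *\<^sub>R U x) powr p) \<partial>lborel) \<le> B"
    unfolding \<kappa>_def by (rule nn_integral_le_smear[OF U _ _ half B]) (use p in auto)
  have "(\<integral>\<^sup>+x. H x * ennreal (norm (\<kappa> *\<^sub>R U x) powr p) \<partial>lborel) = (\<integral>\<^sup>+x. ennreal (\<kappa> powr p) * (H x * ennreal (norm (U x) powr p)) \<partial>lborel)"
    using \<kappa> by (intro nn_integral_cong) (simp add: powr_mult ennreal_mult ac_simps)
  also have "\<dots> = ennreal (\<kappa> powr p) * (\<integral>\<^sup>+x. H x * ennreal (norm (U x) powr p) \<partial>lborel)"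
    by (intro nn_integral_cmult) measurable
  finally show "ennreal (\<kappa> powr p) * (\<integral>\<^sup>+x. H x * ennreal (norm (U x) powr p) \<partial>lborel) \<le> B"
    using le by simp
qed (use \<kappa> in simp)

end

section \<open>Weighted integral bounds over the points that carry the cone\<close>

definition Lpow :: "real \<Rightarrow> ('a::euclidean_space \<Rightarrow> complex) \<Rightarrow> ennreal" where
  "Lpow p f = (\<integral>\<^sup>+x. ennreal (norm (f x) powr p) \<partial>lborel)"

lemma ennreal_mult_le_trans:
  assumes "x \<le> ennreal a * y" "y \<le> ennreal b * z" "0 \<le> a"
  shows "x \<le> ennreal (a * b) * z"
proof -
  have "x \<le> ennreal a * (ennreal b * z)" using assms(1,2) mult_left_mono[of y "ennreal b * z" "ennreal a"] by auto
  then show ?thesis using assms(3) by (cases "0 \<le> b") (auto simp: ennreal_mult mult.assoc ennreal_neg mult_nonneg_nonpos)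
qed

lemma ennreal_mult_add_le:
  assumes "x \<le> ennreal a * z" "y \<le> ennreal b * z" "0 \<le> a" "0 \<le> b"
  shows "x + y \<le> ennreal (a + b) * z"
  using add_mono[OF assms(1,2)] assms(3,4) by (simp add: distrib_right)

context finite_cone
begin

text \<open>Dividing by \<omega> and the crude inequality
  \<open>(x + y)^p \<le> 2^p (x^p + y^p)\<close> produce the factor
  \<open>(2 / \<omega>) powr p\<close>. Both terms are measured by the same quantity
  \<open>S\<close>, later the Sobolev energy.\<close>

lemma nn_integral_D_le:
  assumes [measurable]: "H \<in> borel_measurable borel" "A \<in> borel_measurable borel" "P \<in> borel_measurable borel" "z \<in> borel_measurable borel"
    and p: "1 \<le> p" and e: "e \<ge> 0" and z: "\<And>x. 0 \<le> z x"
    and le: "\<And>x. x \<in> D \<Longrightarrow> ennreal \<omega> * ennreal (z x) \<le> A x + ennreal e * P x"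
    and EA: "(\<integral>\<^sup>+x. H x * epow (A x) p \<partial>lborel) \<le> ennreal KA * S" "0 \<le> KA"
    and EP: "(\<integral>\<^sup>+x. H x * epow (P x) p \<partial>lborel) \<le> ennreal KP * S" "0 \<le> KP"
  shows "(\<integral>\<^sup>+x. indicator D x * H x * ennreal (z x powr p) \<partial>lborel) \<le> ennreal ((2 / \<omega>) powr p * (KA + e powr p * KP)) * S"
proof -
  have "(\<integral>\<^sup>+x. indicator D x * H x * ennreal (z x powr p) \<partial>lborel) \<le>
    (\<integral>\<^sup>+x. ennreal ((2 / \<omega>) powr p) * (H x * epow (A x) p + ennreal (e powr p) * (H x * epow (P x) p)) \<partial>lborel)"
  proof (rule nn_integral_mono)
    fix x
    show "indicator D x * H x * ennreal (z x powr p) \<le> ennreal ((2 / \<omega>) powr p) * (H x * epow (A x) p + ennreal (e powr p) * (H x * epow (P x) p))"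
    proof (cases "x \<in> D")
      case True
      have "ennreal (\<omega> powr p * z x powr p) = epow (ennreal \<omega> * ennreal (z x)) p"
        using z[of x] \<omega>(2) by (simp add: epow_ennreal powr_mult flip: ennreal_mult)
      also have "\<dots> \<le> epow (A x + ennreal e * P x) p"
        using p by (intro epow_mono le True) auto
      also have "\<dots> \<le> ennreal (2 powr p) * (epow (A x) p + epow (ennreal e * P x) p)"
        using p by (intro epow_add) auto
      also have "epow (ennreal e * P x) p = ennreal (e powr p) * epow (P x) p"
        using p e by (simp add: epow_mult epow_ennreal)
      finally have "ennreal (1 / \<omega> powr p) * (H x * ennreal (\<omega> powr p * z x powr p)) \<le> ennreal (1 / \<omega> powr p) * (H x * (ennreal (2 powr p) * (epow (A x) p + ennreal (e powr p) * epow (P x) p)))"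
        by (intro mult_left_mono) auto
      moreover have "ennreal (1 / \<omega> powr p) * (H x * ennreal (\<omega> powr p * z x powr p)) = H x * ennreal (z x powr p)"
        using \<omega>(2) by (simp add: mult.left_commute[of _ "H x"] flip: ennreal_mult)
      moreover have "ennreal (1 / \<omega> powr p) * (H x * (ennreal (2 powr p) * (epow (A x) p + ennreal (e powr p) * epow (P x) p)))
        = (ennreal (1 / \<omega> powr p) * ennreal (2 powr p)) * (H x * epow (A x) p + ennreal (e powr p) * (H x * epow (P x) p))"
        by (simp only: distrib_left ac_simps)
      moreover have "ennreal (1 / \<omega> powr p) * ennreal (2 powr p) = ennreal ((2 / \<omega>) powr p)"
        using \<omega>(2) by (simp add: powr_divide flip: ennreal_mult)
      ultimately show ?thesis using True by simp
    qed simp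
  qed
  also have "\<dots> = ennreal ((2 / \<omega>) powr p) * ((\<integral>\<^sup>+x. H x * epow (A x) p \<partial>lborel) + ennreal (e powr p) * (\<integral>\<^sup>+x. H x * epow (P x) p \<partial>lborel))"
    by (simp add: nn_integral_cmult nn_integral_add)
  also have "\<dots> \<le> ennreal ((2 / \<omega>) powr p) * (ennreal KA * S + ennreal (e powr p) * (ennreal KP * S))"
    by (intro mult_left_mono add_mono EA EP) auto
  also have "\<dots> = ennreal ((2 / \<omega>) powr p * (KA + e powr p * KP)) * S"
    using EA(2) EP(2) by (simp add: ennreal_mult ennreal_plus distrib_right distrib_left mult.assoc)
  finally show ?thesis .
qed

text \<open>The estimates for averages and potentials enter as hypotheses, so that growth exponents
  below 1 and the one-dimensional case share this proof. The constant is spelled out so that its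
  independence of \<open>U\<close> and \<open>V\<close> can be read off.\<close>

lemma bound_first:
  fixes V :: "'n \<Rightarrow> real^'n \<Rightarrow> complex"
  assumes [measurable]: "H \<in> borel_measurable borel" and p: "1 \<le> p"
    and avgb: "\<And>f. f \<in> borel_measurable borel \<Longrightarrow> (\<integral>\<^sup>+x. H x * epow (avg W (1/2) f x) p \<partial>lborel) \<le> ennreal Ka * (\<integral>\<^sup>+x. epow (f x) p \<partial>lborel)" "Ka \<ge> 0"
    and potb: "\<And>f. f \<in> borel_measurable borel \<Longrightarrow> (\<integral>\<^sup>+x. H x * epow (pot W TT 0 f x) p \<partial>lborel) \<le> ennreal Kp * (\<integral>\<^sup>+x. epow (f x) p \<partial>lborel)" "Kp \<ge> 0"
    and U: "loc_int U" and V: "\<And>i. loc_int (V i)" "\<And>i. wder \<Omega> (unit_index i) U (V i)"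
    and S: "Lpow p U \<le> S" "(\<Sum>i\<in>UNIV. Lpow p (V i)) \<le> ennreal N1 * S" "N1 \<ge> 0"
  shows "(\<integral>\<^sup>+x. indicator D x * H x * ennreal (norm (U x) powr p) \<partial>lborel)
    \<le> ennreal (1 / \<kappa> powr p * ((2 / \<omega>) powr p * (Ka * \<omega> powr p + d powr p * (Kp * (real CARD('n) powr p * \<omega> powr p * N1))))) * S"
proof -
  have [measurable]: "U \<in> borel_measurable borel" using U by (simp add: loc_int_def)
  note [measurable] = grad_sm_borel[where V = V, OF V(1)]
  let ?K = "(2 / \<omega>) powr p * (Ka * \<omega> powr p + d powr p * (Kp * (real CARD('n) powr p * \<omega> powr p * N1)))"
  have "(\<integral>\<^sup>+x. indicator D x * H x * ennreal (norm (U x) powr p) \<partial>lborel) \<le> ennreal (1 / \<kappa> powr p) * (ennreal ?K * S)"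
  proof (rule nn_integral_unsmear[OF U _ p])
    show "(\<lambda>x. indicator D x * H x) \<in> borel_measurable borel" by measurable
    fix \<tau> :: real assume \<tau>: "0 < \<tau>" "\<tau> \<le> 1/2"
    show "(\<integral>\<^sup>+x. indicator D x * H x * ennreal (norm (sm \<tau> U x) powr p) \<partial>lborel) \<le> ennreal ?K * S"
    proof (rule nn_integral_D_le[where P = "pot W TT 0 (\<lambda>y. ennreal (grad_sm \<tau> V y))" and A = "avg W (1/2) (\<lambda>y. ennreal (norm (sm \<tau> U y)))"])
      show "(\<integral>\<^sup>+x. H x * epow (avg W (1/2) (\<lambda>y. ennreal (norm (sm \<tau> U y))) x) p \<partial>lborel) \<le> ennreal (Ka * \<omega> powr p) * S"
      proof (rule ennreal_mult_le_trans[OF avgb(1) _ avgb(2)])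
        have "(\<integral>\<^sup>+x. epow (ennreal (norm (sm \<tau> U x))) p \<partial>lborel) \<le> ennreal (\<omega> powr p) * Lpow p U"
          using nn_integral_sm_le[OF U p, of \<tau>] by (simp add: epow_ennreal Lpow_def)
        also have "\<dots> \<le> ennreal (\<omega> powr p) * S" by (intro mult_left_mono S) auto
        finally show "(\<integral>\<^sup>+x. epow (ennreal (norm (sm \<tau> U x))) p \<partial>lborel) \<le> ennreal (\<omega> powr p) * S" .
      qed measurable
      show "(\<integral>\<^sup>+x. H x * epow (pot W TT 0 (\<lambda>y. ennreal (grad_sm \<tau> V y)) x) p \<partial>lborel) \<le> ennreal (Kp * (real CARD('n) powr p * \<omega> powr p * N1)) * S"
      proof (rule ennreal_mult_le_trans[OF potb(1) _ potb(2)])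
        have "(\<integral>\<^sup>+x. epow (ennreal (grad_sm \<tau> V x)) p \<partial>lborel) \<le> ennreal (real CARD('n) powr p * \<omega> powr p) * (\<Sum>i\<in>UNIV. Lpow p (V i))"
          using nn_integral_grad_sm_le[where V = V, OF V(1) p, of \<tau>] by (simp add: epow_ennreal Lpow_def grad_sm_nonneg)
        then show "(\<integral>\<^sup>+x. epow (ennreal (grad_sm \<tau> V x)) p \<partial>lborel) \<le> ennreal (real CARD('n) powr p * \<omega> powr p * N1) * S"
          by (rule ennreal_mult_le_trans[OF _ S(2)]) simp
      qed measurable
    qed (use p d avgb(2) potb(2) S(3) ray_first_order[OF U V _ \<tau>] in \<open>auto\<close>)
  qed
  also have "\<dots> = ennreal (1 / \<kappa> powr p * ?K) * S"
  proof -
    have "0 \<le> ?K" using avgb(2) potb(2) S(3) by (intro mult_nonneg_nonneg add_nonneg_nonneg) auto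
    then show ?thesis by (simp only: ennreal_mult'' mult.assoc)
  qed
  finally show ?thesis .
qed

lemma bound_second:
  fixes V :: "'n \<Rightarrow> real^'n \<Rightarrow> complex" and VV :: "'n \<Rightarrow> 'n \<Rightarrow> real^'n \<Rightarrow> complex"
  assumes [measurable]: "H \<in> borel_measurable borel" and p: "1 \<le> p"
    and avgb: "\<And>f. f \<in> borel_measurable borel \<Longrightarrow> (\<integral>\<^sup>+x. H x * epow (avg W (1/2) f x) p \<partial>lborel) \<le> ennreal Ka * (\<integral>\<^sup>+x. epow (f x) p \<partial>lborel)" "Ka \<ge> 0"
    and potb: "\<And>f. f \<in> borel_measurable borel \<Longrightarrow> (\<integral>\<^sup>+x. H x * epow (pot W TT 1 f x) p \<partial>lborel) \<le> ennreal Kp * (\<integral>\<^sup>+x. epow (f x) p \<partial>lborel)" "Kp \<ge> 0"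
    and U: "loc_int U" and V: "\<And>i. loc_int (V i)" "\<And>i. wder \<Omega> (unit_index i) U (V i)"
    and VV: "\<And>i j. loc_int (VV i j)" "\<And>i j. wder \<Omega> (\<lambda>k. unit_index i k + unit_index j k) U (VV i j)"
    and S: "Lpow p U \<le> S" "(\<Sum>i\<in>UNIV. Lpow p (V i)) \<le> ennreal N1 * S" "N1 \<ge> 0"
      "(\<Sum>i\<in>UNIV. \<Sum>j\<in>UNIV. Lpow p (VV i j)) \<le> ennreal N2 * S" "N2 \<ge> 0"
  shows "(\<integral>\<^sup>+x. indicator D x * H x * ennreal (norm (U x) powr p) \<partial>lborel)
    \<le> ennreal (1 / \<kappa> powr p * ((2 / \<omega>) powr p * (Ka * (2 powr p * (\<omega> powr p + d powr p * (real CARD('n) powr p * \<omega> powr p * N1)))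
        + (d * d) powr p * (Kp * (real CARD('n) powr p * (real CARD('n) powr p * \<omega> powr p * N2)))))) * S"
proof -
  have [measurable]: "U \<in> borel_measurable borel" using U by (simp add: loc_int_def)
  note [measurable] = grad_sm_borel[where V = V, OF V(1)] grad_sm_borel[where V = "VV i" for i, OF VV(1)]
  let ?n = "real CARD('n) powr p"
  let ?KA = "Ka * (2 powr p * (\<omega> powr p + d powr p * (?n * \<omega> powr p * N1)))"
  let ?KP = "Kp * (?n * (?n * \<omega> powr p * N2))"
  let ?K = "(2 / \<omega>) powr p * (?KA + (d * d) powr p * ?KP)"
  have sm0: "(\<integral>\<^sup>+x. epow (ennreal (norm (sm \<tau> U x))) p \<partial>lborel) \<le> ennreal (\<omega> powr p) * S" for \<tau>
  proof -
    have "(\<integral>\<^sup>+x. epow (ennreal (norm (sm \<tau> U x))) p \<partial>lborel) \<le> ennreal (\<omega> powr p) * Lpow p U"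
      using nn_integral_sm_le[OF U p, of \<tau>] by (simp add: epow_ennreal Lpow_def)
    also have "\<dots> \<le> ennreal (\<omega> powr p) * S" by (intro mult_left_mono S) auto
    finally show ?thesis .
  qed
  have sm1: "(\<integral>\<^sup>+x. epow (ennreal (grad_sm \<tau> V x)) p \<partial>lborel) \<le> ennreal (?n * \<omega> powr p * N1) * S" for \<tau>
  proof -
    have "(\<integral>\<^sup>+x. epow (ennreal (grad_sm \<tau> V x)) p \<partial>lborel) \<le> ennreal (?n * \<omega> powr p) * (\<Sum>i\<in>UNIV. Lpow p (V i))"
      using nn_integral_grad_sm_le[where V = V, OF V(1) p, of \<tau>] by (simp add: epow_ennreal Lpow_def grad_sm_nonneg)
    then show ?thesis by (rule ennreal_mult_le_trans[OF _ S(2)]) simp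
  qed
  have sm2: "(\<integral>\<^sup>+x. epow (ennreal (\<Sum>i\<in>UNIV. grad_sm \<tau> (VV i) x)) p \<partial>lborel) \<le> ennreal (?n * (?n * \<omega> powr p * N2)) * S" for \<tau>
  proof (rule ennreal_mult_le_trans)
    have "(\<integral>\<^sup>+x. epow (ennreal (\<Sum>i\<in>UNIV. grad_sm \<tau> (VV i) x)) p \<partial>lborel) = (\<integral>\<^sup>+x. epow (\<Sum>i\<in>UNIV. ennreal (grad_sm \<tau> (VV i) x)) p \<partial>lborel)"
      by (simp add: grad_sm_nonneg)
    also have "\<dots> \<le> (\<integral>\<^sup>+x. ennreal ?n * (\<Sum>i\<in>UNIV. epow (ennreal (grad_sm \<tau> (VV i) x)) p) \<partial>lborel)"
      by (intro nn_integral_mono epow_sum[of p "UNIV :: 'n set"]) (use p in auto)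
    also have "\<dots> = ennreal ?n * (\<Sum>i\<in>UNIV. \<integral>\<^sup>+x. epow (ennreal (grad_sm \<tau> (VV i) x)) p \<partial>lborel)"
      by (simp add: nn_integral_cmult nn_integral_sum)
    finally show "(\<integral>\<^sup>+x. epow (ennreal (\<Sum>i\<in>UNIV. grad_sm \<tau> (VV i) x)) p \<partial>lborel) \<le> \<dots>" .
    have "(\<Sum>i\<in>UNIV. \<integral>\<^sup>+x. epow (ennreal (grad_sm \<tau> (VV i) x)) p \<partial>lborel) \<le> (\<Sum>i\<in>UNIV. ennreal (?n * \<omega> powr p) * (\<Sum>j\<in>UNIV. Lpow p (VV i j)))"
    proof (rule sum_mono)
      fix i
      show "(\<integral>\<^sup>+x. epow (ennreal (grad_sm \<tau> (VV i) x)) p \<partial>lborel) \<le> ennreal (?n * \<omega> powr p) * (\<Sum>j\<in>UNIV. Lpow p (VV i j))"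
        using nn_integral_grad_sm_le[where V = "VV i", OF VV(1) p, of \<tau>] by (simp add: epow_ennreal Lpow_def grad_sm_nonneg)
    qed
    then have "(\<Sum>i\<in>UNIV. \<integral>\<^sup>+x. epow (ennreal (grad_sm \<tau> (VV i) x)) p \<partial>lborel) \<le> ennreal (?n * \<omega> powr p) * (\<Sum>i\<in>UNIV. \<Sum>j\<in>UNIV. Lpow p (VV i j))"
      by (simp add: sum_distrib_left)
    then show "(\<Sum>i\<in>UNIV. \<integral>\<^sup>+x. epow (ennreal (grad_sm \<tau> (VV i) x)) p \<partial>lborel) \<le> ennreal (?n * \<omega> powr p * N2) * S"
      by (rule ennreal_mult_le_trans[OF _ S(4)]) simp
  qed simp
  have "(\<integral>\<^sup>+x. indicator D x * H x * ennreal (norm (U x) powr p) \<partial>lborel) \<le> ennreal (1 / \<kappa> powr p) * (ennreal ?K * S)"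
  proof (rule nn_integral_unsmear[OF U _ p])
    show "(\<lambda>x. indicator D x * H x) \<in> borel_measurable borel" by measurable
    fix \<tau> :: real assume \<tau>: "0 < \<tau>" "\<tau> \<le> 1/2"
    let ?f = "\<lambda>y. ennreal (norm (sm \<tau> U y) + d * grad_sm \<tau> V y)"
    show "(\<integral>\<^sup>+x. indicator D x * H x * ennreal (norm (sm \<tau> U x) powr p) \<partial>lborel) \<le> ennreal ?K * S"
    proof (rule nn_integral_D_le[where P = "pot W TT 1 (\<lambda>y. ennreal (\<Sum>i\<in>UNIV. grad_sm \<tau> (VV i) y))" and A = "avg W (1/2) ?f"])
      show "(\<integral>\<^sup>+x. H x * epow (avg W (1/2) ?f x) p \<partial>lborel) \<le> ennreal ?KA * S"
      proof (rule ennreal_mult_le_trans[OF avgb(1) _ avgb(2)])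
        have "(\<integral>\<^sup>+x. epow (?f x) p \<partial>lborel) \<le> (\<integral>\<^sup>+x. ennreal (2 powr p) * (epow (ennreal (norm (sm \<tau> U x))) p + ennreal (d powr p) * epow (ennreal (grad_sm \<tau> V x)) p) \<partial>lborel)"
        proof (rule nn_integral_mono)
          fix x
          show "epow (?f x) p \<le> ennreal (2 powr p) * (epow (ennreal (norm (sm \<tau> U x))) p + ennreal (d powr p) * epow (ennreal (grad_sm \<tau> V x)) p)"
            using epow_add[of p "ennreal (norm (sm \<tau> U x))" "ennreal d * ennreal (grad_sm \<tau> V x)"] p d grad_sm_nonneg[of \<tau> V x]
            by (simp add: epow_mult epow_ennreal ennreal_mult)
        qed
        also have "\<dots> = ennreal (2 powr p) * ((\<integral>\<^sup>+x. epow (ennreal (norm (sm \<tau> U x))) p \<partial>lborel) + ennreal (d powr p) * (\<integral>\<^sup>+x. epow (ennreal (grad_sm \<tau> V x)) p \<partial>lborel))"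
          by (simp add: nn_integral_cmult nn_integral_add)
        finally show "(\<integral>\<^sup>+x. epow (?f x) p \<partial>lborel) \<le> ennreal (2 powr p * (\<omega> powr p + d powr p * (?n * \<omega> powr p * N1))) * S"
          by (rule ennreal_mult_le_trans[OF _ ennreal_mult_add_le[OF sm0 ennreal_mult_le_trans[OF order_refl sm1]]])
            (use S(3) in auto)
      qed measurable
      show "(\<integral>\<^sup>+x. H x * epow (pot W TT 1 (\<lambda>y. ennreal (\<Sum>i\<in>UNIV. grad_sm \<tau> (VV i) y)) x) p \<partial>lborel) \<le> ennreal ?KP * S"
        by (rule ennreal_mult_le_trans[OF potb(1) sm2 potb(2)]) measurable
      show "0 \<le> ?KA" "0 \<le> ?KP" using avgb(2) potb(2) S(3,5) d by simp_all
      show "avg W (1/2) ?f \<in> borel_measurable borel" by measurable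
      show "pot W TT 1 (\<lambda>y. ennreal (\<Sum>i\<in>UNIV. grad_sm \<tau> (VV i) y)) \<in> borel_measurable borel" by measurable
      show "(\<lambda>x. norm (sm \<tau> U x)) \<in> borel_measurable borel" by measurable
      show "ennreal \<omega> * ennreal (norm (sm \<tau> U x)) \<le> avg W (1/2) ?f x + ennreal (d * d) * pot W TT 1 (\<lambda>y. ennreal (\<Sum>i\<in>UNIV. grad_sm \<tau> (VV i) y)) x" if "x \<in> D" for x
        by (rule ray_second_order[OF U V VV that \<tau>])
    qed (use p d in auto)
  qed
  also have "\<dots> = ennreal (1 / \<kappa> powr p * ?K) * S"
  proof -
    have "0 \<le> ?K" using avgb(2) potb(2) S(3,5) by (intro mult_nonneg_nonneg add_nonneg_nonneg) auto
    then show ?thesis by (simp only: ennreal_mult'' mult.assoc)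
  qed
  finally show ?thesis .
qed

text \<open>The level set argument needs differentiability along rays and is therefore run on the
  smeared function at each fixed \<tau>; only the resulting bound, which is uniform in \<tau>, is
  passed to the limit.\<close>

lemma bound_critical:
  assumes p: "1 \<le> p" "p < real CARD('n)" and A: "A \<ge> 0" and N1: "N1 \<ge> 0"
  obtains C where "C \<ge> 0" "\<And>(G :: real^'n \<Rightarrow> real) U (V :: 'n \<Rightarrow> real^'n \<Rightarrow> complex) S. G \<in> borel_measurable borel \<Longrightarrow> (\<And>x. (0::real) \<le> G x) \<Longrightarrow>
    (\<And>z. (\<integral>\<^sup>+x. indicator (ball z (d / 2)) x * ennreal (G x powr real CARD('n)) \<partial>lborel) \<le> ennreal A) \<Longrightarrow>
    loc_int U \<Longrightarrow> (\<And>i. loc_int (V i)) \<Longrightarrow> (\<And>i. wder \<Omega> (unit_index i) U (V i)) \<Longrightarrow>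
    Lpow p U \<le> S \<Longrightarrow> (\<Sum>i\<in>UNIV. Lpow p (V i)) \<le> ennreal N1 * S \<Longrightarrow>
    (\<integral>\<^sup>+x. indicator D x * ennreal (G x powr p) * ennreal (norm (U x) powr p) \<partial>lborel) \<le> ennreal C * S"
proof -
  obtain C where C: "C \<ge> 0" "\<And>u F (G :: real^'n \<Rightarrow> real) D. u \<in> borel_measurable borel \<Longrightarrow> F \<in> borel_measurable borel \<Longrightarrow>
    G \<in> borel_measurable borel \<Longrightarrow> D \<in> sets borel \<Longrightarrow>
    (\<And>x. (0::real) \<le> u x) \<Longrightarrow> (\<And>x. (0::real) \<le> G x) \<Longrightarrow>
    (\<And>z. (\<integral>\<^sup>+x. indicator (ball z (d / 2)) x * ennreal (G x powr real CARD('n)) \<partial>lborel) \<le> ennreal A) \<Longrightarrow>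
    (\<And>x (k::int). x \<in> D \<Longrightarrow> 2 powr (real_of_int k + 1) \<le> u x \<Longrightarrow>
       ennreal (\<omega> * 2 powr k) \<le> avg W (1/2) (\<lambda>x. ennreal (u x)) x
         + ennreal d * pot W {0<..<1/2} 0 (\<lambda>y. indicator {y. 2 powr k < u y \<and> u y < 2 powr (real_of_int k + 1)} y * F y) x) \<Longrightarrow>
    (\<integral>\<^sup>+x. indicator D x * ennreal (G x powr p * u x powr p) \<partial>lborel) \<le>
      ennreal C * ((\<integral>\<^sup>+x. ennreal (u x powr p) \<partial>lborel) + (\<integral>\<^sup>+x. epow (F x) p \<partial>lborel))"
    by (rule nn_integral_level_sets_le[OF W_borel \<omega> W_ball d p _ A]) (simp, blast)
  let ?K = "C * (\<omega> powr p + real CARD('n) powr p * \<omega> powr p * N1)"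
  show ?thesis
  proof (rule that)
    show K: "0 \<le> 1 / \<kappa> powr p * ?K" using C(1) N1 by simp
    fix G :: "real^'n \<Rightarrow> real" and U and V :: "'n \<Rightarrow> real^'n \<Rightarrow> complex" and S
    assume [measurable]: "G \<in> borel_measurable borel" and G: "\<And>x. (0::real) \<le> G x"
      and GA: "\<And>z. (\<integral>\<^sup>+x. indicator (ball z (d / 2)) x * ennreal (G x powr real CARD('n)) \<partial>lborel) \<le> ennreal A"
      and U: "loc_int U" and V: "\<And>i. loc_int (V i)" "\<And>i. wder \<Omega> (unit_index i) U (V i)"
      and S: "Lpow p U \<le> S" "(\<Sum>i\<in>UNIV. Lpow p (V i)) \<le> ennreal N1 * S"
    have [measurable]: "U \<in> borel_measurable borel" using U by (simp add: loc_int_def)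
    note [measurable] = grad_sm_borel[where V = V, OF V(1)]
    have "(\<integral>\<^sup>+x. indicator D x * ennreal (G x powr p) * ennreal (norm (U x) powr p) \<partial>lborel) \<le> ennreal (1 / \<kappa> powr p) * (ennreal ?K * S)"
    proof (rule nn_integral_unsmear[OF U _ p(1)])
      show "(\<lambda>x. indicator D x * ennreal (G x powr p)) \<in> borel_measurable borel" by measurable
      fix \<tau> :: real assume \<tau>: "0 < \<tau>" "\<tau> \<le> 1/2"
      have "(\<integral>\<^sup>+x. indicator D x * ennreal (G x powr p * norm (sm \<tau> U x) powr p) \<partial>lborel) \<le>
        ennreal C * ((\<integral>\<^sup>+x. ennreal (norm (sm \<tau> U x) powr p) \<partial>lborel) + (\<integral>\<^sup>+x. epow (ennreal (grad_sm \<tau> V x)) p \<partial>lborel))"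
      proof (rule C(2)[OF _ _ _ D_borel _ G GA])
        fix x and k :: int assume x: "x \<in> D" and k: "2 powr (real_of_int k + 1) \<le> norm (sm \<tau> U x)"
        have two: "2 powr (real_of_int k + 1) = 2 * 2 powr real_of_int k" by (simp add: powr_add)
        show "ennreal (\<omega> * 2 powr k) \<le> avg W (1/2) (\<lambda>x. ennreal (norm (sm \<tau> U x))) x
         + ennreal d * pot W {0<..<1/2} 0 (\<lambda>y. indicator {y. 2 powr k < norm (sm \<tau> U y) \<and> norm (sm \<tau> U y) < 2 powr (real_of_int k + 1)} y * ennreal (grad_sm \<tau> V y)) x"
          using ray_level[OF U V x \<tau>, of "2 powr k"] k \<omega>(2) unfolding two by (simp add: ennreal_mult)
      qed simp_all
      then have "(\<integral>\<^sup>+x. indicator D x * ennreal (G x powr p) * ennreal (norm (sm \<tau> U x) powr p) \<partial>lborel) \<le>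
        ennreal C * ((\<integral>\<^sup>+x. ennreal (norm (sm \<tau> U x) powr p) \<partial>lborel) + (\<integral>\<^sup>+x. epow (ennreal (grad_sm \<tau> V x)) p \<partial>lborel))"
        by (simp add: ennreal_mult mult.assoc)
      moreover have "(\<integral>\<^sup>+x. ennreal (norm (sm \<tau> U x) powr p) \<partial>lborel) \<le> ennreal (\<omega> powr p) * S"
        using order_trans[OF nn_integral_sm_le[OF U p(1), of \<tau>, folded Lpow_def] mult_left_mono[OF S(1)]] by (simp add: Lpow_def)
      moreover have "(\<integral>\<^sup>+x. epow (ennreal (grad_sm \<tau> V x)) p \<partial>lborel) \<le> ennreal (real CARD('n) powr p * \<omega> powr p * N1) * S"
      proof (rule ennreal_mult_le_trans[OF _ S(2)])
        show "(\<integral>\<^sup>+x. epow (ennreal (grad_sm \<tau> V x)) p \<partial>lborel) \<le> ennreal (real CARD('n) powr p * \<omega> powr p) * (\<Sum>i\<in>UNIV. Lpow p (V i))"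
          using nn_integral_grad_sm_le[where V = V, OF V(1) p(1), of \<tau>] by (simp add: epow_ennreal Lpow_def grad_sm_nonneg)
      qed simp
      ultimately show "(\<integral>\<^sup>+x. indicator D x * ennreal (G x powr p) * ennreal (norm (sm \<tau> U x) powr p) \<partial>lborel) \<le> ennreal ?K * S"
        using C(1) N1 by (intro ennreal_mult_le_trans[OF _ ennreal_mult_add_le]) auto
    qed
    also have "\<dots> = ennreal (1 / \<kappa> powr p * ?K) * S"
    proof -
      have "0 \<le> ?K" using C(1) N1 by simp
      then show ?thesis by (simp only: ennreal_mult'' mult.assoc)
    qed
    finally show "(\<integral>\<^sup>+x. indicator D x * ennreal (G x powr p) * ennreal (norm (U x) powr p) \<partial>lborel) \<le> ennreal (1 / \<kappa> powr p * ?K) * S" .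
  qed
qed

end

section \<open>Morrey bounds, finitely many cones\<close>

text \<open>Morrey norm at most 1, raised to the power \<open>q\<close> so that no root of an
  integral occurs. \<open>G\<close> is meant to vanish outside \<Omega>, so the balls are not
  intersected with \<Omega>.\<close>

definition morrey_le :: "real \<Rightarrow> real \<Rightarrow> real \<Rightarrow> (real^'n::finite) set \<Rightarrow> (real^'n \<Rightarrow> real) \<Rightarrow> bool" where
  "morrey_le d q \<sigma> \<Omega> G \<longleftrightarrow> (\<forall>x\<in>\<Omega>. \<forall>\<rho>. 0 < \<rho> \<and> \<rho> \<le> d \<longrightarrow>
     (\<integral>\<^sup>+y. indicator (ball x \<rho>) y * ennreal (G y powr q) \<partial>lborel) \<le> ennreal (\<rho> powr (real CARD('n) - \<sigma> * q)))"

lemma morrey_le_ball: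
  fixes G :: "real^'n::finite \<Rightarrow> real"
  assumes G: "morrey_le d q \<sigma> \<Omega> G" "\<And>x. x \<notin> \<Omega> \<Longrightarrow> G x = 0" and \<rho>: "2 * \<rho> \<le> \<rho>'" "0 < \<rho>'" "\<rho>' \<le> d"
  shows "(\<integral>\<^sup>+y. indicator (ball x \<rho>) y * ennreal (G y powr q) \<partial>lborel) \<le> ennreal (\<rho>' powr (real CARD('n) - \<sigma> * q))"
proof (cases "ball x \<rho> \<inter> \<Omega> = {}")
  case True
  then have "(\<integral>\<^sup>+y. indicator (ball x \<rho>) y * ennreal (G y powr q) \<partial>lborel) = (\<integral>\<^sup>+y. 0 \<partial>(lborel :: (real^'n) measure))"
    using G(2) by (intro nn_integral_cong) (auto simp: indicator_def disjoint_iff)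
  then show ?thesis by simp
next
  case False
  then obtain x' where x': "x' \<in> \<Omega>" "dist x x' < \<rho>" by auto
  have "ball x \<rho> \<subseteq> ball x' \<rho>'"
  proof
    fix y assume "y \<in> ball x \<rho>"
    then show "y \<in> ball x' \<rho>'" using x'(2) \<rho>(1) dist_triangle[of x' y x] by (simp add: dist_commute)
  qed
  then have "(\<integral>\<^sup>+y. indicator (ball x \<rho>) y * ennreal (G y powr q) \<partial>lborel) \<le> (\<integral>\<^sup>+y. indicator (ball x' \<rho>') y * ennreal (G y powr q) \<partial>lborel)"
    by (intro nn_integral_mono mult_right_mono) (auto simp: indicator_def)
  also have "\<dots> \<le> ennreal (\<rho>' powr (real CARD('n) - \<sigma> * q))"
    using G(1) x'(1) \<rho> unfolding morrey_le_def by blast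
  finally show ?thesis .
qed

text \<open>Splitting at the level \<open>R powr - \<sigma>\<close> makes both terms scale like
  \<open>R powr (n - \<sigma> * p)\<close> in dimension \<open>n\<close>. Since
  \<open>\<sigma> \<le> 1\<close> and \<open>R \<le> d\<close>, the exponent \<sigma> may be raised
  to 1 at the cost of a power of \<open>d\<close>.\<close>

lemma morrey_le_growth1:
  fixes G :: "real^'n::finite \<Rightarrow> real"
  assumes G: "morrey_le d q \<sigma> \<Omega> G" "\<And>x. x \<notin> \<Omega> \<Longrightarrow> G x = 0" "\<And>x. 0 \<le> G x" and [measurable]: "G \<in> borel_measurable borel"
    and p: "1 \<le> p" "p \<le> q" and \<sigma>: "\<sigma> \<le> 1" and t: "0 < t" "t \<le> 1/2" and d: "0 < d"
  shows "(\<integral>\<^sup>+y. indicator (ball x (d * t)) y * ennreal (G y powr p) \<partial>lborel) \<le>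
    ennreal ((1 + unit_ball_vol (real CARD('n))) * (2 * d) powr (real CARD('n) - p) * d powr ((1 - \<sigma>) * p) * t powr (real CARD('n) - 1 * p))"
proof -
  let ?n = "real CARD('n)" and ?v = "unit_ball_vol (real CARD('n))"
  define R where "R = 2 * (d * t)"
  have R: "0 < R" "R \<le> d" using d t by (auto simp: R_def)
  have "emeasure lborel (ball x (d * t)) \<le> ennreal (?v * R powr ?n)"
  proof -
    have "(d * t) ^ CARD('n) \<le> R ^ CARD('n)" using d t by (intro power_mono) (auto simp: R_def)
    then show ?thesis using d t R by (auto simp: emeasure_ball powr_realpow intro!: ennreal_leI mult_left_mono)
  qed
  then have "(\<integral>\<^sup>+y. indicator (ball x (d * t)) y * ennreal (G y powr p) \<partial>lborel) \<le>
     ennreal ((R powr - \<sigma>) powr (p - q) * R powr (?n - \<sigma> * q) + (R powr - \<sigma>) powr p * (?v * R powr ?n))"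
    using p R by (intro nn_integral_powr_split_le[OF _ _ G(3) _ _ _ morrey_le_ball[OF G(1,2)]]) (auto simp: R_def)
  also have "(R powr - \<sigma>) powr (p - q) * R powr (?n - \<sigma> * q) + (R powr - \<sigma>) powr p * (?v * R powr ?n) = (1 + ?v) * R powr (?n - \<sigma> * p)"
    using R by (simp add: powr_powr distrib_right mult.left_commute[of _ ?v] algebra_simps flip: powr_add)
  finally have le: "(\<integral>\<^sup>+y. indicator (ball x (d * t)) y * ennreal (G y powr p) \<partial>lborel) \<le> ennreal ((1 + ?v) * R powr (?n - \<sigma> * p))" .
  have "R powr (?n - \<sigma> * p) = R powr (?n - p) * R powr ((1 - \<sigma>) * p)"
    by (simp add: algebra_simps flip: powr_add)
  also have "\<dots> \<le> R powr (?n - p) * d powr ((1 - \<sigma>) * p)"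
    using R \<sigma> p by (intro mult_left_mono powr_mono2) auto
  also have "R powr (?n - p) = (2 * d) powr (?n - p) * t powr (?n - 1 * p)"
    using d t by (simp add: R_def powr_mult)
  finally have "(1 + ?v) * R powr (?n - \<sigma> * p) \<le> (1 + ?v) * ((2 * d) powr (?n - p) * t powr (?n - 1 * p) * d powr ((1 - \<sigma>) * p))"
    by (intro mult_left_mono) (auto intro: add_nonneg_nonneg)
  then show ?thesis
    using order_trans[OF le ennreal_leI] by (simp add: ac_simps)
qed

text \<open>The bound at radius \<open>d\<close> is kept for all smaller balls, so \<sigma> only
  enters the constant; in dimension \<open>n\<close> a splitting at the level
  \<open>R powr - (n / q)\<close> then plays the role of Hoelder's inequality and gives the growth
  exponent \<open>n / q\<close>.\<close>

lemma morrey_le_growth: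
  fixes G :: "real^'n::finite \<Rightarrow> real"
  assumes G: "morrey_le d q \<sigma> \<Omega> G" "\<And>x. x \<notin> \<Omega> \<Longrightarrow> G x = 0" "\<And>x. 0 \<le> G x" and [measurable]: "G \<in> borel_measurable borel"
    and p: "1 \<le> p" "p \<le> q" and t: "0 < t" "t \<le> 1/2" and d: "0 < d"
  shows "(\<integral>\<^sup>+y. indicator (ball x (d * t)) y * ennreal (G y powr p) \<partial>lborel) \<le>
    ennreal ((d powr (real CARD('n) - \<sigma> * q) + unit_ball_vol (real CARD('n))) * d powr (real CARD('n) - real CARD('n) / q * p)
       * t powr (real CARD('n) - real CARD('n) / q * p))"
proof -
  let ?n = "real CARD('n)" and ?v = "unit_ball_vol (real CARD('n))"
  define R where "R = d * t"
  have R: "0 < R" "2 * R \<le> d" using d t by (auto simp: R_def)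
  have q: "q > 0" using p by simp
  have "emeasure lborel (ball x R) \<le> ennreal (?v * R powr ?n)"
    using R by (auto simp: emeasure_ball powr_realpow)
  then have "(\<integral>\<^sup>+y. indicator (ball x R) y * ennreal (G y powr p) \<partial>lborel) \<le>
     ennreal ((R powr - (?n / q)) powr (p - q) * d powr (?n - \<sigma> * q) + (R powr - (?n / q)) powr p * (?v * R powr ?n))"
    using p R d by (intro nn_integral_powr_split_le[OF _ _ G(3) _ _ _ morrey_le_ball[OF G(1,2)]]) auto
  also have "(R powr - (?n / q)) powr (p - q) = R powr (?n - ?n / q * p)"
  proof -
    have "- (?n / q) * (p - q) = ?n - ?n / q * p" using q by (simp add: field_simps)
    then show ?thesis by (simp only: powr_powr)
  qed
  also have "(R powr - (?n / q)) powr p * (?v * R powr ?n) = ?v * R powr (?n - ?n / q * p)"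
    using R by (simp add: powr_powr algebra_simps flip: powr_add)
  also have "R powr (?n - ?n / q * p) * d powr (?n - \<sigma> * q) + ?v * R powr (?n - ?n / q * p) = (d powr (?n - \<sigma> * q) + ?v) * R powr (?n - ?n / q * p)"
    by (simp add: algebra_simps)
  also have "R powr (?n - ?n / q * p) = d powr (?n - ?n / q * p) * t powr (?n - ?n / q * p)"
    using d t by (simp add: R_def powr_mult)
  finally show ?thesis by (simp add: R_def ac_simps)
qed

section \<open>Bounds on one cone in terms of the Sobolev energy\<close>

definition multi_indices :: "nat \<Rightarrow> ('n::finite \<Rightarrow> nat) set" where
  "multi_indices r = {\<alpha>. sum \<alpha> UNIV \<le> r}"

lemma finite_multi_indices: "finite (multi_indices r :: ('n::finite \<Rightarrow> nat) set)"
proof (rule finite_subset)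
  have "\<alpha> k \<le> r" if "sum \<alpha> UNIV \<le> r" for \<alpha> :: "'n \<Rightarrow> nat" and k
    using member_le_sum[of k UNIV \<alpha>] that by auto
  then show "multi_indices r \<subseteq> (PiE UNIV (\<lambda>_. {..r}) :: ('n \<Rightarrow> nat) set)"
    by (auto simp: multi_indices_def)
  show "finite (PiE UNIV (\<lambda>_. {..r}) :: ('n \<Rightarrow> nat) set)" by (intro finite_PiE) auto
qed

text \<open>The function and its weak derivatives form one family, whose member at the zero
  multi-index is the function. All members live on the whole space, but derivatives are tested
  inside \<Omega> only.\<close>

definition Sobolev_data :: "nat \<Rightarrow> (real^'n::finite) set \<Rightarrow> (('n \<Rightarrow> nat) \<Rightarrow> real^'n \<Rightarrow> complex) \<Rightarrow> bool" where
  "Sobolev_data r \<Omega> V \<longleftrightarrow> (\<forall>\<alpha>\<in>multi_indices r. loc_int (V \<alpha>) \<and> wder \<Omega> \<alpha> (V (\<lambda>_. 0)) (V \<alpha>))"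

text \<open>The \<open>p\<close>-th power of the Sobolev norm, once the family represents a Sobolev
  function.\<close>

definition energy :: "nat \<Rightarrow> real \<Rightarrow> (('n::finite \<Rightarrow> nat) \<Rightarrow> real^'n \<Rightarrow> complex) \<Rightarrow> ennreal" where
  "energy r p V = (\<Sum>\<alpha>\<in>multi_indices r. Lpow p (V \<alpha>))"

lemma Lpow_le_energy: "\<alpha> \<in> multi_indices r \<Longrightarrow> Lpow p (V \<alpha>) \<le> energy r p V"
  unfolding energy_def by (intro member_le_sum finite_multi_indices) auto

lemma sum_le_energy:
  fixes V :: "('n::finite \<Rightarrow> nat) \<Rightarrow> real^'n \<Rightarrow> complex"
  assumes "\<And>i :: 'n. f i \<le> ennreal N * energy r p V" "N \<ge> 0"
  shows "(\<Sum>i\<in>UNIV. f i) \<le> ennreal (real CARD('n) * N) * energy r p V"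
proof -
  have "(\<Sum>i\<in>UNIV. f i) \<le> of_nat CARD('n) * (ennreal N * energy r p V)"
    using sum_bounded_above[of "UNIV :: 'n set" f "ennreal N * energy r p V"] assms(1) by simp
  then show ?thesis using assms(2) by (simp add: ennreal_of_nat_eq_real_of_nat ennreal_mult mult.assoc)
qed

context finite_cone
begin

lemma avg_half_bound:
  assumes [measurable]: "H \<in> borel_measurable borel" "f \<in> borel_measurable borel" and p: "1 \<le> p" and C: "C \<ge> 0"
    and HB: "\<And>y t. 0 < t \<Longrightarrow> t \<le> 1/2 \<Longrightarrow> (\<integral>\<^sup>+x. indicator (ball y (d * t)) x * H x \<partial>lborel) \<le> ennreal (C * t powr (real CARD('n) - e * p))"
  shows "(\<integral>\<^sup>+x. H x * epow (avg W (1/2) f x) p \<partial>lborel) \<le> ennreal ((1/2) powr (- (p * e)) * (\<omega> powr (p - 1) * C)) * (\<integral>\<^sup>+x. epow (f x) p \<partial>lborel)"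
  using nn_integral_avg_le_powr[OF _ _ W_borel W_ball \<omega>(1), of f H p "1/2" C e] HB[of "1/2"] p C \<omega>(2)
  by (simp add: ennreal_mult mult.assoc)

text \<open>Growth exponent 1 is available because \<open>\<sigma> \<le> 1\<close>, and it is below
  2, the limit tolerated by Taylor's formula of order two. For larger \<open>r\<close> the energy of
  order two is part of the energy of order \<open>r\<close>.\<close>

lemma cone_bound_second:
  assumes r: "r \<ge> 2" and p: "1 \<le> p" "p \<le> q" and \<sigma>: "\<sigma> \<le> 1"
  shows "\<exists>C\<ge>0. \<forall>G V. G \<in> borel_measurable borel \<longrightarrow> (\<forall>x. (0::real) \<le> G x) \<longrightarrow> (\<forall>x. x \<notin> \<Omega> \<longrightarrow> G x = 0) \<longrightarrow> morrey_le d q \<sigma> \<Omega> G \<longrightarrow>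
    Sobolev_data r \<Omega> V \<longrightarrow> (\<integral>\<^sup>+x. indicator D x * ennreal (G x powr p) * ennreal (norm (V (\<lambda>_. 0) x) powr p) \<partial>lborel) \<le> ennreal C * energy r p V"
proof -
  define Cg where "Cg = (1 + unit_ball_vol (real CARD('n))) * (2 * d) powr (real CARD('n) - p) * d powr ((1 - \<sigma>) * p)"
  have Cg: "Cg \<ge> 0" unfolding Cg_def by (auto intro!: mult_nonneg_nonneg add_nonneg_nonneg)
  define Ka where "Ka = (1/2) powr (- (p * 1)) * (\<omega> powr (p - 1) * Cg)"
  have Ka: "Ka \<ge> 0" using Cg by (simp add: Ka_def)
  obtain Kp where Kp: "Kp \<ge> 0" "\<And>f H. f \<in> borel_measurable borel \<Longrightarrow> H \<in> borel_measurable borel \<Longrightarrow>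
      (\<And>y t. 0 < t \<Longrightarrow> t \<le> 1/2 \<Longrightarrow> (\<integral>\<^sup>+x. indicator (ball y (d * t)) x * H x \<partial>lborel) \<le> ennreal (Cg * t powr (real CARD('n) - 1 * p))) \<Longrightarrow>
      (\<integral>\<^sup>+x. H x * epow (pot W {0<..<1/2} 1 f x) p \<partial>lborel) \<le> ennreal Kp * (\<integral>\<^sup>+x. epow (f x) p \<partial>lborel)"
    by (rule nn_integral_pot_le_powr[OF W_borel W_ball \<omega>(1) _ p(1) Cg, of 1 1]) (use \<omega>(2) in \<open>auto\<close>)
  show ?thesis
  proof (intro exI conjI allI impI)
    fix G :: "real^'n \<Rightarrow> real" and V
    assume [measurable]: "G \<in> borel_measurable borel" and G0: "\<forall>x. (0::real) \<le> G x" and G\<Omega>: "\<forall>x. x \<notin> \<Omega> \<longrightarrow> G x = 0" and GM: "morrey_le d q \<sigma> \<Omega> G"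
      and V: "Sobolev_data r \<Omega> V"
    have G: "\<And>x. x \<notin> \<Omega> \<Longrightarrow> G x = 0" "\<And>x. 0 \<le> G x" using G0 G\<Omega> by auto
    let ?H = "\<lambda>x. ennreal (G x powr p)"
    have HB: "(\<integral>\<^sup>+x. indicator (ball y (d * t)) x * ?H x \<partial>lborel) \<le> ennreal (Cg * t powr (real CARD('n) - 1 * p))" if "0 < t" "t \<le> 1/2" for y t
      unfolding Cg_def by (rule morrey_le_growth1[OF GM G]) (use that p \<sigma> d in auto)
    have mi: "(\<lambda>_. 0) \<in> multi_indices r" "unit_index i \<in> multi_indices r" "(\<lambda>k. unit_index i k + unit_index j k) \<in> multi_indices r" for i j :: 'n
      using r by (auto simp: multi_indices_def sum_unit_index sum.distrib)
    have *: "Lpow p (V \<alpha>) \<le> ennreal 1 * energy r p V" if "\<alpha> \<in> multi_indices r" for \<alpha>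
      using Lpow_le_energy[OF that, of p V] by simp
    show "(\<integral>\<^sup>+x. indicator D x * ?H x * ennreal (norm (V (\<lambda>_. 0) x) powr p) \<partial>lborel)
      \<le> ennreal (1 / \<kappa> powr p * ((2 / \<omega>) powr p * (Ka * (2 powr p * (\<omega> powr p + d powr p * (real CARD('n) powr p * \<omega> powr p * (real CARD('n) * 1))))
        + (d * d) powr p * (Kp * (real CARD('n) powr p * (real CARD('n) powr p * \<omega> powr p * (real CARD('n) * (real CARD('n) * 1)))))))) * energy r p V"
    proof (rule bound_second[where V = "\<lambda>i. V (unit_index i)" and VV = "\<lambda>i j. V (\<lambda>k. unit_index i k + unit_index j k)"])
      show "(\<integral>\<^sup>+x. ?H x * epow (avg W (1/2) f x) p \<partial>lborel) \<le> ennreal Ka * (\<integral>\<^sup>+x. epow (f x) p \<partial>lborel)" if "f \<in> borel_measurable borel" for f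
        unfolding Ka_def by (rule avg_half_bound[OF _ that p(1) Cg HB]) auto
      show "(\<integral>\<^sup>+x. ?H x * epow (pot W TT 1 f x) p \<partial>lborel) \<le> ennreal Kp * (\<integral>\<^sup>+x. epow (f x) p \<partial>lborel)" if "f \<in> borel_measurable borel" for f
        by (rule Kp(2)[OF that _ HB]) auto
      show "(\<Sum>i\<in>UNIV. Lpow p (V (unit_index i))) \<le> ennreal (real CARD('n) * 1) * energy r p V"
        by (intro sum_le_energy * mi) auto
      show "(\<Sum>i\<in>UNIV. \<Sum>j\<in>UNIV. Lpow p (V (\<lambda>k. unit_index i k + unit_index j k))) \<le> ennreal (real CARD('n) * (real CARD('n) * 1)) * energy r p V"
        by (intro sum_le_energy * mi) auto
      show "Lpow p (V (\<lambda>_. 0)) \<le> energy r p V" by (rule Lpow_le_energy[OF mi(1)])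
    qed (use V mi p Ka Kp(1) in \<open>auto simp: Sobolev_data_def\<close>)
  next
    show "0 \<le> 1 / \<kappa> powr p * ((2 / \<omega>) powr p * (Ka * (2 powr p * (\<omega> powr p + d powr p * (real CARD('n) powr p * \<omega> powr p * (real CARD('n) * 1))))
        + (d * d) powr p * (Kp * (real CARD('n) powr p * (real CARD('n) powr p * \<omega> powr p * (real CARD('n) * (real CARD('n) * 1)))))))"
      using Ka Kp(1) by (intro mult_nonneg_nonneg add_nonneg_nonneg) auto
  qed
qed

text \<open>In dimension \<open>n\<close> the growth exponent \<open>n / q\<close> is below 1 unless
  \<open>q = n\<close>, and then the dimension and both exponents are 1. The two cases feed a
  potential estimate of the same form into \<open>bound_first\<close>.\<close>

lemma cone_bound_first:
  assumes r: "r \<ge> 1" and p: "1 \<le> p" "p \<le> q" and q: "q \<ge> real CARD('n)" "q = real CARD('n) \<Longrightarrow> CARD('n) = 1 \<and> p = 1"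
  shows "\<exists>C\<ge>0. \<forall>G V. G \<in> borel_measurable borel \<longrightarrow> (\<forall>x. (0::real) \<le> G x) \<longrightarrow> (\<forall>x. x \<notin> \<Omega> \<longrightarrow> G x = 0) \<longrightarrow> morrey_le d q \<sigma> \<Omega> G \<longrightarrow>
    Sobolev_data r \<Omega> V \<longrightarrow> (\<integral>\<^sup>+x. indicator D x * ennreal (G x powr p) * ennreal (norm (V (\<lambda>_. 0) x) powr p) \<partial>lborel) \<le> ennreal C * energy r p V"
proof -
  define n where "n = real CARD('n)"
  define Cg where "Cg = (d powr (n - \<sigma> * q) + unit_ball_vol n) * d powr (n - n / q * p)"
  have Cg: "Cg \<ge> 0" unfolding Cg_def n_def by (auto intro!: mult_nonneg_nonneg add_nonneg_nonneg)
  define Ka where "Ka = (1/2) powr (- (p * (n / q))) * (\<omega> powr (p - 1) * Cg)"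
  have Ka: "Ka \<ge> 0" using Cg by (simp add: Ka_def)
  obtain Kp where Kp: "Kp \<ge> 0" "\<And>f H. f \<in> borel_measurable borel \<Longrightarrow> H \<in> borel_measurable borel \<Longrightarrow>
      (\<And>y t. 0 < t \<Longrightarrow> t \<le> 1/2 \<Longrightarrow> (\<integral>\<^sup>+x. indicator (ball y (d * t)) x * H x \<partial>lborel) \<le> ennreal (Cg * t powr (n - n / q * p))) \<Longrightarrow>
      (\<integral>\<^sup>+x. H x * epow (pot W TT 0 f x) p \<partial>lborel) \<le> ennreal Kp * (\<integral>\<^sup>+x. epow (f x) p \<partial>lborel)"
  proof (cases "q = n")
    case True
    then have one: "CARD('n) = 1" "p = 1" "q = 1" using q by (auto simp: n_def)
    define e where "e = norm c - a"
    have e: "e > 0" using a by (simp add: e_def)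
    show ?thesis
    proof (rule that)
      show "0 \<le> d / e * Cg" using d e Cg by simp
      fix f H :: "real^'n \<Rightarrow> ennreal" assume [measurable]: "f \<in> borel_measurable borel" "H \<in> borel_measurable borel"
        and HB: "\<And>y t. 0 < t \<Longrightarrow> t \<le> 1/2 \<Longrightarrow> (\<integral>\<^sup>+x. indicator (ball y (d * t)) x * H x \<partial>lborel) \<le> ennreal (Cg * t powr (n - n / q * p))"
      have "(\<integral>\<^sup>+x. H x * pot W TT 0 f x \<partial>lborel) \<le> ennreal (d / e) * ennreal Cg * (\<integral>\<^sup>+x. f x \<partial>lborel)"
      proof (rule nn_integral_pot_le_1[OF _ _ W_borel W_ball _ e])
        show "W \<inter> ball 0 e = {}" unfolding e_def by (rule W_disjnt)
        show "(\<integral>\<^sup>+x. indicator (ball y (d / 2)) x * H x \<partial>lborel) \<le> ennreal Cg" for y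
          using HB[of "1/2" y] one by (simp add: n_def)
      qed (use one d in auto)
      then show "(\<integral>\<^sup>+x. H x * epow (pot W TT 0 f x) p \<partial>lborel) \<le> ennreal (d / e * Cg) * (\<integral>\<^sup>+x. epow (f x) p \<partial>lborel)"
        unfolding one epow_1 using d e Cg by (simp add: ennreal_mult flip: times_divide_eq_left)
    qed
  next
    case False
    then have e: "real 0 \<le> n / q" "n / q < real 0 + 1" using q p by (auto simp: n_def)
    show ?thesis
      by (rule nn_integral_pot_le_powr[OF W_borel W_ball \<omega>(1) _ p(1) Cg e])
        (use \<omega>(2) that in \<open>auto simp: n_def\<close>)
  qed
  show ?thesis
  proof (intro exI conjI allI impI)
    fix G :: "real^'n \<Rightarrow> real" and V
    assume [measurable]: "G \<in> borel_measurable borel" and G0: "\<forall>x. (0::real) \<le> G x" and G\<Omega>: "\<forall>x. x \<notin> \<Omega> \<longrightarrow> G x = 0" and GM: "morrey_le d q \<sigma> \<Omega> G"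
      and V: "Sobolev_data r \<Omega> V"
    have G: "\<And>x. x \<notin> \<Omega> \<Longrightarrow> G x = 0" "\<And>x. 0 \<le> G x" using G0 G\<Omega> by auto
    let ?H = "\<lambda>x. ennreal (G x powr p)"
    have HB: "(\<integral>\<^sup>+x. indicator (ball y (d * t)) x * ?H x \<partial>lborel) \<le> ennreal (Cg * t powr (n - n / q * p))" if "0 < t" "t \<le> 1/2" for y t
      unfolding Cg_def n_def by (rule morrey_le_growth[OF GM G]) (use that p d in auto)
    have mi: "(\<lambda>_. 0) \<in> multi_indices r" "unit_index i \<in> multi_indices r" for i :: 'n
      using r by (auto simp: multi_indices_def sum_unit_index)
    have *: "Lpow p (V \<alpha>) \<le> ennreal 1 * energy r p V" if "\<alpha> \<in> multi_indices r" for \<alpha>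
      using Lpow_le_energy[OF that, of p V] by simp
    show "(\<integral>\<^sup>+x. indicator D x * ?H x * ennreal (norm (V (\<lambda>_. 0) x) powr p) \<partial>lborel)
      \<le> ennreal (1 / \<kappa> powr p * ((2 / \<omega>) powr p * (Ka * \<omega> powr p + d powr p * (Kp * (real CARD('n) powr p * \<omega> powr p * (real CARD('n) * 1)))))) * energy r p V"
    proof (rule bound_first[where V = "\<lambda>i. V (unit_index i)"])
      show "(\<integral>\<^sup>+x. ?H x * epow (avg W (1/2) f x) p \<partial>lborel) \<le> ennreal Ka * (\<integral>\<^sup>+x. epow (f x) p \<partial>lborel)" if "f \<in> borel_measurable borel" for f
        unfolding Ka_def by (rule avg_half_bound[OF _ that p(1) Cg HB[unfolded n_def], folded n_def]) auto
      show "(\<integral>\<^sup>+x. ?H x * epow (pot W TT 0 f x) p \<partial>lborel) \<le> ennreal Kp * (\<integral>\<^sup>+x. epow (f x) p \<partial>lborel)" if "f \<in> borel_measurable borel" for f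
        by (rule Kp(2)[OF that _ HB]) auto
      show "(\<Sum>i\<in>UNIV. Lpow p (V (unit_index i))) \<le> ennreal (real CARD('n) * 1) * energy r p V"
        by (intro sum_le_energy * mi) auto
      show "Lpow p (V (\<lambda>_. 0)) \<le> energy r p V" by (rule Lpow_le_energy[OF mi(1)])
    qed (use V mi p Ka Kp(1) in \<open>auto simp: Sobolev_data_def\<close>)
  next
    show "0 \<le> 1 / \<kappa> powr p * ((2 / \<omega>) powr p * (Ka * \<omega> powr p + d powr p * (Kp * (real CARD('n) powr p * \<omega> powr p * (real CARD('n) * 1)))))"
      using Ka Kp(1) by (intro mult_nonneg_nonneg add_nonneg_nonneg) auto
  qed
qed

text \<open>The growth exponent is exactly 1, where the weight in Jensen's inequality for
  \<open>t\<close> would be \<open>1 / t\<close> and fails to be integrable; the level set estimate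
  takes over.\<close>

lemma cone_bound_critical:
  assumes r: "r \<ge> 1" and p: "1 \<le> p" "p < real CARD('n)"
  shows "\<exists>C\<ge>0. \<forall>G V. G \<in> borel_measurable borel \<longrightarrow> (\<forall>x. (0::real) \<le> G x) \<longrightarrow> (\<forall>x. x \<notin> \<Omega> \<longrightarrow> G x = 0) \<longrightarrow> morrey_le d (real CARD('n)) \<sigma> \<Omega> G \<longrightarrow>
    Sobolev_data r \<Omega> V \<longrightarrow> (\<integral>\<^sup>+x. indicator D x * ennreal (G x powr p) * ennreal (norm (V (\<lambda>_. 0) x) powr p) \<partial>lborel) \<le> ennreal C * energy r p V"
proof -
  define A where "A = d powr (real CARD('n) - \<sigma> * real CARD('n))"
  have A: "A \<ge> 0" "real CARD('n) * 1 \<ge> 0" by (auto simp: A_def)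
  obtain C where C: "C \<ge> 0" "\<And>(G :: real^'n \<Rightarrow> real) U (V :: 'n \<Rightarrow> real^'n \<Rightarrow> complex) S. G \<in> borel_measurable borel \<Longrightarrow> (\<And>x. (0::real) \<le> G x) \<Longrightarrow>
    (\<And>z. (\<integral>\<^sup>+x. indicator (ball z (d / 2)) x * ennreal (G x powr real CARD('n)) \<partial>lborel) \<le> ennreal A) \<Longrightarrow>
    loc_int U \<Longrightarrow> (\<And>i. loc_int (V i)) \<Longrightarrow> (\<And>i. wder \<Omega> (unit_index i) U (V i)) \<Longrightarrow>
    Lpow p U \<le> S \<Longrightarrow> (\<Sum>i\<in>UNIV. Lpow p (V i)) \<le> ennreal (real CARD('n) * 1) * S \<Longrightarrow>
    (\<integral>\<^sup>+x. indicator D x * ennreal (G x powr p) * ennreal (norm (U x) powr p) \<partial>lborel) \<le> ennreal C * S"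
    by (rule bound_critical[OF p A]) blast
  show ?thesis
  proof (intro exI[of _ C] conjI allI impI C(1))
    fix G :: "real^'n \<Rightarrow> real" and V
    assume G: "G \<in> borel_measurable borel" and G0: "\<forall>x. (0::real) \<le> G x" and G\<Omega>: "\<forall>x. x \<notin> \<Omega> \<longrightarrow> G x = 0" and GM: "morrey_le d (real CARD('n)) \<sigma> \<Omega> G"
      and V: "Sobolev_data r \<Omega> V"
    have mi: "(\<lambda>_. 0) \<in> multi_indices r" "unit_index i \<in> multi_indices r" for i :: 'n
      using r by (auto simp: multi_indices_def sum_unit_index)
    have *: "Lpow p (V \<alpha>) \<le> ennreal 1 * energy r p V" if "\<alpha> \<in> multi_indices r" for \<alpha>
      using Lpow_le_energy[OF that, of p V] by simp
    show "(\<integral>\<^sup>+x. indicator D x * ennreal (G x powr p) * ennreal (norm (V (\<lambda>_. 0) x) powr p) \<partial>lborel) \<le> ennreal C * energy r p V"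
    proof (rule C(2)[of G "V (\<lambda>_. 0)" "\<lambda>i. V (unit_index i)", OF G])
      show "(\<integral>\<^sup>+x. indicator (ball z (d / 2)) x * ennreal (G x powr real CARD('n)) \<partial>lborel) \<le> ennreal A" for z
        unfolding A_def by (rule morrey_le_ball[OF GM]) (use G\<Omega> d in auto)
      show "(\<Sum>i\<in>UNIV. Lpow p (V (unit_index i))) \<le> ennreal (real CARD('n) * 1) * energy r p V"
        by (intro sum_le_energy * mi) auto
      show "Lpow p (V (\<lambda>_. 0)) \<le> energy r p V" by (rule Lpow_le_energy[OF mi(1)])
    qed (use V mi G0 in \<open>auto simp: Sobolev_data_def\<close>)
  qed
qed

lemma cone_bound:
  assumes r: "r \<ge> 1" and p: "1 \<le> p" "p \<le> q" and q: "q \<ge> real CARD('n) / real r"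
    and cr: "real CARD('n) / real r = p \<and> p > 1 \<Longrightarrow> q > real CARD('n) / real r" and \<sigma>: "\<sigma> \<le> 1"
  shows "\<exists>C\<ge>0. \<forall>G V. G \<in> borel_measurable borel \<longrightarrow> (\<forall>x. (0::real) \<le> G x) \<longrightarrow> (\<forall>x. x \<notin> \<Omega> \<longrightarrow> G x = 0) \<longrightarrow> morrey_le d q \<sigma> \<Omega> G \<longrightarrow>
    Sobolev_data r \<Omega> V \<longrightarrow> (\<integral>\<^sup>+x. indicator D x * ennreal (G x powr p) * ennreal (norm (V (\<lambda>_. 0) x) powr p) \<partial>lborel) \<le> ennreal C * energy r p V"
proof (cases "r \<ge> 2")
  case True
  then show ?thesis by (rule cone_bound_second[OF _ p \<sigma>])
next
  case False
  with r have r1: "r = 1" by simp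
  show ?thesis
  proof (cases "q = real CARD('n) \<and> p < real CARD('n)")
    case True
    then show ?thesis using cone_bound_critical[OF r p(1), of \<sigma>] by simp
  next
    case False
    \<comment> \<open>Here \<open>p = q = n\<close> for the dimension \<open>n\<close>, since
      \<open>p < n\<close> has been excluded and \<open>p \<le> q\<close>. The strict inequality
      required for \<open>n / r = p > 1\<close> then leaves only \<open>n = p = 1\<close>.\<close>
    have "CARD('n) = 1 \<and> p = 1" if qn: "q = real CARD('n)"
    proof -
      have "p = real CARD('n)" using False qn p by simp
      moreover from this have "\<not> p > 1" using cr qn r1 by auto
      then have "p = 1" using p(1) by linarith
      ultimately show ?thesis by simp
    qed
    then show ?thesis using cone_bound_first[OF r p] q r1 by simp
  qed
qed

end

section \<open>Finitely many cones for the whole open set\<close>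

text \<open>With the vertex at the origin, a cone of opening \<theta> and unit axis \<open>v\<close>
  contains the ball of radius \<open>sin \<theta>\<close> around \<open>v\<close>. It therefore also
  contains the cone over a smaller ball around any point of a sufficiently fine finite net of the
  sphere that is close to \<open>v\<close>.\<close>

lemma cone_cover:
  fixes \<Omega> :: "(real^'n::finite) set"
  assumes "open \<Omega>" "cone_condition d \<Omega>" "d > 0"
  obtains N a where "finite N" "\<And>c. c \<in> N \<Longrightarrow> finite_cone c a d \<Omega>" "\<Omega> \<subseteq> (\<Union>c\<in>N. finite_cone.D c a \<Omega>)"
proof -
  obtain \<theta> where \<theta>: "0 < \<theta>" "\<theta> < pi / 2" and cone: "\<And>x. x \<in> \<Omega> \<Longrightarrow> \<exists>C. is_cone \<theta> x C \<and> (\<forall>\<rho>. 0 < \<rho> \<and> \<rho> \<le> d \<longrightarrow> closure (C \<inter> ball x \<rho>) \<subseteq> \<Omega>)"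
    using assms(2) unfolding cone_condition_def by blast
  define s where "s = sin \<theta>"
  have s: "0 < s" "s < 1"
    using \<theta> sin_gt_zero2[of \<theta>] sin_monotone_2pi[of \<theta> "pi/2"] by (auto simp: s_def)
  \<comment> \<open>Relative to the length \<open>d / 2\<close> of the new axes the radius is
    \<open>s / 4\<close>; together with the mesh \<open>s / 2\<close> of the net it stays below
    \<open>s\<close>. Axes of length \<open>d / 2\<close> keep the balls within distance
    \<open>d\<close> of the vertex.\<close>
  define a where "a = d / 2 * (s / 4)"
  obtain N0 where N0: "N0 \<subseteq> sphere 0 1" "finite N0" "(sphere 0 1 :: (real^'n) set) \<subseteq> (\<Union>v\<in>N0. ball v (s / 2))"
    by (rule compactE_image[of "sphere 0 1 :: (real^'n) set" "sphere 0 1" "\<lambda>v. ball v (s / 2)"]) (use s in auto)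
  have fc: "finite_cone ((d / 2) *\<^sub>R v) a d \<Omega>" if "v \<in> N0" for v
  proof
    have n: "norm ((d / 2) *\<^sub>R v) = d / 2" using that N0(1) assms(3) by (auto simp: subset_eq)
    show "0 < a" using s assms(3) by (simp add: a_def)
    have "d / 2 * (s / 4) < d / 2 * 1" using s assms(3) by (intro mult_strict_left_mono) auto
    then show "a < norm ((d / 2) *\<^sub>R v)" "norm ((d / 2) *\<^sub>R v) + a < d" unfolding n a_def using assms(3) by linarith+
  qed (rule assms(1))
  have cover: "\<exists>v\<in>N0. x \<in> finite_cone.D ((d / 2) *\<^sub>R v) a \<Omega>" if x: "x \<in> \<Omega>" for x
  proof -
    obtain z b where zb: "b > 0" "norm (z - x) > b" "s = b / norm (z - x)" "closure (infinite_cone x z b \<inter> ball x d) \<subseteq> \<Omega>"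
      using cone[OF x] assms(3) unfolding is_cone_def s_def by blast
    define m where "m = norm (z - x)"
    have m: "m > 0" "b = s * m" using zb by (auto simp: m_def)
    define v where "v = (z - x) /\<^sub>R m"
    have "v \<in> sphere 0 1" using m by (simp add: v_def m_def)
    then obtain v' where v': "v' \<in> N0" "dist v' v < s / 2" using N0(3) by auto
    interpret finite_cone "(d / 2) *\<^sub>R v'" a d \<Omega> by (rule fc[OF v'(1)])
    have "x + t *\<^sub>R w \<in> \<Omega>" if t: "0 \<le> t" "t \<le> 1" and w: "w \<in> W" for t w
    proof (cases "t = 0")
      case False
      define w' where "w' = w /\<^sub>R (d / 2)"
      have ww: "w = (d / 2) *\<^sub>R w'" using assms(3) by (simp add: w'_def)
      have "norm (w - (d / 2) *\<^sub>R v') \<le> a" using w by (simp add: W_def dist_norm norm_minus_commute)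
      moreover have "norm (w - (d / 2) *\<^sub>R v') = d / 2 * norm (w' - v')"
        unfolding ww using assms(3) by (simp flip: scaleR_diff_right)
      ultimately have "norm (w' - v') \<le> s / 4" using assms(3) by (simp add: a_def)
      then have wv: "norm (w' - v) < s"
        using v'(2) norm_triangle_ineq[of "w' - v'" "v' - v"] s by (simp add: dist_norm)
      have "x + t *\<^sub>R w \<in> infinite_cone x z b"
      proof -
        \<comment> \<open>The rays through \<open>w\<close> and through
          \<open>m *\<^sub>R w'\<close> coincide, and the latter point, seen from \<open>x\<close>,
          lies in the ball around \<open>z\<close> that defines the cone.\<close>
        have eq: "m *\<^sub>R v = z - x" using m by (simp add: v_def)
        have "norm ((x + m *\<^sub>R w') - z) = norm (m *\<^sub>R (w' - v))" unfolding scaleR_diff_right eq by (simp add: algebra_simps)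
        also have "\<dots> < b" using wv m by (simp add: mult.commute)
        finally have "norm ((x + m *\<^sub>R w') - z) < b" .
        moreover have "x + t *\<^sub>R w = x + (t * (d / 2) / m) *\<^sub>R ((x + m *\<^sub>R w') - x)"
          using m by (simp add: ww)
        moreover have "t * (d / 2) / m > 0" using False t assms(3) m by simp
        ultimately show ?thesis unfolding infinite_cone_def by blast
      qed
      moreover have "x + t *\<^sub>R w \<in> ball x d"
      proof -
        have "norm w < d" using w W_ball by auto
        then have "\<bar>t\<bar> * norm w < d" using t mult_left_le_one_le[of "norm w" t] by auto
        then show ?thesis by (simp add: dist_norm)
      qed
      ultimately have "x + t *\<^sub>R w \<in> closure (infinite_cone x z b \<inter> ball x d)" by (intro closure_subset[THEN subsetD]) auto
      then show ?thesis using zb(4) by blast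
    qed (use x in simp)
    then have "x \<in> D" by (auto simp: D_def)
    then show ?thesis using v'(1) by blast
  qed
  show ?thesis
    by (rule that[of "(\<lambda>v. (d / 2) *\<^sub>R v) ` N0" a]) (use N0(2) fc cover in auto)
qed

text \<open>The sets \<open>D\<close> of the finitely many cones cover \<Omega>, and
  \<open>G\<close> vanishes elsewhere, so the bounds on the single sets are added.\<close>

lemma Sobolev_data_bound:
  fixes \<Omega> :: "(real^'n::finite) set"
  assumes d: "d > 0" and \<Omega>: "open \<Omega>" "cone_condition d \<Omega>" and r: "r \<ge> 1" and p: "1 \<le> p" "p \<le> q" and q: "q \<ge> real CARD('n) / real r"
    and cr: "real CARD('n) / real r = p \<and> p > 1 \<Longrightarrow> q > real CARD('n) / real r" and \<sigma>: "\<sigma> \<le> 1"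
  shows "\<exists>C\<ge>0. \<forall>G V. G \<in> borel_measurable borel \<longrightarrow> (\<forall>x. (0::real) \<le> G x) \<longrightarrow> (\<forall>x. x \<notin> \<Omega> \<longrightarrow> G x = 0) \<longrightarrow> morrey_le d q \<sigma> \<Omega> G \<longrightarrow>
    Sobolev_data r \<Omega> V \<longrightarrow> (\<integral>\<^sup>+x. ennreal (G x powr p) * ennreal (norm (V (\<lambda>_. 0) x) powr p) \<partial>lborel) \<le> ennreal C * energy r p V"
proof -
  obtain N a where N: "finite N" "\<And>c. c \<in> N \<Longrightarrow> finite_cone c a d \<Omega>" "\<Omega> \<subseteq> (\<Union>c\<in>N. finite_cone.D c a \<Omega>)"
    using cone_cover[OF \<Omega> d] by metis
  have "\<forall>c\<in>N. \<exists>C\<ge>0. \<forall>G V. G \<in> borel_measurable borel \<longrightarrow> (\<forall>x. (0::real) \<le> G x) \<longrightarrow> (\<forall>x. x \<notin> \<Omega> \<longrightarrow> G x = 0) \<longrightarrow> morrey_le d q \<sigma> \<Omega> G \<longrightarrow>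
    Sobolev_data r \<Omega> V \<longrightarrow> (\<integral>\<^sup>+x. indicator (finite_cone.D c a \<Omega>) x * ennreal (G x powr p) * ennreal (norm (V (\<lambda>_. 0) x) powr p) \<partial>lborel) \<le> ennreal C * energy r p V"
    using finite_cone.cone_bound[OF N(2) r p q cr \<sigma>] by blast
  then obtain C where C: "\<And>c. c \<in> N \<Longrightarrow> C c \<ge> 0" "\<And>c G V. c \<in> N \<Longrightarrow> G \<in> borel_measurable borel \<Longrightarrow> (\<forall>x. (0::real) \<le> G x) \<Longrightarrow> (\<forall>x. x \<notin> \<Omega> \<longrightarrow> G x = 0) \<Longrightarrow> morrey_le d q \<sigma> \<Omega> G \<Longrightarrow>
    Sobolev_data r \<Omega> V \<Longrightarrow> (\<integral>\<^sup>+x. indicator (finite_cone.D c a \<Omega>) x * ennreal (G x powr p) * ennreal (norm (V (\<lambda>_. 0) x) powr p) \<partial>lborel) \<le> ennreal (C c) * energy r p V"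
    by (subst (asm) bchoice_iff) blast
  show ?thesis
  proof (intro exI[of _ "\<Sum>c\<in>N. C c"] conjI allI impI sum_nonneg C(1))
    fix G :: "real^'n \<Rightarrow> real" and V
    assume G [measurable]: "G \<in> borel_measurable borel" and G0: "\<forall>x. (0::real) \<le> G x" and G\<Omega>: "\<forall>x. x \<notin> \<Omega> \<longrightarrow> G x = 0" and GM: "morrey_le d q \<sigma> \<Omega> G"
      and V: "Sobolev_data r \<Omega> V"
    have "(\<lambda>_. 0) \<in> (multi_indices r :: ('n \<Rightarrow> nat) set)" by (simp add: multi_indices_def)
    then have [measurable]: "V (\<lambda>_. 0) \<in> borel_measurable borel" using V by (auto simp: Sobolev_data_def loc_int_def)
    let ?h = "\<lambda>x. ennreal (G x powr p) * ennreal (norm (V (\<lambda>_. 0) x) powr p)"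
    have "(\<integral>\<^sup>+x. ?h x \<partial>lborel) \<le> (\<integral>\<^sup>+x. (\<Sum>c\<in>N. indicator (finite_cone.D c a \<Omega>) x * ?h x) \<partial>lborel)"
    proof (rule nn_integral_mono)
      fix x
      show "?h x \<le> (\<Sum>c\<in>N. indicator (finite_cone.D c a \<Omega>) x * ?h x)"
      proof (cases "x \<in> \<Omega>")
        case True
        then obtain c where "c \<in> N" "x \<in> finite_cone.D c a \<Omega>" using N(3) by auto
        then show ?thesis using member_le_sum[of c N "\<lambda>c. indicator (finite_cone.D c a \<Omega>) x * ?h x"] N(1) by auto
      qed (use G\<Omega> in simp)
    qed
    also have "\<dots> = (\<Sum>c\<in>N. \<integral>\<^sup>+x. indicator (finite_cone.D c a \<Omega>) x * ?h x \<partial>lborel)"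
    proof (rule nn_integral_sum)
      fix c assume "c \<in> N"
      then have [measurable]: "finite_cone.D c a \<Omega> \<in> sets borel" using finite_cone.D_borel[OF N(2)] by blast
      show "(\<lambda>x. indicator (finite_cone.D c a \<Omega>) x * ?h x) \<in> borel_measurable lborel" by measurable
    qed
    also have "\<dots> \<le> (\<Sum>c\<in>N. ennreal (C c) * energy r p V)"
      using C(2)[OF _ G G0 G\<Omega> GM V] by (intro sum_mono) (simp add: mult.assoc)
    also have "\<dots> = ennreal (\<Sum>c\<in>N. C c) * energy r p V"
      using C(1) by (simp add: sum_distrib_right[symmetric])
    finally show "(\<integral>\<^sup>+x. ?h x \<partial>lborel) \<le> ennreal (\<Sum>c\<in>N. C c) * energy r p V" .
  qed
qed

section \<open>Borel representatives and uniqueness of weak derivatives\<close>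

lemma borel_measurable_cprodf:
  assumes "\<And>k. bump1 (l $ k) (u $ k) (F k)" shows "cprodf F \<in> borel_measurable borel"
proof -
  have [measurable]: "prodf F \<in> borel_measurable borel" by (rule borel_measurable_prodf[OF assms])
  show ?thesis unfolding cprodf_def[abs_def] by measurable
qed

text \<open>Tonelli's theorem and substitutions are applied to Borel functions under
  \<open>lborel\<close>, whereas the spaces consist of Lebesgue measurable functions on \<Omega>. As
  representatives vanish outside \<Omega>, integrals over \<Omega> become integrals over the whole
  space.\<close>

definition borel_rep :: "'a::euclidean_space set \<Rightarrow> ('a \<Rightarrow> complex) \<Rightarrow> ('a \<Rightarrow> complex) \<Rightarrow> bool" where
  "borel_rep \<Omega> u U \<longleftrightarrow> u \<in> borel_measurable (lebesgue_on \<Omega>) \<and> U \<in> borel_measurable borel \<and>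
     (\<forall>x. x \<notin> \<Omega> \<longrightarrow> U x = 0) \<and> (AE x in lborel. x \<in> \<Omega> \<longrightarrow> U x = u x)"

lemma borel_rep_exists:
  fixes u :: "'a::euclidean_space \<Rightarrow> complex"
  assumes u: "u \<in> borel_measurable (lebesgue_on \<Omega>)" and \<Omega>: "\<Omega> \<in> sets borel"
  obtains U where "borel_rep \<Omega> u U"
proof -
  define f where "f x = (if x \<in> \<Omega> then u x else 0)" for x
  have f: "f \<in> borel_measurable lebesgue"
    unfolding f_def using borel_measurable_if_I[OF u] \<Omega> by (simp add: sets_completionI_sets)
  have "(\<lambda>x. Re (f x)) \<in> borel_measurable lebesgue" "(\<lambda>x. Im (f x)) \<in> borel_measurable lebesgue"
    using f by measurable
  then obtain g1 g2 where g: "g1 \<in> borel_measurable lborel" "AE x in lborel. Re (f x) = g1 x"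
      "g2 \<in> borel_measurable lborel" "AE x in lborel. Im (f x) = g2 x"
    using completion_ex_borel_measurable_real by metis
  have [measurable]: "g1 \<in> borel_measurable borel" "g2 \<in> borel_measurable borel" "\<Omega> \<in> sets borel" using g \<Omega> by auto
  define U where "U x = indicator \<Omega> x *\<^sub>R (complex_of_real (g1 x) + \<i> * complex_of_real (g2 x))" for x
  show ?thesis
  proof (rule that)
    have "AE x in lborel. x \<in> \<Omega> \<longrightarrow> U x = u x"
      using g(2,4) by eventually_elim (auto simp: U_def f_def complex_eq_iff)
    moreover have "U \<in> borel_measurable borel" unfolding U_def by measurable
    ultimately show "borel_rep \<Omega> u U" using u by (auto simp: borel_rep_def U_def)
  qed
qed

lemma lebesgue_on_transfer:
  fixes f :: "'a::euclidean_space \<Rightarrow> 'b::euclidean_space"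
  assumes \<Omega>: "\<Omega> \<in> sets borel" and F: "F \<in> borel_measurable borel" "\<And>x. x \<notin> \<Omega> \<Longrightarrow> F x = 0"
    and f: "f \<in> borel_measurable (lebesgue_on \<Omega>)" and ae: "AE x in lborel. x \<in> \<Omega> \<longrightarrow> F x = f x"
  shows "(LINT x|lebesgue_on \<Omega>. f x) = (LINT x|lborel. F x)"
    and "integrable (lebesgue_on \<Omega>) f \<longleftrightarrow> integrable lborel F"
proof -
  have \<Omega>': "\<Omega> \<inter> space lebesgue \<in> sets lebesgue" using \<Omega> by (simp add: sets_completionI_sets)
  have eq: "indicator \<Omega> x *\<^sub>R f x = (if x \<in> \<Omega> then f x else 0)" for x by simp
  have m: "(\<lambda>x. indicator \<Omega> x *\<^sub>R f x) \<in> borel_measurable lebesgue"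
    unfolding eq using borel_measurable_if_I[OF f] \<Omega>' by simp
  have FL: "F \<in> borel_measurable lebesgue" using F(1) by (simp add: measurable_completion)
  have ae': "AE x in lebesgue. indicator \<Omega> x *\<^sub>R f x = F x"
    unfolding AE_completion_iff using ae by eventually_elim (use F(2) in \<open>auto simp: indicator_def\<close>)
  have "(LINT x|lebesgue_on \<Omega>. f x) = (LINT x|lebesgue. indicator \<Omega> x *\<^sub>R f x)"
    by (rule integral_restrict_space[OF \<Omega>'])
  also have "\<dots> = (LINT x|lebesgue. F x)" by (rule integral_cong_AE[OF m FL ae'])
  also have "\<dots> = (LINT x|lborel. F x)" using F(1) by (intro integral_completion) simp
  finally show "(LINT x|lebesgue_on \<Omega>. f x) = (LINT x|lborel. F x)" .
  have "integrable (lebesgue_on \<Omega>) f \<longleftrightarrow> integrable lebesgue (\<lambda>x. indicator \<Omega> x *\<^sub>R f x)"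
    by (rule integrable_restrict_space[OF \<Omega>'])
  also have "\<dots> \<longleftrightarrow> integrable lebesgue F" by (rule integrable_cong_AE[OF m FL ae'])
  also have "\<dots> \<longleftrightarrow> integrable lborel F" using F(1) by (intro integrable_completion) simp
  finally show "integrable (lebesgue_on \<Omega>) f \<longleftrightarrow> integrable lborel F" .
qed

lemma borel_rep_Lp:
  assumes \<Omega>: "\<Omega> \<in> sets borel" and U: "borel_rep \<Omega> u U" and p: "p > 0"
  shows "u \<in> Lp p \<Omega> \<longleftrightarrow> Lpow p U < top"
    and "u \<in> Lp p \<Omega> \<Longrightarrow> Lpow p U = ennreal (Lp_norm p \<Omega> u powr p)"
proof -
  have [measurable]: "U \<in> borel_measurable borel" and u: "u \<in> borel_measurable (lebesgue_on \<Omega>)"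
    using U by (auto simp: borel_rep_def)
  have f: "(\<lambda>x. norm (u x) powr p) \<in> borel_measurable (lebesgue_on \<Omega>)" using u by measurable
  have ae: "AE x in lborel. x \<in> \<Omega> \<longrightarrow> norm (U x) powr p = norm (u x) powr p"
  proof -
    have "AE x in lborel. x \<in> \<Omega> \<longrightarrow> U x = u x" using U by (simp add: borel_rep_def)
    then show ?thesis by eventually_elim auto
  qed
  note t = lebesgue_on_transfer[OF \<Omega> _ _ f ae]
  have t1: "(LINT x|lebesgue_on \<Omega>. norm (u x) powr p) = (LINT x|lborel. norm (U x) powr p)"
    and t2: "integrable (lebesgue_on \<Omega>) (\<lambda>x. norm (u x) powr p) \<longleftrightarrow> integrable lborel (\<lambda>x. norm (U x) powr p)"
    by (rule t; use U p in \<open>simp add: borel_rep_def\<close>)+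
  show 1: "u \<in> Lp p \<Omega> \<longleftrightarrow> Lpow p U < top"
    unfolding Lp_def Lpow_def using t2 u by (simp add: integrable_iff_bounded)
  assume "u \<in> Lp p \<Omega>"
  then have int: "integrable lborel (\<lambda>x. norm (U x) powr p)" using t2 by (simp add: Lp_def)
  have "Lpow p U = ennreal (LINT x|lborel. norm (U x) powr p)"
    unfolding Lpow_def using int by (intro nn_integral_eq_integral) auto
  also have "(LINT x|lborel. norm (U x) powr p) = Lp_norm p \<Omega> u powr p"
    unfolding Lp_norm_def t1 using p by (simp add: powr_powr)
  finally show "Lpow p U = ennreal (Lp_norm p \<Omega> u powr p)" .
qed

lemma Lp_norm_nonneg: "0 \<le> Lp_norm p \<Omega> u" by (simp add: Lp_norm_def)

text \<open>By \<open>z \<le> 1 + z powr p\<close> for \<open>z \<ge> 0\<close>; the constant 1 is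
  integrable over a ball.\<close>

lemma loc_int_Lpow:
  fixes U :: "'a::euclidean_space \<Rightarrow> complex"
  assumes U: "U \<in> borel_measurable borel" "Lpow p U < top" and p: "1 \<le> p"
  shows "loc_int U"
  unfolding loc_int_def
proof (intro conjI allI U(1))
  fix r
  have [measurable]: "U \<in> borel_measurable borel" by (rule U(1))
  have "(\<integral>\<^sup>+x. ennreal (norm (indicator (cball 0 r) x *\<^sub>R U x)) \<partial>lborel) \<le> (\<integral>\<^sup>+x. indicator (cball 0 r) x + ennreal (norm (U x) powr p) \<partial>lborel)"
  proof (rule nn_integral_mono)
    fix x
    have "norm (U x) \<le> 1 + norm (U x) powr p"
    proof (cases "norm (U x) \<le> 1")
      case False
      then have "norm (U x) powr 1 \<le> norm (U x) powr p" using p by (intro powr_mono) auto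
      then show ?thesis using False by simp
    qed (simp add: add_increasing2)
    then have "ennreal (norm (U x)) \<le> ennreal (1 + norm (U x) powr p)" by (rule ennreal_leI)
    then show "ennreal (norm (indicator (cball 0 r) x *\<^sub>R U x)) \<le> indicator (cball 0 r) x + ennreal (norm (U x) powr p)"
      by (auto simp: indicator_def)
  qed
  also have "\<dots> = emeasure lborel (cball (0 :: 'a) r) + Lpow p U"
    unfolding Lpow_def by (simp add: nn_integral_add)
  also have "\<dots> < top" using U(2) emeasure_bounded_finite[OF bounded_cball, of "0 :: 'a" r] by (simp add: less_top)
  finally show "integrable lborel (\<lambda>x. indicator (cball 0 r) x *\<^sub>R U x)"
    by (simp add: integrable_iff_bounded)
qed

lemma wder_borel_rep:
  fixes \<Omega> :: "(real^'n::finite) set"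
  assumes \<Omega>: "open \<Omega>" and w: "has_weak_derivative \<Omega> \<alpha> u v" and U: "borel_rep \<Omega> u U" and V: "borel_rep \<Omega> v V"
  shows "wder \<Omega> \<alpha> U V"
  unfolding wder_def
proof (intro allI impI, elim conjE)
  fix F l r assume F: "\<forall>k. bump1 (l $ k) (r $ k) (F k)" and sub: "cbox l r \<subseteq> \<Omega>"
  have sm: "\<And>k. smooth1 (F k)" using F by (auto simp: bump1_def)
  have t: "test_function \<Omega> (cprodf F)" by (rule test_function_cprodf[OF _ sub]) (use F in auto)
  have F': "\<And>k. bump1 (l $ k) (r $ k) ((deriv ^^ \<alpha> k) (F k))" using F by (auto intro: bump1_funpow_deriv)
  have tr: "(LINT x|lebesgue_on \<Omega>. f x * cprodf E x) = (LINT x|lborel. f' x * cprodf E x)"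
    if E: "\<And>k. bump1 (l $ k) (r $ k) (E k)" and f: "borel_rep \<Omega> f f'" for E f f'
  proof (rule lebesgue_on_transfer(1))
    have E': "cprodf E \<in> borel_measurable borel"
      by (rule borel_measurable_cprodf[OF E])
    have "f' \<in> borel_measurable borel" using f by (simp add: borel_rep_def)
    then show "(\<lambda>x. f' x * cprodf E x) \<in> borel_measurable borel" using E' by measurable
    have "cprodf E \<in> borel_measurable (lebesgue_on \<Omega>)"
      using E' by (simp add: measurable_completion measurable_restrict_space1)
    moreover have "f \<in> borel_measurable (lebesgue_on \<Omega>)" using f by (simp add: borel_rep_def)
    ultimately show "(\<lambda>x. f x * cprodf E x) \<in> borel_measurable (lebesgue_on \<Omega>)"
      by (intro borel_measurable_times)
    have "AE x in lborel. x \<in> \<Omega> \<longrightarrow> f' x = f x" using f by (simp add: borel_rep_def)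
    then show "AE x in lborel. x \<in> \<Omega> \<longrightarrow> f' x * cprodf E x = f x * cprodf E x" by eventually_elim auto
  qed (use \<Omega> f in \<open>auto simp: borel_rep_def\<close>)
  have "(LINT x|lebesgue_on \<Omega>. u x * multi_partial \<alpha> (cprodf F) x) = (-1) ^ sum \<alpha> UNIV * (LINT x|lebesgue_on \<Omega>. v x * cprodf F x)"
    using w t unfolding has_weak_derivative_def by blast
  then show "(LINT y|lborel. U y * cprodf (\<lambda>k. (deriv ^^ \<alpha> k) (F k)) y) = (-1) ^ sum \<alpha> UNIV * (LINT y|lborel. V y * cprodf F y)"
    unfolding multi_partial_cprodf[OF sm] using tr[OF F' U] tr[OF _ V, of F] F by simp
qed

section \<open>Uniqueness of weak derivatives\<close>

text \<open>The fundamental lemma of the calculus of variations, for products. At points of the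
  smaller ball the mollified values are pairings with admissible products, hence 0, and they
  converge almost everywhere to a positive multiple of \<open>f\<close>.\<close>

lemma AE_eq_0_if_tests_vanish:
  fixes f :: "real^'n::finite \<Rightarrow> complex"
  assumes f: "integrable lborel f" and \<rho>: "\<rho> > 0"
    and t: "\<And>F l u. (\<And>k. bump1 (l $ k) (u $ k) (F k)) \<Longrightarrow> cbox l u \<subseteq> cball c \<rho> \<Longrightarrow> (LINT y|lborel. f y * cprodf F y) = 0"
  shows "AE x in lborel. x \<in> ball c (\<rho> / 2) \<longrightarrow> f x = 0"
proof -
  define l u :: "real^'n" where "l = (\<chi> k. 0)" and "u = (\<chi> k. 1)"
  obtain R where R: "R > 0" "\<And>w. w \<in> cbox l u \<Longrightarrow> norm w \<le> R"
    using bounded_cbox[of l u] unfolding bounded_pos by blast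
  \<comment> \<open>At scales up to this bound the kernel reaches at most \<open>\<rho> / 2\<close>
    far, so supports around points of the smaller ball remain in the larger one.\<close>
  have "\<rho> / (2 * R) > 0" using \<rho> R by simp
  then obtain \<tau> :: "nat \<Rightarrow> real" where \<tau>: "\<And>i. 0 < \<tau> i" "\<And>i. \<tau> i \<le> \<rho> / (2 * R)"
    "AE x in lborel. (\<lambda>i. smear l u (\<tau> i) f x) \<longlonglongrightarrow> (LINT w|lborel. kern l u w) *\<^sub>R f x"
    by (rule smear_tendsto_AE[OF f, of _ l u]) blast
  have [measurable]: "f \<in> borel_measurable borel" using f by auto
  have zero: "smear l u (\<tau> i) f x = 0" if x: "x \<in> ball c (\<rho> / 2)" for i x
  proof -
    have "cbox (x + \<tau> i *\<^sub>R l) (x + \<tau> i *\<^sub>R u) \<subseteq> cball c \<rho>"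
    proof
      fix z assume z: "z \<in> cbox (x + \<tau> i *\<^sub>R l) (x + \<tau> i *\<^sub>R u)"
      have w: "(z - x) /\<^sub>R \<tau> i \<in> cbox l u" using z \<tau>(1)[of i] by (auto simp: mem_box_cart field_simps)
      have "norm (z - x) = \<tau> i * norm ((z - x) /\<^sub>R \<tau> i)" using \<tau>(1)[of i] by simp
      also have "\<dots> \<le> (\<rho> / (2 * R)) * R" using R(1) R(2)[OF w] \<tau>(1)[of i] \<tau>(2)[of i] by (intro mult_mono) auto
      also have "\<dots> = \<rho> / 2" using R(1) by simp
      finally have "dist x z \<le> \<rho> / 2" by (simp add: dist_norm norm_minus_commute)
      then show "z \<in> cball c \<rho>" using x dist_triangle[of c z x] by simp
    qed
    then have "(LINT y|lborel. f y * cprodf (scalef (bumps l u) x (\<tau> i)) y) = 0"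
      by (rule t[OF bump1_scalef[OF bump1_bumps \<tau>(1)]])
    then show ?thesis by (simp add: smear_eq \<tau>(1))
  qed
  have \<kappa>: "(LINT w|lborel. kern l u w) > 0" by (rule integral_kern_pos) (simp add: l_def u_def)
  show ?thesis using \<tau>(3)
  proof eventually_elim
    case (elim x)
    show ?case
    proof
      assume "x \<in> ball c (\<rho> / 2)"
      then have "(\<lambda>i. 0) \<longlonglongrightarrow> (LINT w|lborel. kern l u w) *\<^sub>R f x" using elim zero by simp
      then have "(LINT w|lborel. kern l u w) *\<^sub>R f x = 0" by (simp add: LIMSEQ_const_iff)
      then show "f x = 0" using \<kappa> by simp
    qed
  qed
qed

text \<open>\<open>weak_derivative\<close> is an arbitrary choice and not necessarily the derivative
  found in \<open>Lp\<close>; uniqueness identifies the two up to null sets. The difference is shown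
  to vanish on small balls, countably many of which cover \<Omega> by Lindeloef's theorem.\<close>

lemma has_weak_derivative_unique:
  fixes \<Omega> :: "(real^'n::finite) set"
  assumes \<Omega>: "open \<Omega>" and v: "has_weak_derivative \<Omega> \<alpha> u v" "has_weak_derivative \<Omega> \<alpha> u v'"
  shows "AE x in lborel. x \<in> \<Omega> \<longrightarrow> v x = v' x"
proof -
  have local: "\<exists>r>0. AE x in lborel. x \<in> ball c r \<longrightarrow> v x = v' x" if c: "c \<in> \<Omega>" for c
  proof -
    obtain \<rho> where \<rho>: "\<rho> > 0" "cball c \<rho> \<subseteq> \<Omega>" using \<Omega> c open_contains_cball by blast
    let ?K = "cball c \<rho>"
    have int: "integrable lebesgue (\<lambda>x. indicator ?K x *\<^sub>R v x)" "integrable lebesgue (\<lambda>x. indicator ?K x *\<^sub>R v' x)"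
      using v \<rho>(2) by (auto simp: has_weak_derivative_def locally_integrable_def set_integrable_def)
    define w where "w x = indicator ?K x *\<^sub>R v x - indicator ?K x *\<^sub>R v' x" for x
    have w: "integrable lebesgue w" unfolding w_def by (intro Bochner_Integration.integrable_diff int)
    then have "w \<in> borel_measurable (lebesgue_on UNIV)" by (simp add: lebesgue_on_UNIV_eq)
    then obtain f where f: "borel_rep UNIV w f" by (rule borel_rep_exists) simp
    have fm: "f \<in> borel_measurable borel" "w \<in> borel_measurable (lebesgue_on UNIV)" "AE x in lborel. f x = w x" using f by (auto simp: borel_rep_def)
    have fint: "integrable lborel f"
      using lebesgue_on_transfer(2)[of UNIV f w] fm w by (simp add: lebesgue_on_UNIV_eq)
    have "AE x in lborel. x \<in> ball c (\<rho> / 2) \<longrightarrow> f x = 0"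
    proof (rule AE_eq_0_if_tests_vanish[OF fint \<rho>(1)])
      fix F and l r :: "real^'n" assume F: "\<And>k. bump1 (l $ k) (r $ k) (F k)" and sub: "cbox l r \<subseteq> ?K"
      have t: "test_function \<Omega> (cprodf F)" by (rule test_function_cprodf[OF F]) (use sub \<rho>(2) in auto)
      have Fm: "cprodf F \<in> borel_measurable borel"
        by (rule borel_measurable_cprodf[OF F])
      then have Fl: "cprodf F \<in> borel_measurable lebesgue" by (simp add: measurable_completion)
      obtain B where B: "B > 0" "\<And>y. \<bar>prodf F y\<bar> \<le> B" using prodf_bounded[OF F] by metis
      have bounded_int: "integrable lebesgue (\<lambda>x. (indicator ?K x *\<^sub>R z x) * cprodf F x)"
        if "integrable lebesgue (\<lambda>x. indicator ?K x *\<^sub>R z x)" for z :: "real^'n \<Rightarrow> complex"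
      proof (rule Bochner_Integration.integrable_bound)
        show "integrable lebesgue (\<lambda>x. B *\<^sub>R (indicator ?K x *\<^sub>R z x))" by (rule integrable_scaleR_right[OF that])
        show "(\<lambda>x. (indicator ?K x *\<^sub>R z x) * cprodf F x) \<in> borel_measurable lebesgue"
          using borel_measurable_integrable[OF that] Fl by (rule borel_measurable_times)
        show "AE x in lebesgue. norm ((indicator ?K x *\<^sub>R z x) * cprodf F x) \<le> norm (B *\<^sub>R (indicator ?K x *\<^sub>R z x))"
        proof (rule AE_I2)
          fix x
          have "norm (indicator ?K x *\<^sub>R z x) * norm (cprodf F x) \<le> norm (indicator ?K x *\<^sub>R z x) * B"
            using B(2)[of x] by (intro mult_left_mono) (auto simp: cprodf_def)
          then show "norm ((indicator ?K x *\<^sub>R z x) * cprodf F x) \<le> norm (B *\<^sub>R (indicator ?K x *\<^sub>R z x))"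
            using B(1) by (simp only: norm_mult norm_scaleR) (simp add: mult.commute)
        qed
      qed
      have \<Omega>s: "\<Omega> \<inter> space lebesgue \<in> sets lebesgue" using \<Omega> by (simp add: sets_completionI_sets)
      have restr: "(LINT x|lebesgue_on \<Omega>. z x * cprodf F x) = (LINT x|lebesgue. (indicator ?K x *\<^sub>R z x) * cprodf F x)" for z
      proof -
        have "(LINT x|lebesgue_on \<Omega>. z x * cprodf F x) = (LINT x|lebesgue. indicator \<Omega> x *\<^sub>R (z x * cprodf F x))"
          by (rule integral_restrict_space[OF \<Omega>s])
        also have "\<dots> = (LINT x|lebesgue. (indicator ?K x *\<^sub>R z x) * cprodf F x)"
        proof (intro Bochner_Integration.integral_cong refl)
          fix x
          show "indicator \<Omega> x *\<^sub>R (z x * cprodf F x) = (indicator ?K x *\<^sub>R z x) * cprodf F x"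
          proof (cases "x \<in> ?K")
            case False
            then have "x \<notin> cbox l r" using sub by blast
            then have "cprodf F x = 0" using prodf_eq_0[OF F, of x] by (simp add: cprodf_def)
            then show ?thesis by simp
          qed (use \<rho>(2) in auto)
        qed
        finally show ?thesis .
      qed
      have "(LINT x|lebesgue_on \<Omega>. u x * multi_partial \<alpha> (cprodf F) x) = (-1) ^ sum \<alpha> UNIV * (LINT x|lebesgue_on \<Omega>. z x * cprodf F x)"
        if "has_weak_derivative \<Omega> \<alpha> u z" for z
        using that t unfolding has_weak_derivative_def by blast
      from this[OF v(1)] this[OF v(2)]
      have "(-1) ^ sum \<alpha> UNIV * (LINT x|lebesgue_on \<Omega>. v x * cprodf F x) = (-1) ^ sum \<alpha> UNIV * (LINT x|lebesgue_on \<Omega>. v' x * cprodf F x)"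
        by simp
      then have "(LINT x|lebesgue. (indicator ?K x *\<^sub>R v x) * cprodf F x) = (LINT x|lebesgue. (indicator ?K x *\<^sub>R v' x) * cprodf F x)"
        by (simp add: restr)
      then have "(LINT x|lebesgue. w x * cprodf F x) = 0"
        unfolding w_def left_diff_distrib
        by (subst Bochner_Integration.integral_diff[OF bounded_int[OF int(1)] bounded_int[OF int(2)]]) simp
      also have "(LINT x|lebesgue. w x * cprodf F x) = (LINT x|lebesgue_on UNIV. w x * cprodf F x)"
        by (simp add: lebesgue_on_UNIV_eq)
      also have "\<dots> = (LINT x|lborel. f x * cprodf F x)"
      proof (rule lebesgue_on_transfer(1))
        show "(\<lambda>x. f x * cprodf F x) \<in> borel_measurable borel" using fm(1) Fm by (rule borel_measurable_times)
        show "(\<lambda>x. w x * cprodf F x) \<in> borel_measurable (lebesgue_on UNIV)"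
          using fm(2) Fl unfolding lebesgue_on_UNIV_eq by (rule borel_measurable_times)
        show "AE x in lborel. x \<in> UNIV \<longrightarrow> f x * cprodf F x = w x * cprodf F x" using fm(3) by eventually_elim auto
      qed auto
      finally show "(LINT y|lborel. f y * cprodf F y) = 0" .
    qed
    then have "AE x in lborel. x \<in> ball c (\<rho> / 2) \<longrightarrow> v x = v' x"
      using fm(3) by eventually_elim (use \<rho>(1) in \<open>auto simp: w_def\<close>)
    then show ?thesis using \<rho>(1) by (intro exI[of _ "\<rho> / 2"]) auto
  qed
  then obtain r where r: "\<And>c. c \<in> \<Omega> \<Longrightarrow> r c > 0" "\<And>c. c \<in> \<Omega> \<Longrightarrow> AE x in lborel. x \<in> ball c (r c) \<longrightarrow> v x = v' x" by metis
  obtain \<F> where \<F>: "\<F> \<subseteq> (\<lambda>c. ball c (r c)) ` \<Omega>" "countable \<F>" "\<Union>\<F> = \<Union>((\<lambda>c. ball c (r c)) ` \<Omega>)"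
    by (rule Lindelof[of "(\<lambda>c. ball c (r c)) ` \<Omega>"]) auto
  have "AE x in lborel. \<forall>S\<in>\<F>. x \<in> S \<longrightarrow> v x = v' x"
    unfolding AE_ball_countable[OF \<F>(2)] using \<F>(1) r(2) by auto
  then show ?thesis
  proof eventually_elim
    case (elim x)
    show ?case
    proof
      assume "x \<in> \<Omega>"
      then have "x \<in> ball x (r x)" using r(1) by simp
      then have "x \<in> \<Union>\<F>" unfolding \<F>(3) using \<open>x \<in> \<Omega>\<close> by blast
      then show "v x = v' x" using elim by auto
    qed
  qed
qed

text \<open>Measurability of \<open>v\<close> comes from that of \<open>u\<close> by completeness of
  Lebesgue measure. This is applied to the arbitrarily chosen weak derivative.\<close>

lemma Lp_norm_cong_AE:
  fixes u v :: "real^'n::finite \<Rightarrow> complex"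
  assumes \<Omega>: "open \<Omega>" and u: "u \<in> borel_measurable (lebesgue_on \<Omega>)" and ae: "AE x in lborel. x \<in> \<Omega> \<longrightarrow> u x = v x"
  shows "Lp_norm p \<Omega> v = Lp_norm p \<Omega> u"
proof -
  have \<Omega>l: "\<Omega> \<inter> space lebesgue \<in> sets lebesgue" "\<Omega> \<in> sets lebesgue" using \<Omega> by (auto simp: sets_completionI_sets)
  have "AE x in lebesgue. x \<in> \<Omega> \<longrightarrow> u x = v x" using ae by (simp add: AE_completion_iff)
  then have ae': "AE x in lebesgue_on \<Omega>. u x = v x" by (simp add: AE_restrict_space_iff[OF \<Omega>l(1)])
  have v: "v \<in> borel_measurable (lebesgue_on \<Omega>)"
  proof (rule borel_measurable_if_D, rule borel_measurable_AE[OF borel_measurable_if_I[OF u \<Omega>l(2)]])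
    show "AE x in lebesgue. (if x \<in> \<Omega> then u x else 0) = (if x \<in> \<Omega> then v x else 0)"
      using \<open>AE x in lebesgue. x \<in> \<Omega> \<longrightarrow> u x = v x\<close> by eventually_elim auto
  qed
  have "(LINT x|lebesgue_on \<Omega>. norm (v x) powr p) = (LINT x|lebesgue_on \<Omega>. norm (u x) powr p)"
    by (rule integral_cong_AE) (use u v ae' in \<open>auto\<close>)
  then show ?thesis by (simp add: Lp_norm_def)
qed

lemma Sobolev_data_exists:
  fixes \<Omega> :: "(real^'n::finite) set"
  assumes \<Omega>: "open \<Omega>" and p: "1 \<le> p" and u: "u \<in> Sobolev r p \<Omega>" and U: "borel_rep \<Omega> u U"
  obtains V where "V (\<lambda>_. 0) = U" "Sobolev_data r \<Omega> V" "energy r p V = ennreal (Sobolev_norm r p \<Omega> u powr p)"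
proof -
  have \<Omega>b: "\<Omega> \<in> sets borel" using \<Omega> by simp
  have uLp: "u \<in> Lp p \<Omega>" using u by (simp add: Sobolev_def)
  \<comment> \<open>The empty list is the only one with all counts 0, so the derivative of order 0
    is the function itself.\<close>
  have zero: "multi_partial (\<lambda>_. 0) \<phi> = \<phi>" for \<phi> :: "real^'n \<Rightarrow> complex"
  proof -
    have "(SOME xs. \<forall>i::'n. count_list xs i = 0) = []"
      by (rule some_equality) (auto simp: count_list_0_iff)
    then show ?thesis by (simp add: multi_partial_def)
  qed
  have "\<exists>v\<in>Lp p \<Omega>. has_weak_derivative \<Omega> \<alpha> u v" if "\<alpha> \<in> multi_indices r" for \<alpha>
    using u that by (auto simp: Sobolev_def multi_indices_def)
  then obtain v where v: "\<And>\<alpha>. \<alpha> \<in> multi_indices r \<Longrightarrow> v \<alpha> \<in> Lp p \<Omega>" "\<And>\<alpha>. \<alpha> \<in> multi_indices r \<Longrightarrow> has_weak_derivative \<Omega> \<alpha> u (v \<alpha>)"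
    by metis
  have mi0: "(\<lambda>_. 0) \<in> (multi_indices r :: ('n \<Rightarrow> nat) set)" by (simp add: multi_indices_def)
  have u0: "has_weak_derivative \<Omega> (\<lambda>_. 0) u u"
    using v(2)[OF mi0] by (simp add: has_weak_derivative_def zero)
  \<comment> \<open>At order 0 the witness is replaced by \<open>u\<close>, which is its own
    derivative of order 0, so that the family can start with the given representative
    \<open>U\<close> exactly and not merely almost everywhere.\<close>
  define v0 where "v0 = v((\<lambda>_. 0) := u)"
  have v0: "v0 \<alpha> \<in> Lp p \<Omega>" "has_weak_derivative \<Omega> \<alpha> u (v0 \<alpha>)" if "\<alpha> \<in> multi_indices r" for \<alpha>
    using v[OF that] u0 uLp by (auto simp: v0_def)
  have "\<exists>V. borel_rep \<Omega> (v0 \<alpha>) V" if "\<alpha> \<in> multi_indices r" for \<alpha>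
    using borel_rep_exists[OF _ \<Omega>b, of "v0 \<alpha>"] v0(1)[OF that] by (auto simp: Lp_def)
  then obtain V' where V': "\<And>\<alpha>. \<alpha> \<in> multi_indices r \<Longrightarrow> borel_rep \<Omega> (v0 \<alpha>) (V' \<alpha>)" by metis
  define V where "V = V'((\<lambda>_. 0) := U)"
  have V: "borel_rep \<Omega> (v0 \<alpha>) (V \<alpha>)" if "\<alpha> \<in> multi_indices r" for \<alpha>
    using V'[OF that] U by (auto simp: V_def v0_def)
  have p0: "p > 0" using p by simp
  show ?thesis
  proof (rule that)
    show V0: "V (\<lambda>_. 0) = U" by (simp add: V_def)
    show "Sobolev_data r \<Omega> V"
      unfolding Sobolev_data_def V0
    proof (intro ballI conjI)
      fix \<alpha> :: "'n \<Rightarrow> nat" assume \<alpha>: "\<alpha> \<in> multi_indices r"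
      have "Lpow p (V \<alpha>) < top" using borel_rep_Lp(1)[OF \<Omega>b V[OF \<alpha>] p0] v0(1)[OF \<alpha>] by simp
      then show "loc_int (V \<alpha>)" using V[OF \<alpha>] p by (intro loc_int_Lpow) (auto simp: borel_rep_def)
      show "wder \<Omega> \<alpha> U (V \<alpha>)" by (rule wder_borel_rep[OF \<Omega> v0(2)[OF \<alpha>] U V[OF \<alpha>]])
    qed
    have "Lpow p (V \<alpha>) = ennreal (Lp_norm p \<Omega> (weak_derivative \<Omega> \<alpha> u) powr p)" if \<alpha>: "\<alpha> \<in> multi_indices r" for \<alpha>
    proof -
      have "has_weak_derivative \<Omega> \<alpha> u (weak_derivative \<Omega> \<alpha> u)"
        unfolding weak_derivative_def by (rule someI[of "has_weak_derivative \<Omega> \<alpha> u", OF v0(2)[OF \<alpha>]])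
      then have "AE x in lborel. x \<in> \<Omega> \<longrightarrow> v0 \<alpha> x = weak_derivative \<Omega> \<alpha> u x"
        by (rule has_weak_derivative_unique[OF \<Omega> v0(2)[OF \<alpha>]])
      then have "Lp_norm p \<Omega> (weak_derivative \<Omega> \<alpha> u) = Lp_norm p \<Omega> (v0 \<alpha>)"
        using v0(1)[OF \<alpha>] by (intro Lp_norm_cong_AE[OF \<Omega>]) (auto simp: Lp_def)
      then show ?thesis using borel_rep_Lp(2)[OF \<Omega>b V[OF \<alpha>] p0 v0(1)[OF \<alpha>]] by simp
    qed
    then have "energy r p V = (\<Sum>\<alpha>\<in>multi_indices r. ennreal (Lp_norm p \<Omega> (weak_derivative \<Omega> \<alpha> u) powr p))"
      unfolding energy_def by (intro sum.cong) auto
    also have "\<dots> = ennreal (\<Sum>\<alpha>\<in>multi_indices r. Lp_norm p \<Omega> (weak_derivative \<Omega> \<alpha> u) powr p)" by simp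
    also have "(\<Sum>\<alpha>\<in>multi_indices r. Lp_norm p \<Omega> (weak_derivative \<Omega> \<alpha> u) powr p) = Sobolev_norm r p \<Omega> u powr p"
      unfolding Sobolev_norm_def multi_indices_def using p by (simp add: powr_powr sum_nonneg)
    finally show "energy r p V = ennreal (Sobolev_norm r p \<Omega> u powr p)" .
  qed
qed

section \<open>The product estimate\<close>

text \<open>Morrey spaces give measurability on bounded parts of \<Omega>; on all of \<Omega> the
  function is the pointwise limit of its cut-offs to growing balls.\<close>

lemma Lp_Int_ball_imp_measurable:
  fixes g :: "real^'n::finite \<Rightarrow> complex"
  assumes g: "\<And>x R. g \<in> Lp q (\<Omega> \<inter> ball x R)" and \<Omega>: "open \<Omega>"
  shows "g \<in> borel_measurable (lebesgue_on \<Omega>)"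
proof (rule borel_measurable_if_D, rule borel_measurable_LIMSEQ_metric)
  fix m :: nat
  have "g \<in> borel_measurable (lebesgue_on (\<Omega> \<inter> ball 0 (real m)))" using g by (simp add: Lp_def)
  moreover have "\<Omega> \<inter> ball 0 (real m) \<in> sets lebesgue" using \<Omega> by (simp add: sets_completionI_sets)
  ultimately show "(\<lambda>x. if x \<in> \<Omega> \<inter> ball 0 (real m) then g x else 0) \<in> borel_measurable lebesgue"
    by (rule borel_measurable_if_I)
next
  fix x :: "real^'n"
  obtain N :: nat where N: "norm x < N" using reals_Archimedean2 by blast
  have "eventually (\<lambda>m. (if x \<in> \<Omega> then g x else 0) = (if x \<in> \<Omega> \<inter> ball 0 (real m) then g x else 0)) sequentially"
    using eventually_ge_at_top[of N] by eventually_elim (use N in auto)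
  then show "(\<lambda>m. if x \<in> \<Omega> \<inter> ball 0 (real m) then g x else 0) \<longlonglongrightarrow> (if x \<in> \<Omega> then g x else 0)"
    by (rule Lim_transform_eventually[OF tendsto_const])
qed

lemma norm_add_powr_le:
  fixes a b :: "'a::real_normed_vector"
  assumes "0 < p"
  shows "norm (a + b) powr p \<le> 2 powr p * (norm a powr p + norm b powr p)"
proof -
  have "norm (a + b) powr p \<le> (2 * max (norm a) (norm b)) powr p"
    using assms norm_triangle_ineq[of a b] by (intro powr_mono2) auto
  also have "\<dots> = 2 powr p * max (norm a) (norm b) powr p" by (rule powr_mult)
  also have "\<dots> \<le> 2 powr p * (norm a powr p + norm b powr p)"
    by (intro mult_left_mono) (auto simp: max_def)
  finally show ?thesis .
qed

text \<open>From \<open>z powr p = z * z powr (p - 1)\<close> and monotonicity of the second factor.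
  It turns a sum of \<open>p\<close>-th powers back into the power of a sum before the root is
  taken, in place of Minkowski's inequality.\<close>

lemma powr_add_le:
  assumes "0 \<le> a" "0 \<le> b" "1 \<le> (p::real)"
  shows "a powr p + b powr p \<le> (a + b) powr p"
proof (cases "a + b = 0")
  case True
  then have "a = 0" "b = 0" using assms by linarith+
  then show ?thesis by simp
next
  case False
  then have pos: "a + b > 0" using assms by linarith
  have le: "z powr p \<le> z * (a + b) powr (p - 1)" if "0 \<le> z" "z \<le> a + b" for z
  proof -
    have "z powr p = z * z powr (p - 1)" using that(1) by (cases "z = 0") (auto simp: powr_diff)
    also have "\<dots> \<le> z * (a + b) powr (p - 1)" using that assms(3) by (intro mult_left_mono powr_mono2) auto
    finally show ?thesis .
  qed
  have "a powr p + b powr p \<le> a * (a + b) powr (p - 1) + b * (a + b) powr (p - 1)"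
    using assms by (intro add_mono le) auto
  also have "\<dots> = (a + b) * (a + b) powr (p - 1)" by (simp only: distrib_right)
  also have "\<dots> = (a + b) powr p" using pos by (simp add: powr_diff)
  finally show ?thesis .
qed

lemma Lp_diff:
  assumes "g \<in> Lp q B" "h \<in> Lp q B" "0 < q"
  shows "(\<lambda>x. g x - h x) \<in> Lp q B"
proof -
  have [measurable]: "g \<in> borel_measurable (lebesgue_on B)" "h \<in> borel_measurable (lebesgue_on B)"
    using assms by (auto simp: Lp_def)
  have "integrable (lebesgue_on B) (\<lambda>x. norm (g x - h x) powr q)"
  proof (rule Bochner_Integration.integrable_bound)
    show "integrable (lebesgue_on B) (\<lambda>x. 2 powr q * (norm (g x) powr q + norm (h x) powr q))"
      using assms by (auto simp: Lp_def)
    show "AE x in lebesgue_on B. norm (norm (g x - h x) powr q) \<le> norm (2 powr q * (norm (g x) powr q + norm (h x) powr q))"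
      using norm_add_powr_le[OF assms(3), of "g x" "- h x" for x] by (intro AE_I2) simp
  qed measurable
  then show ?thesis by (simp add: Lp_def)
qed

lemma borel_rep_subset:
  assumes "borel_rep \<Omega> u U" "A \<subseteq> \<Omega>" "A \<in> sets borel" "\<Omega> \<in> sets borel"
  shows "borel_rep A u (\<lambda>x. indicator A x *\<^sub>R U x)"
proof -
  have [measurable]: "U \<in> borel_measurable borel" "A \<in> sets borel" using assms by (auto simp: borel_rep_def)
  have "u \<in> borel_measurable (lebesgue_on A)"
    by (rule measurable_restrict_mono[OF _ assms(2)]) (use assms(1) in \<open>unfold borel_rep_def, blast\<close>)
  moreover have "AE x in lborel. x \<in> \<Omega> \<longrightarrow> U x = u x" using assms(1) by (simp add: borel_rep_def)
  then have "AE x in lborel. x \<in> A \<longrightarrow> indicator A x *\<^sub>R U x = u x"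
    by eventually_elim (use assms(2) in auto)
  moreover have "(\<lambda>x. indicator A x *\<^sub>R U x) \<in> borel_measurable borel" by measurable
  ultimately show ?thesis unfolding borel_rep_def by simp
qed

lemma borel_rep_mult:
  assumes "borel_rep \<Omega> u U" "borel_rep \<Omega> v V"
  shows "borel_rep \<Omega> (\<lambda>x. u x * v x) (\<lambda>x. U x * V x)"
proof -
  have "AE x in lborel. x \<in> \<Omega> \<longrightarrow> U x = u x" "AE x in lborel. x \<in> \<Omega> \<longrightarrow> V x = v x"
    using assms by (auto simp: borel_rep_def)
  then have "AE x in lborel. x \<in> \<Omega> \<longrightarrow> U x * V x = u x * v x" by eventually_elim auto
  then show ?thesis using assms by (auto simp: borel_rep_def)
qed

lemma borel_rep_diff:
  assumes "borel_rep \<Omega> u U" "borel_rep \<Omega> v V"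
  shows "borel_rep \<Omega> (\<lambda>x. u x - v x) (\<lambda>x. U x - V x)"
proof -
  have "AE x in lborel. x \<in> \<Omega> \<longrightarrow> U x = u x" "AE x in lborel. x \<in> \<Omega> \<longrightarrow> V x = v x"
    using assms by (auto simp: borel_rep_def)
  then have "AE x in lborel. x \<in> \<Omega> \<longrightarrow> U x - V x = u x - v x" by eventually_elim auto
  then show ?thesis using assms by (auto simp: borel_rep_def)
qed

text \<open>Division by the upper bound \<delta> normalises the norm to at most 1. In dimension
  \<open>n\<close> the exponents fit because \<open>(\<sigma> - n / q) * q\<close> and
  \<open>n - \<sigma> * q\<close> add up to 0.\<close>

lemma morrey_le_Morrey_norm:
  fixes \<Omega> :: "(real^'n::finite) set" and f :: "real^'n \<Rightarrow> complex"
  assumes \<Omega>: "open \<Omega>" and q: "0 < q" and \<delta>: "0 < \<delta>" and f: "\<And>x R. f \<in> Lp q (\<Omega> \<inter> ball x R)"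
    and M: "Morrey_norm d q \<sigma> \<Omega> f < ennreal \<delta>" and F: "borel_rep \<Omega> f F"
  shows "morrey_le d q \<sigma> \<Omega> (\<lambda>x. norm (F x) / \<delta>)"
  unfolding morrey_le_def
proof (intro ballI allI impI, elim conjE)
  fix x \<rho> assume x: "x \<in> \<Omega>" and \<rho>: "0 < \<rho>" "\<rho> \<le> d"
  let ?n = "real CARD('n)" and ?B = "ball x \<rho> \<inter> \<Omega>"
  have Bs [measurable]: "?B \<in> sets borel" "\<Omega> \<in> sets borel" using \<Omega> by auto
  have [measurable]: "F \<in> borel_measurable borel" using F by (simp add: borel_rep_def)
  have rep: "borel_rep ?B f (\<lambda>x. indicator ?B x *\<^sub>R F x)" by (rule borel_rep_subset[OF F _ Bs]) auto
  have fB: "f \<in> Lp q ?B" using f[of x \<rho>] by (simp add: Int_commute)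
  have "ennreal (\<rho> powr (\<sigma> - ?n / q) * Lp_norm q ?B f) \<le> Morrey_norm d q \<sigma> \<Omega> f"
    unfolding Morrey_norm_def by (rule SUP_upper2[of "(x, \<rho>)"]) (use x \<rho> in auto)
  then have "ennreal (\<rho> powr (\<sigma> - ?n / q) * Lp_norm q ?B f) < ennreal \<delta>" using M by (rule le_less_trans)
  then have "\<rho> powr (\<sigma> - ?n / q) * Lp_norm q ?B f < \<delta>" by (simp add: ennreal_less_iff Lp_norm_nonneg)
  then have "(\<rho> powr (\<sigma> - ?n / q) * Lp_norm q ?B f) powr q \<le> \<delta> powr q"
    using q by (intro powr_mono2) (auto simp: Lp_norm_nonneg)
  then have le: "\<rho> powr ((\<sigma> - ?n / q) * q) * Lp_norm q ?B f powr q \<le> \<delta> powr q"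
    by (simp add: powr_mult powr_powr)
  have "(\<integral>\<^sup>+y. indicator (ball x \<rho>) y * ennreal ((norm (F y) / \<delta>) powr q) \<partial>lborel) = (\<integral>\<^sup>+y. ennreal (1 / \<delta> powr q) * ennreal (norm (indicator ?B y *\<^sub>R F y) powr q) \<partial>lborel)"
  proof (rule nn_integral_cong)
    fix y
    have "F y = 0" if "y \<notin> \<Omega>" using F that by (simp add: borel_rep_def)
    then show "indicator (ball x \<rho>) y * ennreal ((norm (F y) / \<delta>) powr q) = ennreal (1 / \<delta> powr q) * ennreal (norm (indicator ?B y *\<^sub>R F y) powr q)"
      using \<delta> q by (cases "y \<in> \<Omega>") (auto simp: indicator_def powr_divide simp flip: ennreal_mult)
  qed
  also have "\<dots> = ennreal (1 / \<delta> powr q) * Lpow q (\<lambda>y. indicator ?B y *\<^sub>R F y)"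
    unfolding Lpow_def by (intro nn_integral_cmult) measurable
  also have "\<dots> = ennreal (1 / \<delta> powr q * Lp_norm q ?B f powr q)"
    using borel_rep_Lp(2)[OF Bs(1) rep q fB] by (simp flip: ennreal_mult)
  also have "\<dots> \<le> ennreal (\<rho> powr (?n - \<sigma> * q))"
  proof (rule ennreal_leI)
    have "\<rho> powr (?n - \<sigma> * q) * (\<rho> powr ((\<sigma> - ?n / q) * q) * Lp_norm q ?B f powr q) \<le> \<rho> powr (?n - \<sigma> * q) * \<delta> powr q"
      by (intro mult_left_mono le) auto
    moreover have "\<rho> powr (?n - \<sigma> * q) * \<rho> powr ((\<sigma> - ?n / q) * q) = 1"
    proof -
      have "(?n - \<sigma> * q) + (\<sigma> - ?n / q) * q = 0" using q by (simp add: field_simps)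
      then show ?thesis using \<rho> by (simp flip: powr_add)
    qed
    ultimately have "Lp_norm q ?B f powr q \<le> \<rho> powr (?n - \<sigma> * q) * \<delta> powr q"
      by (simp only: mult.assoc[symmetric] mult_1)
    then show "1 / \<delta> powr q * Lp_norm q ?B f powr q \<le> \<rho> powr (?n - \<sigma> * q)"
      using \<delta> by (simp add: pos_divide_le_eq)
  qed
  finally show "(\<integral>\<^sup>+y. indicator (ball x \<rho>) y * ennreal ((norm (F y) / \<delta>) powr q) \<partial>lborel) \<le> ennreal (\<rho> powr (?n - \<sigma> * q))" .
qed

theorem lemma4p2:
  fixes d p q s :: real and r :: nat
    and \<Omega> :: "(real^'n) set" and g :: "real^'n \<Rightarrow> complex"
  assumes "d > 0"
    and "open \<Omega>" and "cone_condition d \<Omega>"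
    and "r \<ge> 1" and "1 \<le> p" and "p \<le> q"
    and "q \<ge> real CARD('n) / real r"
    and "real CARD('n) / real r = p \<and> p > 1 \<Longrightarrow> q > real CARD('n) / real r"
    and "s \<le> p"
    and "g \<in> Morrey_tilde d q (s / p) \<Omega>"
  shows "\<forall>\<epsilon>>0. \<exists>c>0. \<forall>u \<in> Sobolev r p \<Omega>.
           (\<lambda>x. g x * u x) \<in> Lp p \<Omega> \<and>
           Lp_norm p \<Omega> (\<lambda>x. g x * u x) \<le> \<epsilon> * Sobolev_norm r p \<Omega> u + c * Lp_norm p \<Omega> u"
proof (intro allI impI)
  fix \<epsilon> :: real assume \<epsilon>: "\<epsilon> > 0"
  note p = \<open>1 \<le> p\<close> and \<Omega> = \<open>open \<Omega>\<close>
  have p0: "p > 0" and q0: "q > 0" using assms(5,6) by auto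
  have \<Omega>b: "\<Omega> \<in> sets borel" using \<Omega> by simp
  have \<sigma>: "s / p \<le> 1" using assms(9) p0 by simp
  obtain C where C: "C \<ge> 0" "\<And>G V. G \<in> borel_measurable borel \<Longrightarrow> (\<forall>x. (0::real) \<le> G x) \<Longrightarrow> (\<forall>x. x \<notin> \<Omega> \<longrightarrow> G x = 0) \<Longrightarrow> morrey_le d q (s / p) \<Omega> G \<Longrightarrow>
    Sobolev_data r \<Omega> V \<Longrightarrow> (\<integral>\<^sup>+x. ennreal (G x powr p) * ennreal (norm (V (\<lambda>_. 0) x) powr p) \<partial>lborel) \<le> ennreal C * energy r p V"
    using Sobolev_data_bound[OF assms(1-8) \<sigma>] by blast
  define K where "K = C powr (1 / p)"
  have K: "K \<ge> 0" "K powr p = C" using C(1) p0 by (auto simp: K_def powr_powr)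
  \<comment> \<open>The 2 compensates for the factor \<open>2 powr p\<close> lost when the product
    is split into two summands; the added 1 avoids a division by zero if
    \<open>K = 0\<close>.\<close>
  define \<delta> where "\<delta> = \<epsilon> / (2 * (K + 1))"
  have \<delta>: "\<delta> > 0" "2 * (\<delta> * K) \<le> \<epsilon>" using \<epsilon> K(1) by (auto simp: \<delta>_def field_simps)
  have gM: "\<And>x R. g \<in> Lp q (\<Omega> \<inter> ball x R)" using assms(10) by (simp add: Morrey_tilde_def Morrey_def)
  obtain h where h: "h \<in> L_infinity \<Omega>" "h \<in> Morrey d q (s / p) \<Omega>" "Morrey_norm d q (s / p) \<Omega> (\<lambda>x. g x - h x) < ennreal \<delta>"
    using assms(10) \<delta>(1) by (auto simp: Morrey_tilde_def)
  have hM: "\<And>x R. h \<in> Lp q (\<Omega> \<inter> ball x R)" using h(2) by (simp add: Morrey_def)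
  have gm: "g \<in> borel_measurable (lebesgue_on \<Omega>)" by (rule Lp_Int_ball_imp_measurable[OF gM \<Omega>])
  have hm: "h \<in> borel_measurable (lebesgue_on \<Omega>)" using h(1) by (simp add: L_infinity_def)
  obtain g' where g': "borel_rep \<Omega> g g'" by (rule borel_rep_exists[OF gm \<Omega>b])
  obtain h' where h': "borel_rep \<Omega> h h'" by (rule borel_rep_exists[OF hm \<Omega>b])
  have [measurable]: "g' \<in> borel_measurable borel" "h' \<in> borel_measurable borel" using g' h' by (auto simp: borel_rep_def)
  define G where "G x = norm (g' x - h' x) / \<delta>" for x
  have morrey_G: "morrey_le d q (s / p) \<Omega> G"
    unfolding G_def by (rule morrey_le_Morrey_norm[OF \<Omega> q0 \<delta>(1) Lp_diff[OF gM hM q0] h(3) borel_rep_diff[OF g' h']])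
  have G: "G \<in> borel_measurable borel" "\<forall>x. 0 \<le> G x" "\<forall>x. x \<notin> \<Omega> \<longrightarrow> G x = 0"
    using \<delta>(1) g' h' unfolding G_def by (auto simp: borel_rep_def)
  note [measurable] = G(1)
  obtain H where H: "H \<ge> 0" "AE x in lborel. norm (h' x) \<le> H"
  proof -
    obtain H where "AE x in lebesgue_on \<Omega>. norm (h x) \<le> H" using h(1) by (auto simp: L_infinity_def)
    then have "AE x in lborel. x \<in> \<Omega> \<longrightarrow> norm (h x) \<le> H"
      using \<Omega>b by (simp add: AE_restrict_space_iff sets_completionI_sets AE_completion_iff)
    moreover have "AE x in lborel. x \<in> \<Omega> \<longrightarrow> h' x = h x" using h' by (simp add: borel_rep_def)
    \<comment> \<open>The essential bound concerns \<Omega> only and could be negative if \<Omega>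
      is empty; the maximum with 0 also covers the points outside, where the representative is
      0.\<close>
    ultimately have "AE x in lborel. norm (h' x) \<le> max 0 H"
      by eventually_elim (use h' in \<open>force simp: borel_rep_def\<close>)
    then show ?thesis by (intro that[of "max 0 H"]) auto
  qed
  show "\<exists>c>0. \<forall>u \<in> Sobolev r p \<Omega>. (\<lambda>x. g x * u x) \<in> Lp p \<Omega> \<and>
           Lp_norm p \<Omega> (\<lambda>x. g x * u x) \<le> \<epsilon> * Sobolev_norm r p \<Omega> u + c * Lp_norm p \<Omega> u"
  \<comment> \<open>The constant depends on \<epsilon> through the choice of the bounded part
    \<open>h\<close> and hence through its bound \<open>H\<close>; the 1 makes it positive even for
    \<open>H = 0\<close>.\<close>
  proof (intro exI[of _ "2 * H + 1"] conjI ballI)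
    show "2 * H + 1 > 0" using H(1) by simp
    fix u assume u: "u \<in> Sobolev r p \<Omega>"
    then have uLp: "u \<in> Lp p \<Omega>" by (simp add: Sobolev_def)
    then have "u \<in> borel_measurable (lebesgue_on \<Omega>)" by (simp add: Lp_def)
    then obtain U where U: "borel_rep \<Omega> u U" by (rule borel_rep_exists[OF _ \<Omega>b])
    have [measurable]: "U \<in> borel_measurable borel" using U by (simp add: borel_rep_def)
    obtain V where V: "V (\<lambda>_. 0) = U" "Sobolev_data r \<Omega> V" "energy r p V = ennreal (Sobolev_norm r p \<Omega> u powr p)"
      by (rule Sobolev_data_exists[OF \<Omega> p u U])
    define S where "S = Sobolev_norm r p \<Omega> u"
    define T where "T = Lp_norm p \<Omega> u"
    have S: "S \<ge> 0" by (simp add: S_def Sobolev_norm_def)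
    have T: "T \<ge> 0" by (simp add: T_def Lp_norm_nonneg)
    note rep = borel_rep_mult[OF g' U]
    have IG: "(\<integral>\<^sup>+x. ennreal ((norm (g' x - h' x) * norm (U x)) powr p) \<partial>lborel) \<le> ennreal ((\<delta> * K * S) powr p)"
    proof -
      have "(\<integral>\<^sup>+x. ennreal ((norm (g' x - h' x) * norm (U x)) powr p) \<partial>lborel) = (\<integral>\<^sup>+x. ennreal (\<delta> powr p) * (ennreal (G x powr p) * ennreal (norm (U x) powr p)) \<partial>lborel)"
        using \<delta>(1) by (intro nn_integral_cong) (simp add: G_def powr_divide powr_mult flip: ennreal_mult)
      also have "\<dots> = ennreal (\<delta> powr p) * (\<integral>\<^sup>+x. ennreal (G x powr p) * ennreal (norm (U x) powr p) \<partial>lborel)"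
        by (intro nn_integral_cmult) measurable
      also have "\<dots> \<le> ennreal (\<delta> powr p) * (ennreal C * ennreal (S powr p))"
        using C(2)[OF G morrey_G V(2)] V(1,3) by (intro mult_left_mono) (auto simp: S_def)
      also have "\<dots> = ennreal ((\<delta> * K * S) powr p)"
        using C(1) K(2) by (simp add: powr_mult mult.assoc flip: ennreal_mult)
      finally show ?thesis .
    qed
    have IH: "(\<integral>\<^sup>+x. ennreal ((norm (h' x) * norm (U x)) powr p) \<partial>lborel) \<le> ennreal ((H * T) powr p)"
    proof -
      have "(\<integral>\<^sup>+x. ennreal ((norm (h' x) * norm (U x)) powr p) \<partial>lborel) \<le> (\<integral>\<^sup>+x. ennreal (H powr p) * ennreal (norm (U x) powr p) \<partial>lborel)"
      proof (rule nn_integral_mono_AE)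
        show "AE x in lborel. ennreal ((norm (h' x) * norm (U x)) powr p) \<le> ennreal (H powr p) * ennreal (norm (U x) powr p)"
          using H(2)
        proof eventually_elim
          case (elim x)
          then have "norm (h' x) powr p \<le> H powr p" using p0 by (intro powr_mono2) auto
          then show ?case by (simp add: powr_mult mult_right_mono ennreal_leI flip: ennreal_mult)
        qed
      qed
      also have "\<dots> = ennreal (H powr p) * Lpow p U" unfolding Lpow_def by (intro nn_integral_cmult) measurable
      also have "\<dots> = ennreal ((H * T) powr p)"
        using borel_rep_Lp(2)[OF \<Omega>b U p0 uLp] by (simp add: T_def powr_mult flip: ennreal_mult)
      finally show ?thesis .
    qed
    have "Lpow p (\<lambda>x. g' x * U x) \<le> (\<integral>\<^sup>+x. ennreal (2 powr p) * (ennreal ((norm (g' x - h' x) * norm (U x)) powr p) + ennreal ((norm (h' x) * norm (U x)) powr p)) \<partial>lborel)"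
      unfolding Lpow_def
    proof (rule nn_integral_mono)
      fix x
      have "g' x * U x = (g' x - h' x) * U x + h' x * U x" by (simp add: algebra_simps)
      then have "norm (g' x * U x) powr p \<le> 2 powr p * ((norm (g' x - h' x) * norm (U x)) powr p + (norm (h' x) * norm (U x)) powr p)"
        using norm_add_powr_le[OF p0, of "(g' x - h' x) * U x" "h' x * U x"] by (simp only: norm_mult)
      then show "ennreal (norm (g' x * U x) powr p) \<le> ennreal (2 powr p) * (ennreal ((norm (g' x - h' x) * norm (U x)) powr p) + ennreal ((norm (h' x) * norm (U x)) powr p))"
        by (simp add: ennreal_leI flip: ennreal_mult ennreal_plus)
    qed
    also have "\<dots> = ennreal (2 powr p) * ((\<integral>\<^sup>+x. ennreal ((norm (g' x - h' x) * norm (U x)) powr p) \<partial>lborel) + (\<integral>\<^sup>+x. ennreal ((norm (h' x) * norm (U x)) powr p) \<partial>lborel))"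
      by (simp add: nn_integral_cmult nn_integral_add)
    also have "\<dots> \<le> ennreal (2 powr p) * (ennreal ((\<delta> * K * S) powr p) + ennreal ((H * T) powr p))"
      by (intro mult_left_mono add_mono IG IH) auto
    also have "\<dots> = ennreal (2 powr p * ((\<delta> * K * S) powr p + (H * T) powr p))"
      by (simp flip: ennreal_mult ennreal_plus)
    finally have bound: "Lpow p (\<lambda>x. g' x * U x) \<le> ennreal (2 powr p * ((\<delta> * K * S) powr p + (H * T) powr p))" .
    \<comment> \<open>Membership precedes the norm estimate: for a product whose power is not
      integrable \<open>Lp_norm\<close> would be 0 and the estimate would say nothing.\<close>
    then show mem: "(\<lambda>x. g x * u x) \<in> Lp p \<Omega>"
      using borel_rep_Lp(1)[OF \<Omega>b rep p0] by (simp add: le_less_trans)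
    define X where "X = Lp_norm p \<Omega> (\<lambda>x. g x * u x)"
    have X: "X \<ge> 0" by (simp add: X_def Lp_norm_nonneg)
    have a: "\<delta> * K * S \<ge> 0" "H * T \<ge> 0" using \<delta>(1) K(1) S H(1) T by auto
    have "ennreal (X powr p) \<le> ennreal (2 powr p * ((\<delta> * K * S) powr p + (H * T) powr p))"
      using bound borel_rep_Lp(2)[OF \<Omega>b rep p0 mem] by (simp add: X_def)
    then have "X powr p \<le> 2 powr p * ((\<delta> * K * S) powr p + (H * T) powr p)" by (simp add: ennreal_le_iff)
    also have "(\<delta> * K * S) powr p + (H * T) powr p \<le> (\<delta> * K * S + H * T) powr p"
      by (rule powr_add_le) (use a p in auto)
    finally have "X powr p \<le> (2 * (\<delta> * K * S + H * T)) powr p"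
      by (simp only: powr_mult mult_left_mono powr_ge_zero)
    then have "X \<le> 2 * (\<delta> * K * S + H * T)"
      using p0 X a by (metis add_nonneg_nonneg mult_nonneg_nonneg not_le powr_less_mono2 zero_le_numeral)
    also have "\<dots> = 2 * (\<delta> * K) * S + 2 * H * T" by (simp add: algebra_simps)
    also have "\<dots> \<le> \<epsilon> * S + (2 * H + 1) * T"
      using \<delta>(2) S T by (intro add_mono mult_right_mono) auto
    finally show "Lp_norm p \<Omega> (\<lambda>x. g x * u x) \<le> \<epsilon> * Sobolev_norm r p \<Omega> u + (2 * H + 1) * Lp_norm p \<Omega> u"
      by (simp add: X_def S_def T_def)
  qed
qed

end
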